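(* Consider problem (P) and the sequences generated by Algorithm 1, both described in the context. Suppose that $\Phi_{\lambda,\mu}$ is a KL function, that Assumptions 1 and 2 (stated in the context) hold, and that there exists $c_s>0$ such that for all $k\ge\widetilde k$ (with $\widetilde k$ as in the context) $${\rm dist}\big(0,\partial\Phi_{\lambda,\mu}(\overline U^{k+1},\overline V^{k+1})\big)\le c_s\big(\|\overline X^{k+1}-\overline X^k\|_F+\|\widehat X^{k+1}-\overline X^{k+1}\|_F\big)+c_s\big(\|U^{k+1}-\overline U^k\|_F+\|V^{k+1}-\widehat V^{k+1}\|_F\big).$$ Then the sequences $\{\overline X^k\}$ and $\{\widehat X^k\}$ converge to the same point, say $X^*$. Moreover, with $(P^*,Q^* )\in\mathbb O^{n,m}(X^* )$ and $P_1^*$, $Q_1^*$ the matrices obtained by deleting the last $n-r$ columns of $P^*$ and the last $m-r$ columns of $Q^*$, respectively, the pair $\big(P_1^*(\Sigma_r(X^* ))^{1/2},Q_1^*(\Sigma_r(X^* ))^{1/2}\big)$ is a stationary point of problem (P). Furthermore, $$\lim_{k\to\infty}{\rm col}(U^k)=\lim_{k\to\infty}{\rm col}(\overline U^k)=\lim_{k\to\infty}{\rm col}(\widehat U^k)={\rm col}(X^* ),$$ $$\lim_{k\to\infty}{\rm col}(V^k)=\lim_{k\to\infty}{\rm col}(\overline V^k)=\lim_{k\to\infty}{\rm col}(\widehat V^k)={\rm row}(X^* ),$$ where the set convergence is in the sense of Painlevé–Kuratowski.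
   Context: **Notation.** $n\le m$ and $r\in[n]:=\{1,\dots,n\}$ are fixed integers, $\mathbb X_r:=\mathbb R^{n\times r}\times\mathbb R^{m\times r}$, and $l$ stands for $n$ or $m$. $\|\cdot\|_F$ is the Frobenius norm, and $\|\cdot\|$ is the spectral norm of a matrix or the Euclidean norm of a vector. $\mathbb O^{a\times b}$ is the set of $a\times b$ real matrices with orthonormal columns, and $\mathbb O^a:=\mathbb O^{a\times a}$. $Z_i$ is the $i$-th column of a matrix $Z$, $J_Z$ is the index set of its nonzero columns, $\|Z\|_{2,0}:=|J_Z|$, and ${\rm col}(Z)$, ${\rm row}(Z)$ are the subspaces spanned by the columns and by the rows of $Z$. Singular values are ordered $\sigma_1(X)\ge\sigma_2(X)\ge\cdots$, $\sigma(X)$ is the vector of singular values, $\Sigma_\kappa(X):={\rm Diag}(\sigma_1(X),\dots,\sigma_\kappa(X))$, and for $X\in\mathbb R^{n\times m}$, $\mathbb O^{n,m}(X):=\{(P,Q)\in\mathbb O^n\times\mathbb O^m : X=P[{\rm Diag}(\sigma(X))\ \ 0]Q^\top\}$. **Problem (P).** Minimize over $(U,V)\in\mathbb X_r$ the function $\Phi_{\lambda,\mu}(U,V):=f(UV^\top)+\lambda[\vartheta(U)+\vartheta(V)]+\frac{\mu}{2}[\|U\|_F^2+\|V\|_F^2]$, where $\lambda,\mu>0$; $f:\mathbb R^{n\times m}\to\mathbb R$ is bounded below and differentiable with $\nabla f$ Lipschitz continuous with modulus $L_f$; $\vartheta(W):=\sum_i\theta(\|W_i\|)$ (sum over all columns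 of $W$); and $\theta:\mathbb R\to(-\infty,\infty]$ is proper and lower semicontinuous with (C.1) $\theta(0)=0$, $\theta(t)>0$ for $t>0$, $\theta(t)=\infty$ for $t<0$; (C.2) $\theta$ is differentiable on $(0,\infty)$ and its proximal mapping has a closed form. **Majorization.** $\widehat\Phi_{\lambda,\mu}(U,V,U',V'):=f(U'V'^\top)+\langle\nabla f(U'V'^\top),UV^\top-U'V'^\top\rangle+\frac{L_f}{2}\|UV^\top-U'V'^\top\|_F^2+\lambda[\vartheta(U)+\vartheta(V)]+\frac{\mu}{2}(\|U\|_F^2+\|V\|_F^2)$. **Algorithm 1.** Parameters $\varrho\in(0,1)$, $\underline{\gamma_1},\underline{\gamma_2}>0$, $\gamma_{1,0},\gamma_{2,0}>0$; write $\underline\gamma:=\min\{\underline{\gamma_1},\underline{\gamma_2}\}$. Choose $\overline P^0\in\mathbb O^{m\times r}$, $\widehat P^0\in\mathbb O^{n\times r}$, $\overline Q^0=\overline D^0=I_r$, $(\overline U^0,\overline V^0)=(\widehat P^0,\overline P^0)$, $\overline X^0=\overline U^0(\overline V^0)^\top$. For $k=0,1,2,\dots$: 1. $U^{k+1}\in\arg\min_{U\in\mathbb R^{n\times r}}\{\widehat\Phi_{\lambda,\mu}(U,\overline V^k,\overline U^k,\overline V^k)+\frac{\gamma_{1,k}}{2}\|U-\overline U^k\|_F^2\}$. 2. Take a thin SVD $U^{k+1}\overline D^k=\widehat P^{k+1}(\widehat D^{k+1})^2(\widehat Q^{k+1})^\top$ with $\widehat P^{k+1}\in\mathbb O^{n\times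 r}$, $\widehat Q^{k+1}\in\mathbb O^r$, $(\widehat D^{k+1})^2={\rm Diag}(\sigma(U^{k+1}\overline D^k))$; set $\widehat U^{k+1}:=\widehat P^{k+1}\widehat D^{k+1}$, $\widehat V^{k+1}:=\overline P^k\widehat Q^{k+1}\widehat D^{k+1}$, $\widehat X^{k+1}:=\widehat U^{k+1}(\widehat V^{k+1})^\top$. 3. $V^{k+1}\in\arg\min_{V\in\mathbb R^{m\times r}}\{\widehat\Phi_{\lambda,\mu}(\widehat U^{k+1},V,\widehat U^{k+1},\widehat V^{k+1})+\frac{\gamma_{2,k}}{2}\|V-\widehat V^{k+1}\|_F^2\}$. 4. Take a thin SVD $V^{k+1}\widehat D^{k+1}=\overline P^{k+1}(\overline D^{k+1})^2(\overline Q^{k+1})^\top$ with $\overline P^{k+1}\in\mathbb O^{m\times r}$, $\overline Q^{k+1}\in\mathbb O^r$, $(\overline D^{k+1})^2={\rm Diag}(\sigma(V^{k+1}\widehat D^{k+1}))$; set $\overline U^{k+1}:=\widehat P^{k+1}\overline Q^{k+1}\overline D^{k+1}$, $\overline V^{k+1}:=\overline P^{k+1}\overline D^{k+1}$, $\overline X^{k+1}:=\overline U^{k+1}(\overline V^{k+1})^\top$. 5. $\gamma_{1,k+1}=\max(\underline{\gamma_1},\varrho\gamma_{1,k})$, $\gamma_{2,k+1}=\max(\underline{\gamma_2},\varrho\gamma_{2,k})$. ($\widehat D^k,\overline D^k$ are diagonal with nonnegative entries.) **Assumption 1.** For any $\kappa\in[n]$, any $X\in\mathbb R^{n\times m}$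 with ${\rm rank}(X)\le\kappa$ and any $(P,Q)\in\mathbb O^{n,m}(X)$, the pair $(\overline U,\overline V)=(P_1[\Sigma_\kappa(X)]^{1/2},Q_1[\Sigma_\kappa(X)]^{1/2})$ satisfies $\vartheta(\overline U)+\vartheta(\overline V)=\inf\{\vartheta(U)+\vartheta(V): (U,V)\in\mathbb R^{n\times\kappa}\times\mathbb R^{m\times\kappa},\ X=UV^\top\}$, where $P_1,Q_1$ consist of the first $\kappa$ columns of $P,Q$. **Assumption 2.** Let $\Lambda^k:=[L_f(\overline D^k)^2+(\mu+\gamma_{1,k})I_r]^{1/2}$, $\Delta^{k+1}:=[L_f(\widehat D^{k+1})^2+(\mu+\gamma_{2,k})I_r]^{1/2}$, and let $\widehat\beta>0$ be a constant with $(\Lambda^k_{ii})^2\le\widehat\beta$ and $(\Delta^k_{ii})^2\le\widehat\beta$ for all $k$ and $i\in[r]$ (such a constant exists under Assumption 1). For any fixed $\gamma\in[\lambda\widehat\beta^{-1},\lambda(\mu+\underline\gamma)^{-1}]$ there exists $c_p>0$ such that for any $t\ge0$, either $\mathcal P_\gamma\theta(t)=\{0\}$ or $\min_{s\in\mathcal P_\gamma\theta(t)}s\ge c_p$, where $\mathcal P_\gamma\theta(t):=\arg\min_{s\in\mathbb R}\{\frac{1}{2\gamma}(t-s)^2+\theta(s)\}$. **The indices $\overline k$, $\widetilde k$ and $\overline r$.** $\mathcal W^*$ denotes the set of cluster points of $W^k:=(\widehat U^k,\widehat V^k,\overline U^k,\overline V^k,\widehat X^k,\overline X^k)$, and $\overline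 r:=\|\overline U\|_{2,0}={\rm rank}(\overline X)$ for $W=(\widehat U,\widehat V,\overline U,\overline V,\widehat X,\overline X)\in\mathcal W^*$ (under Assumptions 1–2 this value does not depend on $W$). $\overline k$ is an index such that for all $k\ge\overline k$: $J_{V^k}=J_{U^k}=J_{\widehat U^k}=J_{\widehat V^k}=J_{\overline V^k}=J_{\overline U^k}=J_{\overline U^{k+1}}$ and ${\rm rank}(\overline X^k)={\rm rank}(\widehat X^k)={\rm rank}(\widehat U^k)={\rm rank}(\widehat V^k)={\rm rank}(\overline U^k)={\rm rank}(\overline V^k)=\|\overline U^k\|_{2,0}$ (such an index exists). $\widetilde k\ge\overline k$ is an index for which there is $\alpha>0$ with $\min\{\sigma_{\overline r}(\overline X^k),\sigma_{\overline r}(\widehat X^k)\}\ge\alpha$ for all $k\ge\widetilde k$ (such an index exists under Assumptions 1–2). **Stationary points.** $\partial$ denotes the limiting (Mordukhovich) subdifferential. Let $\phi(x):=\theta(\|x\|)$ for $x\in\mathbb R^l$. A pair $(U,V)\in\mathbb X_r$ is a stationary point of (P) if $0\in\partial\Phi_{\lambda,\mu}(U,V)$, where $\partial\Phi_{\lambda,\mu}(U,V)$ is the product of $\nabla f(UV^\top)V+\mu U+\lambda[\mathcal U_1\times\cdots\times\mathcal U_r]$ and $[\nabla f(UV^\top)]^\top U+\mu V+\lambda[\mathcal V_1\times\cdots\times\mathcal V_r]$, with $\mathcal U_j=\{\theta'(\|U_j\|)U_j/\|U_j\|\}$ if $U_j\ne0$ and $\mathcal U_j=\partial\phi(0)$ if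 $U_j=0$, and similarly for $\mathcal V_j$. **KL function.** For $\eta>0$, $\Upsilon_\eta$ is the set of continuous concave $\varphi:[0,\eta)\to[0,\infty)$, continuously differentiable on $(0,\eta)$, with $\varphi(0)=0$ and $\varphi'>0$ on $(0,\eta)$. A proper function $h$ has the KL property at $\overline x\in{\rm dom}\,\partial h$ if there exist $\delta>0$, $\eta\in(0,\infty]$, $\varphi\in\Upsilon_\eta$ such that $\varphi'(h(x)-h(\overline x))\,{\rm dist}(0,\partial h(x))\ge1$ for all $x$ in the closed ball of radius $\delta$ about $\overline x$ with $h(\overline x)<h(x)<h(\overline x)+\eta$. $h$ is a KL function if this holds at every point of ${\rm dom}\,\partial h$. *)

theory Defs
  imports "HOL-Analysis.Analysis"
begin

text \<open>
  \<open>('n, 'm) rmat\<close> is the space of real matrices with rows indexed by \<open>'n\<close> and columns by \<open>'m\<close>.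
  Its norm and inner product are the Frobenius ones. Index types are linearly ordered so that
  rows and columns have positions \<open>1, \<dots>, CARD('n)\<close>.
\<close>

type_synonym ('n, 'm) rmat = "real^'m^'n"

definition pos :: "'a::{finite,linorder} \<Rightarrow> nat" where
  "pos i = card {j. j \<le> i}"

definition nth_column ::
  "('n::finite, 'm::{finite,linorder}) rmat \<Rightarrow> nat \<Rightarrow> real^'n" where
  "nth_column A p = column (THE j. pos j = p) A"

text \<open>Deletion of the last columns, so that \<open>CARD('r)\<close> of them remain; meant for
  \<open>CARD('r) \<le> CARD('m)\<close>.\<close>

definition first_columns ::
  "('n::finite, 'm::{finite,linorder}) rmat \<Rightarrow> ('n, 'r::{finite,linorder}) rmat" where
  "first_columns A = (\<chi> i j. nth_column A (pos j) $ i)"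

text \<open>The rectangular matrix with diagonal \<open>s 1, s 2, \<dots>\<close> and zeros elsewhere.\<close>

definition rdiag :: "(nat \<Rightarrow> real) \<Rightarrow> ('n::{finite,linorder}, 'm::{finite,linorder}) rmat" where
  "rdiag s = (\<chi> i j. if pos i = pos j then s (pos i) else 0)"

definition orthonormal_columns :: "('n::finite, 'r::finite) rmat \<Rightarrow> bool" where
  "orthonormal_columns A \<longleftrightarrow> transpose A ** A = mat 1"

definition nonneg_diagonal :: "('r::finite, 'r) rmat \<Rightarrow> bool" where
  "nonneg_diagonal D \<longleftrightarrow> (\<forall>i j. i \<noteq> j \<longrightarrow> D $ i $ j = 0) \<and> (\<forall>i. 0 \<le> D $ i $ i)"

definition nonzero_columns :: "('n::finite, 'r::finite) rmat \<Rightarrow> 'r set" where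
  "nonzero_columns A = {j. column j A \<noteq> 0}"

text \<open>
  The \<open>i\<close>-th largest singular value (\<open>i \<ge> 1\<close>): singular values are the square roots of the
  eigenvalues of \<open>X X\<^sup>T\<close>, and the dimension below counts, with multiplicity, those that are at
  least \<open>s\<close>. The value is 0 for \<open>i\<close> beyond the number of rows; \<open>i = 0\<close> is meaningless.
\<close>

definition sing_val :: "('n::finite, 'm::finite) rmat \<Rightarrow> nat \<Rightarrow> real" where
  "sing_val X i = Sup (insert 0
     {s. 0 \<le> s \<and> i \<le> dim {v. \<exists>t\<ge>s. (X ** transpose X) *v v = t\<^sup>2 *\<^sub>R v}})"

text \<open>For \<open>CARD('n) \<le> CARD('m)\<close> the middle factor is the block matrix \<open>[Diag(\<sigma>(X)) 0]\<close>.\<close>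

definition svd_pairs ::
  "('n::{finite,linorder}, 'm::{finite,linorder}) rmat \<Rightarrow> (('n, 'n) rmat \<times> ('m, 'm) rmat) set" where
  "svd_pairs X = {(P, Q). orthogonal_matrix P \<and> orthogonal_matrix Q \<and>
                          X = P ** rdiag (sing_val X) ** transpose Q}"

text \<open>The square root of \<open>Diag(\<sigma>\<^sub>1(X), \<dots>, \<sigma>\<^sub>r(X))\<close> with \<open>r = CARD('r)\<close>.\<close>

definition sqrt_sing_diag :: "('n::finite, 'm::finite) rmat \<Rightarrow> ('r::{finite,linorder}, 'r) rmat" where
  "sqrt_sing_diag X = rdiag (\<lambda>i. sqrt (sing_val X i))"

definition argmin_set :: "('a \<Rightarrow> ereal) \<Rightarrow> 'a set" where
  "argmin_set h = {x. \<forall>y. h x \<le> h y}"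

definition proper_fun :: "('a \<Rightarrow> ereal) \<Rightarrow> bool" where
  "proper_fun h \<longleftrightarrow> (\<forall>x. h x \<noteq> -\<infinity>) \<and> (\<exists>x. h x \<noteq> \<infinity>)"

definition lower_semicont :: "('a::topological_space \<Rightarrow> ereal) \<Rightarrow> bool" where
  "lower_semicont h \<longleftrightarrow> (\<forall>x. h x \<le> Liminf (at x) h)"

definition regular_subdiff :: "('a::euclidean_space \<Rightarrow> ereal) \<Rightarrow> 'a \<Rightarrow> 'a set" where
  "regular_subdiff h x = {v. \<bar>h x\<bar> \<noteq> \<infinity> \<and>
     (\<forall>e>0. \<forall>\<^sub>F y in nhds x. h x + ereal (v \<bullet> (y - x) - e * norm (y - x)) \<le> h y)}"

definition limiting_subdiff :: "('a::euclidean_space \<Rightarrow> ereal) \<Rightarrow> 'a \<Rightarrow> 'a set" where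
  "limiting_subdiff h x = {v. \<bar>h x\<bar> \<noteq> \<infinity> \<and>
     (\<exists>y w. y \<longlonglongrightarrow> x \<and> (\<lambda>k. h (y k)) \<longlonglongrightarrow> h x \<and>
            (\<forall>k. w k \<in> regular_subdiff h (y k)) \<and> w \<longlonglongrightarrow> v)}"

text \<open>Distance from the origin, with value \<open>\<infinity>\<close> for the empty set (unlike \<open>infdist\<close>).\<close>

definition dist_zero :: "'a::real_normed_vector set \<Rightarrow> ereal" where
  "dist_zero S = (INF v\<in>S. ereal (norm v))"

definition desingularizing :: "ereal \<Rightarrow> (real \<Rightarrow> real) \<Rightarrow> bool" where
  "desingularizing \<eta> \<phi> \<longleftrightarrow>
     continuous_on {t. 0 \<le> t \<and> ereal t < \<eta>} \<phi> \<and>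
     concave_on {t. 0 \<le> t \<and> ereal t < \<eta>} \<phi> \<and>
     (\<forall>t. 0 \<le> t \<and> ereal t < \<eta> \<longrightarrow> 0 \<le> \<phi> t) \<and>
     (\<forall>t. 0 < t \<and> ereal t < \<eta> \<longrightarrow> \<phi> differentiable (at t)) \<and>
     continuous_on {t. 0 < t \<and> ereal t < \<eta>} (deriv \<phi>) \<and>
     \<phi> 0 = 0 \<and>
     (\<forall>t. 0 < t \<and> ereal t < \<eta> \<longrightarrow> 0 < deriv \<phi> t)"

definition KL_property :: "('a::euclidean_space \<Rightarrow> ereal) \<Rightarrow> 'a \<Rightarrow> bool" where
  "KL_property h xbar \<longleftrightarrow>
     (\<exists>\<delta>>0. \<exists>\<eta>>0. \<exists>\<phi>. desingularizing \<eta> \<phi> \<and>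
        (\<forall>x\<in>cball xbar \<delta>. h xbar < h x \<and> h x < h xbar + \<eta> \<longrightarrow>
           1 \<le> ereal (deriv \<phi> (real_of_ereal (h x - h xbar))) * dist_zero (limiting_subdiff h x)))"

definition KL_function :: "('a::euclidean_space \<Rightarrow> ereal) \<Rightarrow> bool" where
  "KL_function h \<longleftrightarrow> proper_fun h \<and> (\<forall>x. limiting_subdiff h x \<noteq> {} \<longrightarrow> KL_property h x)"

definition cluster_points :: "(nat \<Rightarrow> 'a::topological_space) \<Rightarrow> 'a set" where
  "cluster_points w = {x. \<exists>s::nat \<Rightarrow> nat. strict_mono s \<and> (w \<circ> s) \<longlonglongrightarrow> x}"

definition inner_limit :: "(nat \<Rightarrow> 'a::topological_space set) \<Rightarrow> 'a set" where
  "inner_limit C = {x. \<exists>y. (\<forall>\<^sub>F k in sequentially. y k \<in> C k) \<and> y \<longlonglongrightarrow> x}"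

definition outer_limit :: "(nat \<Rightarrow> 'a::topological_space set) \<Rightarrow> 'a set" where
  "outer_limit C =
     {x. \<exists>s y. strict_mono (s :: nat \<Rightarrow> nat) \<and> (\<forall>k. y k \<in> C (s k)) \<and> y \<longlonglongrightarrow> x}"

definition painleve_kuratowski_converges :: "(nat \<Rightarrow> 'a::topological_space set) \<Rightarrow> 'a set \<Rightarrow> bool" where
  "painleve_kuratowski_converges C D \<longleftrightarrow> inner_limit C = D \<and> outer_limit C = D"

definition penalty_fun :: "(real \<Rightarrow> ereal) \<Rightarrow> bool" where
  "penalty_fun \<theta> \<longleftrightarrow> proper_fun \<theta> \<and> lower_semicont \<theta> \<and>
     \<theta> 0 = 0 \<and> (\<forall>t>0. 0 < \<theta> t) \<and> (\<forall>t<0. \<theta> t = \<infinity>) \<and>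
     (\<forall>t>0. \<theta> t \<noteq> \<infinity> \<and> (\<lambda>s. real_of_ereal (\<theta> s)) differentiable (at t))"

definition vtheta :: "(real \<Rightarrow> ereal) \<Rightarrow> ('n::finite, 'r::finite) rmat \<Rightarrow> ereal" where
  "vtheta \<theta> W = (\<Sum>j\<in>UNIV. \<theta> (norm (column j W)))"

definition objective ::
  "(('n::finite, 'm::finite) rmat \<Rightarrow> real) \<Rightarrow> (real \<Rightarrow> ereal) \<Rightarrow> real \<Rightarrow> real
    \<Rightarrow> ('n, 'r::finite) rmat \<times> ('m, 'r) rmat \<Rightarrow> ereal" where
  "objective f \<theta> lam \<mu> = (\<lambda>(U, V).
     ereal (f (U ** transpose V)) + ereal lam * (vtheta \<theta> U + vtheta \<theta> V)
       + ereal (\<mu> / 2 * ((norm U)\<^sup>2 + (norm V)\<^sup>2)))"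

definition majorant ::
  "(('n::finite, 'm::finite) rmat \<Rightarrow> real) \<Rightarrow> (('n, 'm) rmat \<Rightarrow> ('n, 'm) rmat) \<Rightarrow> real
    \<Rightarrow> (real \<Rightarrow> ereal) \<Rightarrow> real \<Rightarrow> real
    \<Rightarrow> ('n, 'r::finite) rmat \<Rightarrow> ('m, 'r) rmat \<Rightarrow> ('n, 'r) rmat \<Rightarrow> ('m, 'r) rmat \<Rightarrow> ereal" where
  "majorant f gradf Lf \<theta> lam \<mu> U V U' V' =
     ereal (f (U' ** transpose V')
            + gradf (U' ** transpose V') \<bullet> (U ** transpose V - U' ** transpose V')
            + Lf / 2 * (norm (U ** transpose V - U' ** transpose V'))\<^sup>2)
     + ereal lam * (vtheta \<theta> U + vtheta \<theta> V)
     + ereal (\<mu> / 2 * ((norm U)\<^sup>2 + (norm V)\<^sup>2))"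

definition stationary_point ::
  "(('n::finite, 'm::finite) rmat \<Rightarrow> real) \<Rightarrow> (real \<Rightarrow> ereal) \<Rightarrow> real \<Rightarrow> real
    \<Rightarrow> ('n, 'r::finite) rmat \<Rightarrow> ('m, 'r) rmat \<Rightarrow> bool" where
  "stationary_point f \<theta> lam \<mu> U V \<longleftrightarrow> 0 \<in> limiting_subdiff (objective f \<theta> lam \<mu>) (U, V)"

text \<open>
  The iterates are \<open>U\<close>, \<open>V\<close> (solutions of the subproblems), \<open>Uh\<close>, \<open>Vh\<close>, \<open>Xh\<close>, \<open>Ph\<close>, \<open>Dh\<close>, \<open>Qh\<close>
  (hatted in the mathematical notation) and \<open>Ub\<close>, \<open>Vb\<close>, \<open>Xb\<close>, \<open>Pb\<close>, \<open>Db\<close>, \<open>Qb\<close> (barred).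
  The algorithm does not determine \<open>U\<close>, \<open>V\<close>, \<open>Uh\<close>, \<open>Vh\<close>, \<open>Xh\<close>, \<open>Dh\<close>, \<open>Qh\<close> at index 0, and
  these values stay unconstrained.
\<close>

definition alt_min_run ::
  "(('n::{finite,linorder}, 'm::{finite,linorder}) rmat \<Rightarrow> real)
    \<Rightarrow> (('n, 'm) rmat \<Rightarrow> ('n, 'm) rmat) \<Rightarrow> real \<Rightarrow> (real \<Rightarrow> ereal) \<Rightarrow> real \<Rightarrow> real
    \<Rightarrow> real \<Rightarrow> real \<Rightarrow> real \<Rightarrow> (nat \<Rightarrow> real) \<Rightarrow> (nat \<Rightarrow> real)
    \<Rightarrow> (nat \<Rightarrow> ('n, 'r::{finite,linorder}) rmat) \<Rightarrow> (nat \<Rightarrow> ('m, 'r) rmat)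
    \<Rightarrow> (nat \<Rightarrow> ('n, 'r) rmat) \<Rightarrow> (nat \<Rightarrow> ('m, 'r) rmat) \<Rightarrow> (nat \<Rightarrow> ('n, 'm) rmat)
    \<Rightarrow> (nat \<Rightarrow> ('n, 'r) rmat) \<Rightarrow> (nat \<Rightarrow> ('r, 'r) rmat) \<Rightarrow> (nat \<Rightarrow> ('r, 'r) rmat)
    \<Rightarrow> (nat \<Rightarrow> ('n, 'r) rmat) \<Rightarrow> (nat \<Rightarrow> ('m, 'r) rmat) \<Rightarrow> (nat \<Rightarrow> ('n, 'm) rmat)
    \<Rightarrow> (nat \<Rightarrow> ('m, 'r) rmat) \<Rightarrow> (nat \<Rightarrow> ('r, 'r) rmat) \<Rightarrow> (nat \<Rightarrow> ('r, 'r) rmat)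
    \<Rightarrow> bool" where
  "alt_min_run f gradf Lf \<theta> lam \<mu> \<rho> \<gamma>low1 \<gamma>low2 \<gamma>1 \<gamma>2
       U V Uh Vh Xh Ph Dh Qh Ub Vb Xb Pb Db Qb \<longleftrightarrow>
     0 < \<rho> \<and> \<rho> < 1 \<and> 0 < \<gamma>low1 \<and> 0 < \<gamma>low2 \<and> 0 < \<gamma>1 0 \<and> 0 < \<gamma>2 0 \<and>
     orthonormal_columns (Pb 0) \<and> orthonormal_columns (Ph 0) \<and>
     Qb 0 = mat 1 \<and> Db 0 = mat 1 \<and>
     Ub 0 = Ph 0 \<and> Vb 0 = Pb 0 \<and> Xb 0 = Ub 0 ** transpose (Vb 0) \<and>
     (\<forall>k.
        U (Suc k) \<in> argmin_set (\<lambda>W. majorant f gradf Lf \<theta> lam \<mu> W (Vb k) (Ub k) (Vb k)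
                                    + ereal (\<gamma>1 k / 2 * (norm (W - Ub k))\<^sup>2)) \<and>
        orthonormal_columns (Ph (Suc k)) \<and> orthogonal_matrix (Qh (Suc k)) \<and>
        nonneg_diagonal (Dh (Suc k)) \<and>
        Dh (Suc k) ** Dh (Suc k) = rdiag (sing_val (U (Suc k) ** Db k)) \<and>
        U (Suc k) ** Db k =
          Ph (Suc k) ** (Dh (Suc k) ** Dh (Suc k)) ** transpose (Qh (Suc k)) \<and>
        Uh (Suc k) = Ph (Suc k) ** Dh (Suc k) \<and>
        Vh (Suc k) = Pb k ** Qh (Suc k) ** Dh (Suc k) \<and>
        Xh (Suc k) = Uh (Suc k) ** transpose (Vh (Suc k)) \<and>
        V (Suc k) \<in> argmin_set (\<lambda>W. majorant f gradf Lf \<theta> lam \<mu>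
                                      (Uh (Suc k)) W (Uh (Suc k)) (Vh (Suc k))
                                    + ereal (\<gamma>2 k / 2 * (norm (W - Vh (Suc k)))\<^sup>2)) \<and>
        orthonormal_columns (Pb (Suc k)) \<and> orthogonal_matrix (Qb (Suc k)) \<and>
        nonneg_diagonal (Db (Suc k)) \<and>
        Db (Suc k) ** Db (Suc k) = rdiag (sing_val (V (Suc k) ** Dh (Suc k))) \<and>
        V (Suc k) ** Dh (Suc k) =
          Pb (Suc k) ** (Db (Suc k) ** Db (Suc k)) ** transpose (Qb (Suc k)) \<and>
        Ub (Suc k) = Ph (Suc k) ** Qb (Suc k) ** Db (Suc k) \<and>
        Vb (Suc k) = Pb (Suc k) ** Db (Suc k) \<and>
        Xb (Suc k) = Ub (Suc k) ** transpose (Vb (Suc k)) \<and>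
        \<gamma>1 (Suc k) = max \<gamma>low1 (\<rho> * \<gamma>1 k) \<and>
        \<gamma>2 (Suc k) = max \<gamma>low2 (\<rho> * \<gamma>2 k))"

text \<open>
  The number of columns \<open>\<kappa>\<close> is a bound variable here, so matrices with \<open>\<kappa>\<close> columns are given as
  sequences of columns, of which only those at positions \<open>1, \<dots>, \<kappa>\<close> are used.
\<close>

definition columns_mult :: "nat \<Rightarrow> (nat \<Rightarrow> real^'n) \<Rightarrow> (nat \<Rightarrow> real^'m) \<Rightarrow> ('n::finite, 'm::finite) rmat"
  where "columns_mult \<kappa> U V = (\<chi> a b. \<Sum>i=1..\<kappa>. U i $ a * V i $ b)"

definition columns_vtheta :: "(real \<Rightarrow> ereal) \<Rightarrow> nat \<Rightarrow> (nat \<Rightarrow> real^'n) \<Rightarrow> ereal" where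
  "columns_vtheta \<theta> \<kappa> U = (\<Sum>i=1..\<kappa>. \<theta> (norm (U i)))"

definition balanced_factorization_optimal ::
  "('n::{finite,linorder} \<times> 'm::{finite,linorder}) itself \<Rightarrow> (real \<Rightarrow> ereal) \<Rightarrow> bool" where
  "balanced_factorization_optimal _ \<theta> \<longleftrightarrow>
     (\<forall>\<kappa>\<in>{1..CARD('n)}. \<forall>X :: ('n, 'm) rmat. rank X \<le> \<kappa> \<longrightarrow>
        (\<forall>(P, Q) \<in> svd_pairs X.
           columns_vtheta \<theta> \<kappa> (\<lambda>i. sqrt (sing_val X i) *\<^sub>R nth_column P i)
             + columns_vtheta \<theta> \<kappa> (\<lambda>i. sqrt (sing_val X i) *\<^sub>R nth_column Q i)
           = Inf {columns_vtheta \<theta> \<kappa> U + columns_vtheta \<theta> \<kappa> V | U V. X = columns_mult \<kappa> U V}))"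

definition prox_set :: "real \<Rightarrow> (real \<Rightarrow> ereal) \<Rightarrow> real \<Rightarrow> real set" where
  "prox_set \<gamma> \<theta> t = argmin_set (\<lambda>s. ereal (1 / (2 * \<gamma>) * (t - s)\<^sup>2) + \<theta> s)"

text \<open>
  The dichotomy concerns the nonzero elements of the proximal set: for a threshold \<open>t\<close>, such as
  \<open>t = sqrt (2 * \<gamma>)\<close> for the zero norm, it contains 0 together with a positive element.
\<close>

definition prox_gap :: "(real \<Rightarrow> ereal) \<Rightarrow> real \<Rightarrow> bool" where
  "prox_gap \<theta> \<gamma> \<longleftrightarrow>
     (\<exists>c>0. \<forall>t\<ge>0. prox_set \<gamma> \<theta> t = {0} \<or> (\<forall>s \<in> prox_set \<gamma> \<theta> t - {0}. c \<le> s))"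

text \<open>The square root of \<open>Lf D\<^sup>2 + (\<mu> + g) I\<close> for a diagonal matrix \<open>D\<close>.\<close>

definition scaling_matrix :: "real \<Rightarrow> real \<Rightarrow> ('r::finite, 'r) rmat \<Rightarrow> real \<Rightarrow> ('r, 'r) rmat" where
  "scaling_matrix Lf \<mu> D g =
     (\<chi> i j. if i = j then sqrt (Lf * (D $ i $ i)\<^sup>2 + (\<mu> + g)) else 0)"

definition stable_support_index ::
  "(nat \<Rightarrow> ('n::finite, 'r::finite) rmat) \<Rightarrow> (nat \<Rightarrow> ('m::finite, 'r) rmat)
    \<Rightarrow> (nat \<Rightarrow> ('n, 'r) rmat) \<Rightarrow> (nat \<Rightarrow> ('m, 'r) rmat) \<Rightarrow> (nat \<Rightarrow> ('n, 'm) rmat)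
    \<Rightarrow> (nat \<Rightarrow> ('n, 'r) rmat) \<Rightarrow> (nat \<Rightarrow> ('m, 'r) rmat) \<Rightarrow> (nat \<Rightarrow> ('n, 'm) rmat)
    \<Rightarrow> nat \<Rightarrow> bool" where
  "stable_support_index U V Uh Vh Xh Ub Vb Xb kbar \<longleftrightarrow> 1 \<le> kbar \<and>
     (\<forall>k\<ge>kbar.
        nonzero_columns (V k) = nonzero_columns (U k) \<and>
        nonzero_columns (U k) = nonzero_columns (Uh k) \<and>
        nonzero_columns (Uh k) = nonzero_columns (Vh k) \<and>
        nonzero_columns (Vh k) = nonzero_columns (Vb k) \<and>
        nonzero_columns (Vb k) = nonzero_columns (Ub k) \<and>
        nonzero_columns (Ub k) = nonzero_columns (Ub (Suc k)) \<and>
        rank (Xb k) = rank (Xh k) \<and> rank (Xh k) = rank (Uh k) \<and>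
        rank (Uh k) = rank (Vh k) \<and> rank (Vh k) = rank (Ub k) \<and>
        rank (Ub k) = rank (Vb k) \<and> rank (Vb k) = card (nonzero_columns (Ub k)))"

text \<open>For \<open>rbar = 0\<close> there is no singular value to be bounded below.\<close>

definition sing_val_gap_index ::
  "(nat \<Rightarrow> ('n::finite, 'm::finite) rmat) \<Rightarrow> (nat \<Rightarrow> ('n, 'm) rmat) \<Rightarrow> nat \<Rightarrow> nat \<Rightarrow> bool" where
  "sing_val_gap_index Xh Xb rbar ktil \<longleftrightarrow>
     (\<exists>\<alpha>>0. \<forall>k\<ge>ktil. 1 \<le> rbar \<longrightarrow> \<alpha> \<le> min (sing_val (Xb k) rbar) (sing_val (Xh k) rbar))"

end

theory Submission
  imports Defs
begin

text \<open>
  Each half step first solves a proximal subproblem in one factor and then rebalances both factors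
  through a singular value decomposition, which keeps the product and, by the optimality of balanced
  factorizations, does not increase the objective (\<open>balanced_objective_le\<close>). Together with the
  quadratic upper bound for \<open>f\<close>, the objective decreases by at least a multiple of \<open>d\<^sub>k\<^sup>2\<close>, where
  \<open>d\<^sub>k\<close> is the step size \<open>\<parallel>U\<^bsup>k+1\<^esup> - Ub\<^sup>k\<parallel> + \<parallel>V\<^bsup>k+1\<^esup> - Vh\<^bsup>k+1\<^esup>\<parallel>\<close>; by coercivity the iterates stay bounded and
  \<open>d\<^sub>k\<close> tends to 0. The products move by at most a multiple of \<open>d\<^sub>k\<close>, because each subproblem keeps one
  factor fixed.

  The factors themselves need not converge, since singular vectors may rotate, and the penalty may
  jump at 0. Both obstacles are overcome as follows. The norm of a nonzero column of a subproblem
  solution is a nonzero proximal point, hence bounded away from 0 uniformly in \<open>k\<close>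
  (\<open>solves_subproblem_column_gap\<close>); stable supports and \<open>d\<^sub>k \<rightarrow> 0\<close> transfer this gap to all factors.
  Along factors with a gap the objective is continuous, and minimality in the subproblems passes to
  the limit. At a cluster point this yields the first-order condition in \<open>U\<close> for the barred factors
  and the one in \<open>V\<close> for the hatted factors. Both are balanced factorizations of the same matrix,
  and two such factorizations differ only by rotations among equal singular values, under which the
  conditions are invariant (\<open>balanced_eigen_relation_transfer\<close>). So every balanced factorization of
  the limit product is stationary.

  In particular the cluster points of the factors lie in the domain of the subdifferential, and by
  the continuity above they share one objective value. The Kurdyka--Lojasiewicz inequality, made uniform over the compact set of
  cluster points, turns the decrease and the subgradient bound into summability of \<open>d\<^sub>k\<close>
  (\<open>KL_descent_summable\<close>), so the products form Cauchy sequences. Finally, the gap makes the inverses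
  of the products on their ranges uniformly bounded, which forces the column spaces to converge
  (\<open>painleve_kuratowski_range\<close>).
\<close>

section \<open>Columns and products of real matrices\<close>

lemma inner_eq_sum_columns:
  fixes A B :: "('n::finite, 'm::finite) rmat"
  shows "A \<bullet> B = (\<Sum>j\<in>UNIV. column j A \<bullet> column j B)"
  unfolding inner_vec_def column_def by (simp add: inner_vec_def) (rule sum.swap)

lemma norm_sq_eq_sum_columns:
  fixes A :: "('n::finite, 'm::finite) rmat"
  shows "(norm A)\<^sup>2 = (\<Sum>j\<in>UNIV. (norm (column j A))\<^sup>2)"
  by (simp add: power2_norm_eq_inner inner_eq_sum_columns[of A A])

lemma norm_column_le_norm:
  fixes A :: "('n::finite, 'm::finite) rmat"
  shows "norm (column j A) \<le> norm A"
proof -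
  have "(norm (column j A))\<^sup>2 \<le> (norm A)\<^sup>2"
    unfolding norm_sq_eq_sum_columns[of A] by (rule member_le_sum) auto
  then show ?thesis by (rule power2_le_imp_le) simp
qed

lemma column_matrix_mult: "column j (A ** B) = A *v column j B"
  by (simp add: column_def matrix_matrix_mult_def matrix_vector_mult_def vec_eq_iff)

lemma matrix_eq_columnsI: "(\<And>j. column j A = column j B) \<Longrightarrow> A = B"
  by (simp add: column_def vec_eq_iff)

lemma bounded_linear_column: "bounded_linear (\<lambda>A :: ('n::finite, 'm::finite) rmat. column j A)"
  by (rule linear_conv_bounded_linear[THEN iffD1], rule linearI)
     (auto simp: column_def vec_eq_iff)

lemmas column_add = linear_add[OF bounded_linear.linear[OF bounded_linear_column]]
  and column_diff = linear_diff[OF bounded_linear.linear[OF bounded_linear_column]]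
  and column_scaleR = linear_scale[OF bounded_linear.linear[OF bounded_linear_column]]
  and tendsto_column = bounded_linear.tendsto[OF bounded_linear_column]

lemma bounded_linear_transpose:
  "bounded_linear (transpose :: ('n::finite, 'm::finite) rmat \<Rightarrow> ('m, 'n) rmat)"
  by (rule linear_conv_bounded_linear[THEN iffD1], rule linearI)
     (auto simp: transpose_def vec_eq_iff)

lemmas transpose_diff = linear_diff[OF bounded_linear.linear[OF bounded_linear_transpose]]
  and tendsto_transpose = bounded_linear.tendsto[OF bounded_linear_transpose]

lemma inner_transpose:
  fixes A B :: "('n::finite, 'm::finite) rmat"
  shows "transpose A \<bullet> transpose B = A \<bullet> B"
  unfolding inner_vec_def transpose_def by (simp add: inner_vec_def) (rule sum.swap)

lemma norm_transpose:
  fixes A :: "('n::finite, 'm::finite) rmat"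
  shows "norm (transpose A) = norm A"
  by (simp add: norm_eq_sqrt_inner inner_transpose)

lemma bounded_bilinear_matrix_mult:
  "bounded_bilinear ((**) :: ('n::finite, 'k::finite) rmat \<Rightarrow> ('k, 'm::finite) rmat \<Rightarrow> ('n, 'm) rmat)"
proof (rule bilinear_conv_bounded_bilinear[THEN iffD1], unfold bilinear_def, safe)
  fix A :: "('n, 'k) rmat"
  show "linear (\<lambda>B :: ('k, 'm) rmat. A ** B)"
    by (rule linearI)
       (auto simp: matrix_matrix_mult_def vec_eq_iff sum.distrib sum_distrib_left algebra_simps)
next
  fix B :: "('k, 'm) rmat"
  show "linear (\<lambda>A :: ('n, 'k) rmat. A ** B)"
    by (rule linearI)
       (auto simp: matrix_matrix_mult_def vec_eq_iff sum.distrib sum_distrib_left algebra_simps)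
qed

lemmas tendsto_matrix_mult = bounded_bilinear.tendsto[OF bounded_bilinear_matrix_mult]
  and matrix_mult_diff_left = bounded_bilinear.diff_left[OF bounded_bilinear_matrix_mult]
  and matrix_mult_diff_right = bounded_bilinear.diff_right[OF bounded_bilinear_matrix_mult]
  and matrix_mult_add_left = bounded_bilinear.add_left[OF bounded_bilinear_matrix_mult]
  and matrix_mult_scaleR_left = bounded_bilinear.scaleR_left[OF bounded_bilinear_matrix_mult]

lemma inner_mult_transpose:
  fixes H :: "('n::finite, 'm::finite) rmat" and A :: "('n, 'r::finite) rmat"
  shows "H \<bullet> (A ** transpose B) = (H ** B) \<bullet> A"
proof -
  have "H \<bullet> (A ** transpose B)
      = (\<Sum>i\<in>UNIV. \<Sum>k\<in>UNIV. \<Sum>j\<in>UNIV. H $ i $ k * (A $ i $ j * B $ k $ j))"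
    by (simp add: inner_vec_def matrix_matrix_mult_def transpose_def sum_distrib_left)
  also have "\<dots> = (\<Sum>i\<in>UNIV. \<Sum>j\<in>UNIV. \<Sum>k\<in>UNIV. H $ i $ k * (A $ i $ j * B $ k $ j))"
    by (rule sum.cong[OF refl sum.swap])
  also have "\<dots> = (H ** B) \<bullet> A"
    by (simp add: inner_vec_def matrix_matrix_mult_def sum_distrib_right sum_distrib_left mult_ac)
  finally show ?thesis .
qed

text \<open>The matrix \<open>a e\<^sub>j\<^sup>T\<close>: perturbations of a single column decouple the column-separable penalty.\<close>

definition single_column :: "'r \<Rightarrow> real^'n \<Rightarrow> ('n::finite, 'r::finite) rmat" where
  "single_column j a = (\<chi> i k. if k = j then a $ i else 0)"

lemma column_single_column: "column k (single_column j a) = (if k = j then a else 0)"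
  by (simp add: single_column_def column_def vec_eq_iff)

lemma inner_single_column: "A \<bullet> single_column j a = column j A \<bullet> a"
proof -
  have "A \<bullet> single_column j a = (\<Sum>k\<in>UNIV. if k = j then column j A \<bullet> a else 0)"
    unfolding inner_eq_sum_columns[of A] by (intro sum.cong) (auto simp: column_single_column)
  then show ?thesis by simp
qed

lemma norm_sq_single_column_mult:
  fixes B :: "('m::finite, 'r::finite) rmat"
  shows "(norm (single_column j a ** transpose B))\<^sup>2 = (norm (column j B))\<^sup>2 * (norm a)\<^sup>2"
proof -
  have "single_column j a ** transpose B = (\<chi> i k. a $ i * B $ k $ j)"
    unfolding matrix_matrix_mult_def single_column_def transpose_def
    by (simp add: vec_eq_iff if_distrib[of "\<lambda>x. x * _"] cong: if_cong)
  then show ?thesis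
    by (simp add: power2_norm_eq_inner inner_vec_def column_def sum_product mult_ac)
qed

section \<open>The penalty and the subproblems\<close>

definition total_penalty :: "(real \<Rightarrow> ereal) \<Rightarrow> ('n::finite, 'r::finite) rmat \<Rightarrow> real" where
  "total_penalty \<theta> W = (\<Sum>j\<in>UNIV. real_of_ereal (\<theta> (norm (column j W))))"

lemma penalty_eq_real:
  assumes "penalty_fun \<theta>" "0 \<le> s"
  shows "\<theta> s = ereal (real_of_ereal (\<theta> s))"
proof (cases "s = 0")
  case True
  then show ?thesis using assms by (simp add: penalty_fun_def zero_ereal_def)
next
  case False
  then have "\<theta> s \<noteq> \<infinity>" "\<theta> s \<noteq> -\<infinity>"
    using assms by (auto simp: penalty_fun_def proper_fun_def)
  then show ?thesis by (cases "\<theta> s") auto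
qed

lemma real_penalty_nonneg:
  assumes "penalty_fun \<theta>" "0 \<le> s"
  shows "0 \<le> real_of_ereal (\<theta> s)"
proof (cases "s = 0")
  case False
  then have "0 < \<theta> s" using assms by (auto simp: penalty_fun_def)
  then show ?thesis by (simp add: real_of_ereal_pos)
qed (use assms in \<open>simp add: penalty_fun_def\<close>)

lemma real_penalty_zero: "penalty_fun \<theta> \<Longrightarrow> real_of_ereal (\<theta> 0) = 0"
  by (simp add: penalty_fun_def)

lemma vtheta_eq_total_penalty:
  assumes "penalty_fun \<theta>"
  shows "vtheta \<theta> W = ereal (total_penalty \<theta> W)"
  unfolding vtheta_def total_penalty_def
  by (subst penalty_eq_real[OF assms]) (auto simp: sum_ereal)

lemma total_penalty_nonneg: "penalty_fun \<theta> \<Longrightarrow> 0 \<le> total_penalty \<theta> W"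
  unfolding total_penalty_def by (intro sum_nonneg real_penalty_nonneg) auto

lemma has_derivative_penalty_norm:
  fixes x :: "real^'n"
  assumes "penalty_fun \<theta>" "x \<noteq> 0"
  defines "\<tau> \<equiv> \<lambda>s. real_of_ereal (\<theta> s)"
  shows "((\<lambda>y. \<tau> (norm y)) has_derivative (\<lambda>h. ((deriv \<tau> (norm x) / norm x) *\<^sub>R x) \<bullet> h)) (at x)"
proof -
  have "\<tau> differentiable (at (norm x))"
    using assms(1,2) unfolding \<tau>_def penalty_fun_def by auto
  then have "(\<tau> has_real_derivative deriv \<tau> (norm x)) (at (norm x))"
    using DERIV_deriv_iff_real_differentiable by blast
  then have "(\<tau> has_derivative (\<lambda>t. deriv \<tau> (norm x) * t)) (at (norm x))"
    by (simp add: has_field_derivative_def)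
  from has_derivative_compose[OF has_derivative_norm[OF assms(2)] this]
  show ?thesis by (simp add: sgn_div_norm inner_commute field_simps)
qed

definition column_gap :: "real \<Rightarrow> ('n::finite, 'r::finite) rmat \<Rightarrow> bool" where
  "column_gap c W \<longleftrightarrow> (\<forall>j. column j W \<noteq> 0 \<longrightarrow> c \<le> norm (column j W))"

lemma column_gap_mono: "column_gap c W \<Longrightarrow> c' \<le> c \<Longrightarrow> column_gap c' W"
  by (meson column_gap_def order_trans)

lemma column_gap_perturb:
  assumes "column_gap c A" "norm (A - B) < c / 2" "nonzero_columns A = nonzero_columns B"
  shows "column_gap (c / 2) B"
  unfolding column_gap_def
proof (intro allI impI)
  fix j assume "column j B \<noteq> 0"
  then have "column j A \<noteq> 0" using assms(3) by (auto simp: nonzero_columns_def)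
  then have "c \<le> norm (column j A)" using assms(1) by (simp add: column_gap_def)
  moreover have "norm (column j A - column j B) \<le> norm (A - B)"
    unfolding column_diff[symmetric] by (rule norm_column_le_norm)
  ultimately show "c / 2 \<le> norm (column j B)"
    using assms(2) norm_triangle_ineq2[of "column j A" "column j B"] by linarith
qed

text \<open>A penalty that jumps at 0 is still continuous along matrices whose nonzero columns stay
  away from 0, since a column with limit 0 must then vanish eventually.\<close>

lemma tendsto_total_penalty:
  assumes "penalty_fun \<theta>" "W \<longlonglongrightarrow> W'" "0 < c" "\<forall>\<^sub>F n in sequentially. column_gap c (W n)"
  shows "(\<lambda>n. total_penalty \<theta> (W n)) \<longlonglongrightarrow> total_penalty \<theta> W'"
  unfolding total_penalty_def
proof (intro tendsto_sum)
  fix j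
  have lim: "(\<lambda>n. column j (W n)) \<longlonglongrightarrow> column j W'"
    by (rule tendsto_column[OF assms(2)])
  show "(\<lambda>n. real_of_ereal (\<theta> (norm (column j (W n)))))
          \<longlonglongrightarrow> real_of_ereal (\<theta> (norm (column j W')))"
  proof (cases "column j W' = 0")
    case True
    then have "(\<lambda>n. norm (column j (W n))) \<longlonglongrightarrow> 0"
      using lim by (simp add: tendsto_norm_zero)
    then have "\<forall>\<^sub>F n in sequentially. norm (column j (W n)) < c"
      using assms(3) by (rule order_tendstoD(2))
    then have "\<forall>\<^sub>F n in sequentially. column j (W n) = column j W'"
      using assms(4) by eventually_elim (force simp: column_gap_def True)
    then have "\<forall>\<^sub>F n in sequentially. real_of_ereal (\<theta> (norm (column j W')))
                 = real_of_ereal (\<theta> (norm (column j (W n))))"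
      by eventually_elim simp
    then show ?thesis by (rule Lim_transform_eventually[OF tendsto_const])
  next
    case False
    have "isCont (\<lambda>y. real_of_ereal (\<theta> (norm y))) (column j W')"
      using has_derivative_continuous[OF has_derivative_penalty_norm[OF assms(1) False]] .
    then show ?thesis using lim by (rule isCont_tendsto_compose)
  qed
qed

text \<open>Both subproblems of the iteration have this form, with \<open>H\<close> the gradient at the current
  product for the first factor and its transpose for the second one.\<close>

definition subproblem ::
  "(real \<Rightarrow> ereal) \<Rightarrow> real \<Rightarrow> real \<Rightarrow> real \<Rightarrow> real \<Rightarrow> ('n::finite, 'm::finite) rmat
    \<Rightarrow> ('m, 'r::finite) rmat \<Rightarrow> ('n, 'r) rmat \<Rightarrow> ('n, 'r) rmat \<Rightarrow> real" where
  "subproblem \<theta> lam \<mu> L g H B C A =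
     H \<bullet> ((A - C) ** transpose B) + L / 2 * (norm ((A - C) ** transpose B))\<^sup>2
     + lam * total_penalty \<theta> A + \<mu> / 2 * (norm A)\<^sup>2 + g / 2 * (norm (A - C))\<^sup>2"

definition solves_subproblem ::
  "(real \<Rightarrow> ereal) \<Rightarrow> real \<Rightarrow> real \<Rightarrow> real \<Rightarrow> real \<Rightarrow> ('n::finite, 'm::finite) rmat
    \<Rightarrow> ('m, 'r::finite) rmat \<Rightarrow> ('n, 'r) rmat \<Rightarrow> ('n, 'r) rmat \<Rightarrow> bool" where
  "solves_subproblem \<theta> lam \<mu> L g H B C A \<longleftrightarrow>
     (\<forall>W. subproblem \<theta> lam \<mu> L g H B C A \<le> subproblem \<theta> lam \<mu> L g H B C W)"

lemma total_penalty_single_column: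
  "total_penalty \<theta> (A + single_column j a) - total_penalty \<theta> A
     = real_of_ereal (\<theta> (norm (column j A + a))) - real_of_ereal (\<theta> (norm (column j A)))"
proof -
  have "total_penalty \<theta> (A + single_column j a) - total_penalty \<theta> A
    = (\<Sum>k\<in>UNIV. if k = j then real_of_ereal (\<theta> (norm (column j A + a)))
          - real_of_ereal (\<theta> (norm (column j A))) else 0)"
    unfolding total_penalty_def sum_subtractf[symmetric]
    by (intro sum.cong) (auto simp: column_add column_single_column)
  then show ?thesis by simp
qed

lemma norm_sq_add: "(norm (x + y))\<^sup>2 = (norm x)\<^sup>2 + 2 * (x \<bullet> y) + (norm (y::'a::real_inner))\<^sup>2"
  by (simp add: power2_norm_eq_inner inner_add_left inner_add_right inner_commute)

text \<open>Moving one column makes the smooth part of the subproblem exactly quadratic, with isotropic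
  curvature; this is the column-wise proximal structure of the subproblem.\<close>

lemma solves_subproblem_column:
  fixes A C :: "('n::finite, 'r::finite) rmat" and B :: "('m::finite, 'r) rmat"
    and j :: 'r
  assumes "solves_subproblem \<theta> lam \<mu> L g H B C A"
  defines "q \<equiv> column j ((H + L *\<^sub>R ((A - C) ** transpose B)) ** B + \<mu> *\<^sub>R A + g *\<^sub>R (A - C))"
  shows "0 \<le> q \<bullet> a + (L * (norm (column j B))\<^sup>2 + \<mu> + g) / 2 * (norm a)\<^sup>2
           + lam * (real_of_ereal (\<theta> (norm (column j A + a)))
                    - real_of_ereal (\<theta> (norm (column j A))))"
proof -
  define S where "S = single_column j a"
  define E where "E = (A - C) ** transpose B"
  have split: "(A + S - C) ** transpose B = E + S ** transpose B"
    unfolding E_def matrix_mult_add_left[symmetric] by (simp add: algebra_simps)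
  have AC: "A + S - C = (A - C) + S" by simp
  have n1: "(norm (E + S ** transpose B))\<^sup>2
      = (norm E)\<^sup>2 + 2 * (column j (E ** B) \<bullet> a) + (norm (column j B))\<^sup>2 * (norm a)\<^sup>2"
    unfolding norm_sq_add inner_mult_transpose S_def inner_single_column
    by (simp add: norm_sq_single_column_mult)
  have nS: "(norm S)\<^sup>2 = (norm a)\<^sup>2"
    unfolding S_def power2_norm_eq_inner inner_single_column by (simp add: column_single_column)
  have n2: "(norm (A + S))\<^sup>2 = (norm A)\<^sup>2 + 2 * (column j A \<bullet> a) + (norm a)\<^sup>2"
    unfolding norm_sq_add nS by (simp add: S_def inner_single_column)
  have n3: "(norm (A - C + S))\<^sup>2 = (norm (A - C))\<^sup>2 + 2 * (column j (A - C) \<bullet> a) + (norm a)\<^sup>2"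
    unfolding norm_sq_add nS by (simp add: S_def inner_single_column)
  have n0: "H \<bullet> (E + S ** transpose B) = H \<bullet> E + column j (H ** B) \<bullet> a"
    unfolding inner_add_right inner_mult_transpose S_def inner_single_column by simp
  have n4: "total_penalty \<theta> (A + S) = total_penalty \<theta> A
      + (real_of_ereal (\<theta> (norm (column j A + a))) - real_of_ereal (\<theta> (norm (column j A))))"
    using total_penalty_single_column[of \<theta> A j a] by (simp add: S_def)
  have q: "q \<bullet> a = column j (H ** B) \<bullet> a + L * (column j (E ** B) \<bullet> a)
      + \<mu> * (column j A \<bullet> a) + g * (column j (A - C) \<bullet> a)"
    unfolding q_def E_def[symmetric]
    by (simp add: column_add column_scaleR matrix_mult_add_left matrix_mult_scaleR_left
        inner_add_left)
  have "0 \<le> subproblem \<theta> lam \<mu> L g H B C (A + S) - subproblem \<theta> lam \<mu> L g H B C A"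
    using assms(1) unfolding solves_subproblem_def by simp
  also have "\<dots> = q \<bullet> a + (L * (norm (column j B))\<^sup>2 + \<mu> + g) / 2 * (norm a)\<^sup>2
           + lam * (real_of_ereal (\<theta> (norm (column j A + a)))
                    - real_of_ereal (\<theta> (norm (column j A))))"
    unfolding subproblem_def split unfolding AC unfolding n0 n1 n2 n3 n4 q unfolding E_def[symmetric]
    by (simp add: field_simps)
  finally show ?thesis .
qed

text \<open>The norm of a nonzero column of a solution is a proximal point of \<open>\<theta>\<close> for the parameter
  given by the curvature. Replacing the curvature by its upper bound \<open>\<beta>\<close> keeps it a proximal
  point, of a shifted argument, so the single parameter \<open>lam / \<beta>\<close> serves all iterations.\<close>

lemma solves_subproblem_prox:
  assumes \<theta>: "penalty_fun \<theta>" and lam: "0 < lam" and \<beta>: "0 < \<beta>"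
    and sol: "solves_subproblem \<theta> lam \<mu> L g H B C A"
    and curv: "L * (norm (column j B))\<^sup>2 + \<mu> + g \<le> \<beta>"
    and nz: "column j A \<noteq> 0"
  obtains t where "0 \<le> t" "norm (column j A) \<in> prox_set (lam / \<beta>) \<theta> t"
proof -
  define s where "s = norm (column j A)"
  have s: "0 < s" using nz by (simp add: s_def)
  define q where "q = column j ((H + L *\<^sub>R ((A - C) ** transpose B)) ** B + \<mu> *\<^sub>R A + g *\<^sub>R (A - C))"
  \<comment> \<open>The slope of the linear part along the ray through the column.\<close>
  define p where "p = (q \<bullet> column j A) / s"
  let ?\<tau> = "\<lambda>s. real_of_ereal (\<theta> s)"
  have key: "0 \<le> p * (s' - s) + \<beta> / 2 * (s' - s)\<^sup>2 + lam * (?\<tau> s' - ?\<tau> s)" if s': "0 \<le> s'" for s'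
  proof -
    define a where "a = ((s' - s) / s) *\<^sub>R column j A"
    have na: "(norm a)\<^sup>2 = (s' - s)\<^sup>2"
      using s by (simp add: a_def s_def[symmetric] power_mult_distrib power_divide)
    have "column j A + a = (s' / s) *\<^sub>R column j A"
      using s by (simp add: a_def scaleR_add_left[symmetric] diff_divide_distrib
          scaleR_left_diff_distrib)
    then have nn: "norm (column j A + a) = s'"
      using s s' by (simp add: s_def[symmetric])
    have qa: "q \<bullet> a = p * (s' - s)" by (simp add: a_def p_def)
    have "(L * (norm (column j B))\<^sup>2 + \<mu> + g) / 2 * (s' - s)\<^sup>2 \<le> \<beta> / 2 * (s' - s)\<^sup>2"
      using curv by (intro mult_right_mono) auto
    then show ?thesis
      using solves_subproblem_column[OF sol, of j a, folded q_def]
      unfolding nn na qa s_def[symmetric] by linarith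
  qed
  \<comment> \<open>Completing the square in the one-dimensional inequality determines the proximal argument;
    the comparison with a vanishing column shows that it is nonnegative.\<close>
  define t where "t = s - p / \<beta>"
  have "0 \<le> - p * s + \<beta> / 2 * s\<^sup>2 + lam * (- ?\<tau> s)"
    using key[of 0] \<theta> by (simp add: penalty_fun_def)
  moreover have "0 \<le> lam * ?\<tau> s"
    using lam s real_penalty_nonneg[OF \<theta>, of s] by simp
  ultimately have "p * s \<le> (\<beta> / 2 * s) * s" by (simp add: power2_eq_square)
  then have "p \<le> \<beta> / 2 * s" using s mult_right_le_imp_le by blast
  then have "p / \<beta> \<le> s / 2" using \<beta> by (simp add: field_simps)
  then have t0: "0 \<le> t" using s unfolding t_def by linarith
  have "ereal (1 / (2 * (lam / \<beta>)) * (t - s)\<^sup>2) + \<theta> s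
      \<le> ereal (1 / (2 * (lam / \<beta>)) * (t - s')\<^sup>2) + \<theta> s'" for s'
  proof (cases "s' < 0")
    case True
    then show ?thesis using \<theta> by (simp add: penalty_fun_def)
  next
    case False
    then have s': "0 \<le> s'" by simp
    have "lam * (1 / (2 * (lam / \<beta>)) * ((t - s')\<^sup>2 - (t - s)\<^sup>2) + (?\<tau> s' - ?\<tau> s))
        = p * (s' - s) + \<beta> / 2 * (s' - s)\<^sup>2 + lam * (?\<tau> s' - ?\<tau> s)"
      using lam \<beta> unfolding t_def by (simp add: field_simps power2_eq_square)
    then have "0 \<le> lam * (1 / (2 * (lam / \<beta>)) * ((t - s')\<^sup>2 - (t - s)\<^sup>2) + (?\<tau> s' - ?\<tau> s))"
      using key[OF s'] by simp
    then have "0 \<le> 1 / (2 * (lam / \<beta>)) * ((t - s')\<^sup>2 - (t - s)\<^sup>2) + (?\<tau> s' - ?\<tau> s)"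
      using lam by (simp add: zero_le_mult_iff)
    then have "1 / (2 * (lam / \<beta>)) * (t - s)\<^sup>2 + ?\<tau> s \<le> 1 / (2 * (lam / \<beta>)) * (t - s')\<^sup>2 + ?\<tau> s'"
      by (simp add: right_diff_distrib)
    then show ?thesis
      using penalty_eq_real[OF \<theta> s'] penalty_eq_real[OF \<theta>, of s] s
      by (metis ereal_less_eq(3) less_eq_real_def plus_ereal.simps(1))
  qed
  then have "s \<in> prox_set (lam / \<beta>) \<theta> t" by (simp add: prox_set_def argmin_set_def)
  with t0 show thesis using that unfolding s_def by blast
qed

text \<open>The constant is chosen before the data of the subproblem, so one gap serves all iterations.\<close>

lemma solves_subproblem_column_gap:
  assumes "penalty_fun \<theta>" "0 < lam" "0 < \<beta>" "prox_gap \<theta> (lam / \<beta>)"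
  obtains c where "0 < c"
    "\<And>g H B C A. solves_subproblem \<theta> lam \<mu> L g (H :: ('n::finite, 'm::finite) rmat)
        (B :: ('m, 'r::finite) rmat) C A \<Longrightarrow>
      (\<And>j. L * (norm (column j B))\<^sup>2 + \<mu> + g \<le> \<beta>) \<Longrightarrow> column_gap c A"
proof -
  obtain c where c: "0 < c" and prox: "\<And>t. 0 \<le> t \<Longrightarrow>
      prox_set (lam / \<beta>) \<theta> t = {0} \<or> (\<forall>s \<in> prox_set (lam / \<beta>) \<theta> t - {0}. c \<le> s)"
    using assms(4) unfolding prox_gap_def by blast
  have "column_gap c A" if sol: "solves_subproblem \<theta> lam \<mu> L g H B C A"
    and curv: "\<And>j. L * (norm (column j B))\<^sup>2 + \<mu> + g \<le> \<beta>"
    for g and H :: "('n, 'm) rmat" and B :: "('m, 'r) rmat" and C A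
    unfolding column_gap_def
  proof (intro allI impI)
    fix j assume nz: "column j A \<noteq> 0"
    obtain t where t: "0 \<le> t" "norm (column j A) \<in> prox_set (lam / \<beta>) \<theta> t"
      by (rule solves_subproblem_prox[OF assms(1-3) sol curv nz])
    have "norm (column j A) \<noteq> 0" using nz by simp
    then show "c \<le> norm (column j A)" using prox[OF t(1)] t(2) by blast
  qed
  with c show thesis using that by blast
qed

text \<open>When the solution is the proximal centre itself, the quadratic terms contribute nothing to the
  first-order condition except for the regularizer \<open>\<mu>\<close>.\<close>

lemma solves_subproblem_first_order:
  assumes \<theta>: "penalty_fun \<theta>" and sol: "solves_subproblem \<theta> lam \<mu> L g H B A A"
    and nz: "column j A \<noteq> 0"
  shows "H *v column j B + (\<mu> + lam * deriv (\<lambda>s. real_of_ereal (\<theta> s)) (norm (column j A))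
            / norm (column j A)) *\<^sub>R column j A = 0"
proof -
  let ?x = "column j A" and ?\<tau> = "\<lambda>s. real_of_ereal (\<theta> s)"
  let ?d = "deriv ?\<tau> (norm ?x) / norm ?x"
  define q where "q = H *v column j B + \<mu> *\<^sub>R ?x"
  define K where "K = (L * (norm (column j B))\<^sup>2 + \<mu> + g) / 2"
  define F where "F = (\<lambda>y. q \<bullet> (y - ?x) + K * ((y - ?x) \<bullet> (y - ?x)) + lam * (?\<tau> (norm y) - ?\<tau> (norm ?x)))"
  have q: "q = column j ((H + L *\<^sub>R ((A - A) ** transpose B)) ** B + \<mu> *\<^sub>R A + g *\<^sub>R (A - A))"
    unfolding q_def
    by (simp add: column_add column_scaleR column_matrix_mult matrix_mult_diff_left)
  have "0 \<le> F y" for y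
    using solves_subproblem_column[OF sol, of j "y - ?x", folded q K_def]
    by (simp add: F_def power2_norm_eq_inner)
  moreover have "F ?x = 0" by (simp add: F_def)
  moreover have "(F has_derivative (\<lambda>h. q \<bullet> h + lam * ((?d *\<^sub>R ?x) \<bullet> h))) (at ?x)"
    unfolding F_def
    by (rule derivative_eq_intros has_derivative_penalty_norm[OF \<theta> nz] refl | simp)+
  ultimately have zero: "(\<lambda>h. q \<bullet> h + lam * ((?d *\<^sub>R ?x) \<bullet> h)) = (\<lambda>h. 0)"
    by (intro differential_zero_maxmin[of ?x UNIV F]) auto
  have "(q + (lam * ?d) *\<^sub>R ?x) \<bullet> h = 0" for h
    using fun_cong[OF zero, of h] by (simp add: inner_add_left)
  then have "q + (lam * ?d) *\<^sub>R ?x = 0" using inner_eq_zero_iff by blast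
  then show ?thesis unfolding q_def by (simp add: scaleR_add_left add.assoc)
qed

text \<open>The derivative of \<open>\<theta>\<close> may be discontinuous, so first-order conditions need not survive a limit.
  Minimality does, and the first-order condition is then derived at the limit.\<close>

lemma solves_subproblem_limit:
  assumes sol: "\<And>n::nat. solves_subproblem \<theta> lam \<mu> L (g n) (H n) (B n) (C n) (A n)"
    and lims: "g \<longlonglongrightarrow> g'" "H \<longlonglongrightarrow> H'" "B \<longlonglongrightarrow> B'" "C \<longlonglongrightarrow> C'" "A \<longlonglongrightarrow> A'"
    and pen: "(\<lambda>n. total_penalty \<theta> (A n)) \<longlonglongrightarrow> total_penalty \<theta> A'"
  shows "solves_subproblem \<theta> lam \<mu> L g' H' B' C' A'"
  unfolding solves_subproblem_def
proof
  fix W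
  have "(\<lambda>n. subproblem \<theta> lam \<mu> L (g n) (H n) (B n) (C n) (A n))
          \<longlonglongrightarrow> subproblem \<theta> lam \<mu> L g' H' B' C' A'"
    unfolding subproblem_def
    by (intro tendsto_add tendsto_diff tendsto_mult tendsto_inner tendsto_power tendsto_norm
        tendsto_divide tendsto_const tendsto_matrix_mult tendsto_transpose zero_neq_numeral[symmetric] lims pen)
  moreover have "(\<lambda>n. subproblem \<theta> lam \<mu> L (g n) (H n) (B n) (C n) W)
          \<longlonglongrightarrow> subproblem \<theta> lam \<mu> L g' H' B' C' W"
    unfolding subproblem_def
    by (intro tendsto_add tendsto_diff tendsto_mult tendsto_inner tendsto_power tendsto_norm
        tendsto_divide tendsto_const tendsto_matrix_mult tendsto_transpose zero_neq_numeral[symmetric] lims)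
  ultimately show "subproblem \<theta> lam \<mu> L g' H' B' C' A' \<le> subproblem \<theta> lam \<mu> L g' H' B' C' W"
    using sol unfolding solves_subproblem_def by (intro LIMSEQ_le) auto
qed

text \<open>The gap between both sides, along the segment from \<open>x\<close> to \<open>y\<close>, has a derivative of constant
  sign by the Lipschitz bound.\<close>

lemma lipschitz_gradient_descent:
  fixes f :: "'a::real_inner \<Rightarrow> real"
  assumes grad: "\<And>x. GDERIV f x :> gf x" and lip: "L-lipschitz_on UNIV gf"
  shows "f y \<le> f x + gf x \<bullet> (y - x) + L / 2 * (norm (y - x))\<^sup>2"
proof -
  define d where "d = y - x"
  define \<psi> where "\<psi> = (\<lambda>t. f (x + t *\<^sub>R d) - t * (gf x \<bullet> d) - L / 2 * t\<^sup>2 * (norm d)\<^sup>2)"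
  have "\<exists>D. (\<psi> has_real_derivative D) (at t) \<and> D \<le> 0" if "0 \<le> t" for t
  proof (intro exI conjI)
    have "(f has_derivative (\<lambda>h. h \<bullet> gf (x + t *\<^sub>R d))) (at (x + t *\<^sub>R d))"
      using grad by (simp add: gderiv_def)
    then have "((\<lambda>t. f (x + t *\<^sub>R d)) has_derivative (\<lambda>s. (s *\<^sub>R d) \<bullet> gf (x + t *\<^sub>R d))) (at t)"
      by (rule has_derivative_compose[rotated]) (auto intro!: derivative_eq_intros)
    then have "((\<lambda>t. f (x + t *\<^sub>R d)) has_real_derivative (gf (x + t *\<^sub>R d) \<bullet> d)) (at t)"
      unfolding has_field_derivative_def
      by (rule has_derivative_eq_rhs) (auto simp: inner_commute)
    then show "(\<psi> has_real_derivative
        (gf (x + t *\<^sub>R d) \<bullet> d - gf x \<bullet> d - L * t * (norm d)\<^sup>2)) (at t)"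
      unfolding \<psi>_def by (auto intro!: derivative_eq_intros)
    have "(gf (x + t *\<^sub>R d) - gf x) \<bullet> d \<le> norm (gf (x + t *\<^sub>R d) - gf x) * norm d"
      by (rule norm_cauchy_schwarz)
    also have "\<dots> \<le> (L * (t * norm d)) * norm d"
      using lipschitz_onD[OF lip, of "x + t *\<^sub>R d" x] that
      by (intro mult_right_mono) (auto simp: dist_norm)
    finally show "gf (x + t *\<^sub>R d) \<bullet> d - gf x \<bullet> d - L * t * (norm d)\<^sup>2 \<le> 0"
      by (simp add: inner_diff_left power2_eq_square mult_ac)
  qed
  then have "\<psi> 1 \<le> \<psi> 0"
    using DERIV_nonpos_imp_nonincreasing[of 0 1 \<psi>] by simp
  then show ?thesis by (simp add: \<psi>_def d_def)
qed

section \<open>The Kurdyka--Lojasiewicz argument\<close>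

text \<open>The form in which concavity enters the convergence argument: the slope at \<open>s\<close>
  bounds the increment of \<open>\<phi>\<close> from below.\<close>

lemma desingularizing_above_tangent:
  assumes des: "desingularizing \<eta> \<phi>" and t: "0 < t" "0 < s" "ereal s < \<eta>" "ereal t < \<eta>"
  shows "deriv \<phi> s * (s - t) \<le> \<phi> s - \<phi> t"
proof -
  define I where "I = {t. 0 < t \<and> ereal t < \<eta>}"
  have I: "open I"
    unfolding I_def by (intro open_Collect_conj open_Collect_less continuous_intros)
  have conv: "convex I"
    unfolding is_interval_convex_1[symmetric] is_interval_1
  proof (intro ballI allI impI)
    fix a b x assume "a \<in> I" "b \<in> I" "a \<le> x \<and> x \<le> b"
    then show "x \<in> I" unfolding I_def by (auto intro: le_less_trans[of "ereal x" "ereal b"])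
  qed
  have "concave_on {t. 0 \<le> t \<and> ereal t < \<eta>} \<phi>"
    using des by (simp add: desingularizing_def)
  then have "convex_on I (\<lambda>x. - \<phi> x)"
    unfolding concave_on_def by (rule convex_on_subset) (use conv in \<open>auto simp: I_def\<close>)
  moreover have "\<phi> differentiable (at s)"
    using des t by (simp add: desingularizing_def)
  then have "((\<lambda>x. - \<phi> x) has_real_derivative - deriv \<phi> s) (at s within I)"
    using DERIV_deriv_iff_real_differentiable has_field_derivative_at_within
    by (intro DERIV_minus) blast
  ultimately have "- \<phi> t - (- \<phi> s) \<ge> - deriv \<phi> s * (t - s)"
  proof (intro convex_on_imp_above_tangent[where A = I])
    show "connected I" by (rule convex_connected[OF conv])
    show "s \<in> interior I" "t \<in> I" using t by (auto simp: interior_open[OF I]) (auto simp: I_def)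
  qed
  then show ?thesis by (simp add: algebra_simps)
qed

text \<open>The potential \<open>(\<Sum>i<n. d i) + 2 d n + 2 e n\<close> is nonincreasing in \<open>n\<close>.\<close>

lemma summable_half_recursion:
  fixes d e :: "nat \<Rightarrow> real"
  assumes "\<And>n. 0 \<le> d n" "\<And>n. 0 \<le> e n" "\<And>n. d (Suc n) \<le> d n / 2 + (e n - e (Suc n))"
  shows "summable d"
proof (rule summableI_nonneg_bounded)
  have "(\<Sum>i<n. d i) + 2 * d n + 2 * e n \<le> 2 * d 0 + 2 * e 0" for n
  proof (induction n)
    case (Suc n)
    then show ?case using assms(3)[of n] by simp
  qed simp
  then show "(\<Sum>i<n. d i) \<le> 2 * d 0 + 2 * e 0" for n
    using assms(1,2)[of n] by (smt (verit))
qed (use assms(1) in auto)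

text \<open>The closures of the tails of a bounded sequence are nested compact sets whose intersection
  consists of cluster points. A finite subcover of the intersection thus covers a whole tail.\<close>

lemma eventually_in_finite_cover_of_cluster_points:
  fixes z :: "nat \<Rightarrow> 'a::euclidean_space"
  assumes bdd: "bounded (range z)" and \<delta>: "\<And>w. w \<in> cluster_points z \<Longrightarrow> 0 < \<delta> w"
  obtains F where "finite F" "F \<subseteq> cluster_points z"
    "\<forall>\<^sub>F n in sequentially. \<exists>w\<in>F. dist w (z n) < \<delta> w"
proof -
  define T where "T N = closure (z ` {N..})" for N
  define \<Omega> where "\<Omega> = (\<Inter>N. T N)"
  have comp0: "compact (T 0)"
    unfolding T_def using bdd by (simp add: compact_closure bounded_subset)
  have "closed \<Omega>" unfolding \<Omega>_def T_def by auto
  then have comp: "compact \<Omega>"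
    using comp0 unfolding \<Omega>_def by (metis INT_lower UNIV_I compact_Int_closed inf.absorb_iff2)
  have \<Omega>_sub: "\<Omega> \<subseteq> cluster_points z"
  proof
    fix w assume w: "w \<in> \<Omega>"
    have ex: "\<exists>k>m. dist (z k) w < inverse (Suc n)" for m n
    proof -
      have "w \<in> closure (z ` {Suc m..})" using w by (auto simp: \<Omega>_def T_def)
      then obtain y where "y \<in> z ` {Suc m..}" "dist y w < inverse (Suc n)"
        unfolding closure_approachable
        using positive_imp_inverse_positive[OF of_nat_0_less_iff[THEN iffD2, OF zero_less_Suc[of n]]]
        by blast
      then show ?thesis by (auto simp: Suc_le_eq)
    qed
    obtain s where s: "\<And>n. dist (z (s n)) w < inverse (Suc n)" "\<And>n. s n < s (Suc n)"
      using dependent_nat_choice[of "\<lambda>n k. dist (z k) w < inverse (Suc n)" "\<lambda>n k k'. k < k'"] ex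
      by (metis (no_types, lifting))
    have "(\<lambda>n. dist ((z \<circ> s) n) w) \<longlonglongrightarrow> 0"
    proof (rule tendsto_sandwich[OF _ _ tendsto_const LIMSEQ_inverse_real_of_nat])
      show "\<forall>\<^sub>F n in sequentially. dist ((z \<circ> s) n) w \<le> inverse (real (Suc n))"
        using s(1) by (intro always_eventually allI) (simp only: o_def less_imp_le)
    qed simp
    then have "(z \<circ> s) \<longlonglongrightarrow> w" by (rule tendsto_dist_iff[THEN iffD2])
    moreover have "strict_mono s" using s(2) by (simp add: strict_mono_Suc_iff)
    ultimately show "w \<in> cluster_points z" unfolding cluster_points_def by blast
  qed
  have "\<Omega> \<subseteq> (\<Union>w\<in>\<Omega>. ball w (\<delta> w))"
    using \<delta> \<Omega>_sub by (auto intro!: UN_I)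
  then obtain F where F: "F \<subseteq> \<Omega>" "finite F" "\<Omega> \<subseteq> (\<Union>w\<in>F. ball w (\<delta> w))"
    by (rule compactE_image[OF comp, rotated]) auto
  define G where "G = (\<Union>w\<in>F. ball w (\<delta> w))"
  have "\<exists>N. T N \<subseteq> G"
  proof (rule ccontr)
    assume "\<nexists>N. T N \<subseteq> G"
    then have ne: "T N - G \<noteq> {}" for N by blast
    have "open G" unfolding G_def by auto
    then have "compact (T N - G)" for N
      using comp0 unfolding T_def
      by (intro compact_diff) (auto simp: compact_closure intro: bounded_subset[OF bdd])
    moreover have "T n - G \<subseteq> T m - G" if "m \<le> n" for m n
      using that unfolding T_def by (intro Diff_mono closure_mono image_mono) auto
    ultimately have "(\<Inter>N. T N - G) \<noteq> {}"
      using ne by (intro compact_nest) auto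
    then show False using F(3) unfolding G_def[symmetric] \<Omega>_def by blast
  qed
  then obtain N where N: "T N \<subseteq> G" by blast
  have "\<forall>\<^sub>F n in sequentially. \<exists>w\<in>F. dist w (z n) < \<delta> w"
    unfolding eventually_sequentially
  proof (intro exI allI impI)
    fix n assume "N \<le> n"
    then have "z n \<in> T N" unfolding T_def by (intro closure_subset[THEN subsetD]) auto
    then have "z n \<in> G" using N by blast
    then show "\<exists>w\<in>F. dist w (z n) < \<delta> w" by (auto simp: G_def)
  qed
  with F \<Omega>_sub that show thesis by blast
qed

text \<open>The points \<open>z k\<close> need not approach a single limit, so the inequality is used on a finite cover of
  the set of cluster points, on which \<open>h\<close> has a constant value \<open>h*\<close>. With \<open>\<psi>\<close> the sum of the finitely
  many desingularizing functions, concavity gives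
  \<open>d (k+1)\<^sup>2 \<le> (b/a) d k (\<psi> (h (z (k+1)) - h*) - \<psi> (h (z (k+2)) - h*))\<close>, and the arithmetic-geometric mean
  inequality turns this into a recursion with factor \<open>1/2\<close> and a telescoping remainder.\<close>

theorem KL_descent_summable:
  fixes z :: "nat \<Rightarrow> 'a::euclidean_space" and h :: "'a \<Rightarrow> real" and d :: "nat \<Rightarrow> real"
  assumes bdd: "bounded (range z)" and pos: "0 < a" "0 < b" "\<And>k. 0 \<le> d k"
    and descent: "\<And>k. K \<le> k \<Longrightarrow> h (z (Suc k)) + a * (d k)\<^sup>2 \<le> h (z k)"
    and subgrad: "\<And>k. K \<le> k \<Longrightarrow>
      dist_zero (limiting_subdiff (\<lambda>x. ereal (h x)) (z (Suc k))) \<le> ereal (b * d k)"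
    and cluster: "\<And>s w. strict_mono s \<Longrightarrow> (z \<circ> s) \<longlonglongrightarrow> w \<Longrightarrow>
      (\<lambda>n. h (z (s n))) \<longlonglongrightarrow> h w \<and> KL_property (\<lambda>x. ereal (h x)) w"
  shows "summable d"
proof -
  have dec: "h (z l) \<le> h (z k)" if "K \<le> k" "k \<le> l" for k l
    using that(2)
  proof (induction l rule: dec_induct)
    case (step l)
    have "0 \<le> a * (d l)\<^sup>2" using pos by simp
    then show ?case using step descent[of l] that(1) by simp
  qed simp
  obtain w0 s0 where s0: "strict_mono s0" "(z \<circ> s0) \<longlonglongrightarrow> w0"
    using bdd bounded_imp_convergent_subsequence by metis
  define hs where "hs = h w0"
  have ge: "hs \<le> h (z k)" if "K \<le> k" for k
    unfolding hs_def
  proof (rule tendsto_upperbound[OF conjunct1[OF cluster[OF s0]] _ sequentially_bot])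
    show "\<forall>\<^sub>F n in sequentially. h (z (s0 n)) \<le> h (z k)"
      unfolding eventually_sequentially
      using that dec s0(1) by (meson le_trans seq_suble)
  qed
  have lim: "(\<lambda>k. h (z k)) \<longlonglongrightarrow> hs"
  proof (rule order_tendstoI)
    fix y assume "y < hs"
    then show "\<forall>\<^sub>F k in sequentially. y < h (z k)"
      unfolding eventually_sequentially using ge by (meson less_le_trans)
  next
    fix y assume "hs < y"
    then have "\<forall>\<^sub>F n in sequentially. h (z (s0 n)) < y"
      using conjunct1[OF cluster[OF s0]] unfolding hs_def by (rule order_tendstoD(2)[rotated])
    then obtain n where n: "h (z (s0 n)) < y" "K \<le> n"
      using eventually_happens'[OF sequentially_bot, OF eventually_conj[OF _ eventually_ge_at_top[of K]]]
      by blast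
    then have "K \<le> s0 n" using s0(1) by (meson le_trans seq_suble)
    then show "\<forall>\<^sub>F k in sequentially. h (z k) < y"
      unfolding eventually_sequentially using dec n(1) by (meson le_less_trans)
  qed
  have hs: "h w = hs" if w: "w \<in> cluster_points z" for w
  proof -
    obtain s where s: "strict_mono s" "(z \<circ> s) \<longlonglongrightarrow> w"
      using w unfolding cluster_points_def by blast
    have "(\<lambda>n. h (z (s n))) \<longlonglongrightarrow> hs"
      using LIMSEQ_subseq_LIMSEQ[OF lim s(1)] by (simp add: o_def)
    then show ?thesis using conjunct1[OF cluster[OF s]] LIMSEQ_unique by blast
  qed
  show ?thesis
  proof (cases "\<exists>k\<ge>K. h (z k) = hs")
    case True
    then obtain k0 where k0: "K \<le> k0" "h (z k0) = hs" by blast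
    have "d k = 0" if "k0 \<le> k" for k
    proof -
      have "h (z k) = hs" "hs \<le> h (z (Suc k))"
        using dec[OF k0(1) that] ge[of k] ge[of "Suc k"] k0 that by auto
      then have "a * (d k)\<^sup>2 \<le> 0" using descent[of k] k0 that by auto
      then show ?thesis using pos(1) by (simp add: mult_le_0_iff not_le)
    qed
    then show ?thesis by (intro summable_finite[of "{..<k0}"]) auto
  next
    case False
    then have gt: "hs < h (z k)" if "K \<le> k" for k
      using ge[OF that] that by force
    have "\<forall>w\<in>cluster_points z. \<exists>\<delta>>0. \<exists>\<eta>>0. \<exists>\<phi>. desingularizing \<eta> \<phi> \<and>
        (\<forall>x\<in>cball w \<delta>. ereal hs < ereal (h x) \<and> ereal (h x) < ereal hs + \<eta> \<longrightarrow>
           1 \<le> ereal (deriv \<phi> (h x - hs)) * dist_zero (limiting_subdiff (\<lambda>x. ereal (h x)) x))"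
      (is "\<forall>w\<in>_. ?Q w")
    proof
      fix w assume w: "w \<in> cluster_points z"
      then have "KL_property (\<lambda>x. ereal (h x)) w"
        using cluster unfolding cluster_points_def by blast
      then show "?Q w"
        unfolding KL_property_def hs[OF w] by simp
    qed
    then obtain \<delta> \<eta> \<phi> where KL: "\<And>w. w \<in> cluster_points z \<Longrightarrow>
        0 < \<delta> w \<and> 0 < \<eta> w \<and> desingularizing (\<eta> w) (\<phi> w) \<and>
        (\<forall>x\<in>cball w (\<delta> w). ereal hs < ereal (h x) \<and> ereal (h x) < ereal hs + \<eta> w \<longrightarrow>
           1 \<le> ereal (deriv (\<phi> w) (h x - hs)) * dist_zero (limiting_subdiff (\<lambda>x. ereal (h x)) x))"
      by metis
    obtain F where F: "finite F" "F \<subseteq> cluster_points z"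
      and near: "\<forall>\<^sub>F n in sequentially. \<exists>w\<in>F. dist w (z n) < \<delta> w"
      using eventually_in_finite_cover_of_cluster_points[OF bdd, of \<delta>] KL by blast
    define t where "t k = h (z k) - hs" for k
    \<comment> \<open>The sum of the finitely many functions inherits the gradient inequality of each of them.\<close>
    define \<psi> where "\<psi> k = (\<Sum>w\<in>F. \<phi> w (t k))" for k
    define \<psi>' where "\<psi>' k = (\<Sum>w\<in>F. deriv (\<phi> w) (t k))" for k
    have "\<forall>\<^sub>F k in sequentially. ereal (t k) < \<eta> w" if "w \<in> F" for w
    proof -
      have "(\<lambda>k. ereal (t k)) \<longlonglongrightarrow> ereal 0"
        unfolding t_def using tendsto_diff[OF lim tendsto_const[of hs]] by simp
      moreover have "ereal 0 < \<eta> w" using KL that F(2) by (auto simp: zero_ereal_def[symmetric])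
      ultimately show ?thesis by (rule order_tendstoD(2))
    qed
    then have "\<forall>\<^sub>F k in sequentially. \<forall>w\<in>F. ereal (t k) < \<eta> w"
      using F(1) by (simp add: eventually_ball_finite)
    then have "\<forall>\<^sub>F k in sequentially. K \<le> k \<and> (\<forall>w\<in>F. ereal (t k) < \<eta> w) \<and>
        (\<exists>w\<in>F. dist w (z k) < \<delta> w)"
      using near eventually_ge_at_top[of K] by eventually_elim blast
    then obtain N where N: "\<And>k. N \<le> k \<Longrightarrow> K \<le> k \<and> (\<forall>w\<in>F. ereal (t k) < \<eta> w) \<and>
        (\<exists>w\<in>F. dist w (z k) < \<delta> w)"
      unfolding eventually_sequentially by blast
    have tpos: "0 < t k" if "N \<le> k" for k using gt N that by (simp add: t_def)
    have des: "desingularizing (\<eta> w) (\<phi> w)" if "w \<in> F" for w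
      using KL[of w] that F(2) by blast
    have t\<eta>: "ereal (t k) < \<eta> w" if "w \<in> F" "N \<le> k" for w k
      using N that by blast
    have dpos: "0 < deriv (\<phi> w) (t k)" if "w \<in> F" "N \<le> k" for w k
      using des[OF that(1)] t\<eta>[OF that] tpos[OF that(2)] by (simp add: desingularizing_def)
    have \<psi>0: "0 \<le> \<psi> k" if "N \<le> k" for k
      unfolding \<psi>_def
    proof (rule sum_nonneg)
      fix w assume "w \<in> F"
      then show "0 \<le> \<phi> w (t k)"
        using des[of w] t\<eta>[of w k] tpos[of k] that by (simp add: desingularizing_def)
    qed
    have tangent: "\<psi>' k * (t k - t (Suc k)) \<le> \<psi> k - \<psi> (Suc k)" if "N \<le> k" for k
      unfolding \<psi>_def \<psi>'_def sum_distrib_right sum_subtractf[symmetric]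
    proof (rule sum_mono)
      fix w assume w: "w \<in> F"
      have "N \<le> Suc k" using that by simp
      with w that show "deriv (\<phi> w) (t k) * (t k - t (Suc k)) \<le> \<phi> w (t k) - \<phi> w (t (Suc k))"
        by (intro desingularizing_above_tangent[OF des[OF w]] tpos t\<eta>)
    qed
    have grad: "1 \<le> \<psi>' (Suc k) * (b * d k)" if "N \<le> k" for k
    proof -
      have k: "N \<le> Suc k" using that by simp
      obtain w where w: "w \<in> F" "dist w (z (Suc k)) < \<delta> w" using N[OF k] by blast
      have in_ball: "z (Suc k) \<in> cball w (\<delta> w)" using w(2) by simp
      have gap: "ereal hs < ereal (h (z (Suc k)))" using gt N[OF k] by simp
      have "ereal (t (Suc k)) < \<eta> w" using N[OF k] w(1) by blast
      then have lt: "ereal (h (z (Suc k))) < ereal hs + \<eta> w"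
        unfolding t_def by (cases "\<eta> w") auto
      have "1 \<le> ereal (deriv (\<phi> w) (t (Suc k)))
              * dist_zero (limiting_subdiff (\<lambda>x. ereal (h x)) (z (Suc k)))"
        using KL[of w] w(1) F(2) in_ball gap lt unfolding t_def by blast
      also have "\<dots> \<le> ereal (deriv (\<phi> w) (t (Suc k))) * ereal (b * d k)"
        using subgrad[of k] N[OF that] dpos[OF w(1) k] by (intro ereal_mult_left_mono) auto
      finally have "1 \<le> deriv (\<phi> w) (t (Suc k)) * (b * d k)" by (simp add: one_ereal_def)
      also have "\<dots> \<le> \<psi>' (Suc k) * (b * d k)"
      proof (rule mult_right_mono)
        show "deriv (\<phi> w) (t (Suc k)) \<le> \<psi>' (Suc k)"
          unfolding \<psi>'_def using F(1) w(1) dpos k by (intro member_le_sum) (auto simp: less_imp_le)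
        show "0 \<le> b * d k" using pos by simp
      qed
      finally show ?thesis .
    qed
    define M where "M = b / (2 * a)"
    have M: "0 \<le> M" using pos by (simp add: M_def)
    have rec: "d (Suc k) \<le> d k / 2 + (M * \<psi> (Suc k) - M * \<psi> (Suc (Suc k)))"
      if "N \<le> k" for k
    proof -
      have k: "N \<le> Suc k" using that by simp
      have "\<psi>' (Suc k) > 0" if "F \<noteq> {}"
        unfolding \<psi>'_def using dpos k F(1) that by (intro sum_pos) auto
      moreover have "F \<noteq> {}" using N[OF k] by blast
      ultimately have p: "0 < \<psi>' (Suc k)" by blast
      define \<Delta> where "\<Delta> = \<psi> (Suc k) - \<psi> (Suc (Suc k))"
      have "a * (d (Suc k))\<^sup>2 \<le> t (Suc k) - t (Suc (Suc k))"
        using descent[of "Suc k"] N[OF k] by (simp add: t_def)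
      then have "\<psi>' (Suc k) * (a * (d (Suc k))\<^sup>2) \<le> \<Delta>"
        unfolding \<Delta>_def
        by (rule order_trans[OF mult_left_mono[OF _ less_imp_le[OF p]] tangent[OF k]])
      then have "(b * d k) * (\<psi>' (Suc k) * (a * (d (Suc k))\<^sup>2)) \<le> (b * d k) * \<Delta>"
        using pos by (intro mult_left_mono) auto
      moreover have "1 * (a * (d (Suc k))\<^sup>2) \<le> (\<psi>' (Suc k) * (b * d k)) * (a * (d (Suc k))\<^sup>2)"
        using grad[OF that] pos(1) by (intro mult_right_mono) auto
      ultimately have "a * (d (Suc k))\<^sup>2 \<le> (b * d k) * \<Delta>" by (simp add: mult_ac)
      then have sq: "(d (Suc k))\<^sup>2 \<le> d k * (b / a * \<Delta>)"
        using pos(1) by (simp add: field_simps)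
      have "0 \<le> \<psi>' (Suc k) * (a * (d (Suc k))\<^sup>2)" using p pos(1) by simp
      with \<open>\<psi>' (Suc k) * (a * (d (Suc k))\<^sup>2) \<le> \<Delta>\<close> have "0 \<le> \<Delta>" by (rule order_trans[rotated])
      then have e: "0 \<le> b / a * \<Delta>" using pos by simp
      have "4 * (x * y) \<le> (x + y)\<^sup>2" for x y :: real
        using zero_le_power2[of "x - y"] by (simp add: power2_eq_square algebra_simps)
      from this[of "d k" "b / a * \<Delta>"] have "(2 * d (Suc k))\<^sup>2 \<le> (d k + b / a * \<Delta>)\<^sup>2"
        using sq by (simp add: power_mult_distrib)
      then have "2 * d (Suc k) \<le> d k + b / a * \<Delta>"
        by (rule power2_le_imp_le[OF _ add_nonneg_nonneg[OF pos(3) e]])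
      moreover have "b / a * \<Delta> = 2 * (M * \<psi> (Suc k) - M * \<psi> (Suc (Suc k)))"
        unfolding \<Delta>_def M_def using pos(1) by (simp add: field_simps)
      ultimately show ?thesis by simp
    qed
    have "summable (\<lambda>n. d (n + N))"
    proof (rule summable_half_recursion)
      show "0 \<le> d (n + N)" for n by (rule pos(3))
      show "0 \<le> M * \<psi> (Suc (n + N))" for n
        using \<psi>0[of "Suc (n + N)"] M by simp
      show "d (Suc n + N) \<le> d (n + N) / 2 + (M * \<psi> (Suc (n + N)) - M * \<psi> (Suc (Suc n + N)))" for n
        using rec[of "n + N"] by simp
    qed
    then show ?thesis by (rule summable_iff_shift[THEN iffD1])
  qed
qed

section \<open>Positions, rectangular diagonal matrices and singular values\<close>

lemma pos_less:
  fixes i j :: "'a::{finite,linorder}"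
  assumes "i < j"
  shows "pos i < pos j"
  unfolding pos_def
proof (rule psubset_card_mono)
  have "j \<in> {k. k \<le> j}" "j \<notin> {k. k \<le> i}" "{k. k \<le> i} \<subseteq> {k. k \<le> j}" using assms by auto
  then show "{k. k \<le> i} \<subset> {k. k \<le> j}" by blast
qed simp

lemma pos_eq_iff [simp]:
  fixes i j :: "'a::{finite,linorder}"
  shows "pos i = pos j \<longleftrightarrow> i = j"
  using pos_less[of i j] pos_less[of j i] by (cases i j rule: linorder_cases) auto

lemma pos_le_iff:
  fixes i j :: "'a::{finite,linorder}"
  shows "pos i \<le> pos j \<longleftrightarrow> i \<le> j"
  using pos_less[of i j] pos_less[of j i] by (cases i j rule: linorder_cases) auto

lemma bij_betw_pos: "bij_betw (pos :: 'a::{finite,linorder} \<Rightarrow> nat) UNIV {1..CARD('a)}"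
  unfolding bij_betw_def
proof
  show inj: "inj (pos :: 'a \<Rightarrow> nat)" by (rule injI) simp
  have "range (pos :: 'a \<Rightarrow> nat) \<subseteq> {1..CARD('a)}"
  proof clarify
    fix i :: 'a
    have "card {i} \<le> pos i" unfolding pos_def by (rule card_mono) auto
    moreover have "pos i \<le> CARD('a)" unfolding pos_def by (rule card_mono) auto
    ultimately show "pos i \<in> {1..CARD('a)}" by simp
  qed
  then show "range (pos :: 'a \<Rightarrow> nat) = {1..CARD('a)}"
    using inj by (intro card_subset_eq) (auto simp: card_image)
qed

lemma sum_pos: "(\<Sum>i\<in>UNIV. F (pos (i :: 'a::{finite,linorder}))) = (\<Sum>p=1..CARD('a). F p)"
  using sum.reindex_bij_betw[OF bij_betw_pos, of F] .

lemma pos_in: "pos (i :: 'a::{finite,linorder}) \<in> {1..CARD('a)}"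
  using bij_betw_pos[where 'a = 'a] by (auto simp: bij_betw_def)

lemma pos_surj:
  assumes "p \<in> {1..CARD('a)}"
  obtains i :: "'a::{finite,linorder}" where "pos i = p"
  using assms bij_betw_pos[where 'a = 'a] unfolding bij_betw_def by (metis imageE)

lemma nth_column_pos: "nth_column A (pos j) = column j A"
  by (simp add: nth_column_def)

lemma rdiag_product_entry:
  fixes P :: "('n::finite, 'k::{finite,linorder}) rmat" and Q :: "('m::finite, 'l::{finite,linorder}) rmat"
  assumes "CARD('k) \<le> CARD('l)"
  shows "(P ** rdiag s ** transpose Q) $ a $ b
    = (\<Sum>p=1..CARD('k). s p * nth_column P p $ a * nth_column Q p $ b)"
proof -
  have inner: "(\<Sum>l\<in>UNIV. if pos k = pos (l :: 'l) then Q $ b $ l else 0) = nth_column Q (pos k) $ b"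
    for k :: 'k
  proof -
    have "pos k \<in> {1..CARD('l)}" using pos_in[of k] assms by simp
    then obtain l :: 'l where l: "pos l = pos k" by (rule pos_surj)
    then have "(\<Sum>l\<in>UNIV. if pos k = pos (l :: 'l) then Q $ b $ l else 0)
        = (\<Sum>l'\<in>UNIV. if l' = l then Q $ b $ l' else 0)"
      by (intro sum.cong) auto
    also have "\<dots> = nth_column Q (pos k) $ b"
      unfolding l[symmetric] nth_column_pos by (simp add: column_def)
    finally show ?thesis .
  qed
  have "(P ** rdiag s ** transpose Q) $ a $ b
      = (\<Sum>l\<in>UNIV. \<Sum>k\<in>UNIV. P $ a $ k * s (pos k) * (if pos k = pos l then Q $ b $ l else 0))"
    by (simp add: matrix_matrix_mult_def rdiag_def transpose_def sum_distrib_right)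
       (intro sum.cong refl, auto)
  also have "\<dots> = (\<Sum>k\<in>UNIV. \<Sum>l\<in>UNIV. P $ a $ k * s (pos k) * (if pos k = pos l then Q $ b $ l else 0))"
    by (rule sum.swap)
  also have "\<dots> = (\<Sum>k\<in>UNIV. s (pos (k :: 'k)) * nth_column P (pos k) $ a * nth_column Q (pos k) $ b)"
    unfolding sum_distrib_left[symmetric] inner by (simp add: nth_column_pos column_def mult_ac)
  also have "\<dots> = (\<Sum>p=1..CARD('k). s p * nth_column P p $ a * nth_column Q p $ b)"
    by (rule sum_pos)
  finally show ?thesis .
qed

lemma orthonormal_columns_inner:
  fixes P :: "('n::finite, 'r::finite) rmat"
  assumes "orthonormal_columns P"
  shows "column i P \<bullet> column j P = (if i = j then 1 else 0)"
proof -
  have "(transpose P ** P) $ i $ j = (mat 1 :: ('r, 'r) rmat) $ i $ j"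
    using assms by (simp add: orthonormal_columns_def)
  then show ?thesis by (simp add: matrix_mult_transpose_dot_column mat_def)
qed

lemma orthonormal_columnsI:
  fixes P :: "('n::finite, 'r::finite) rmat"
  assumes "\<And>i j. column i P \<bullet> column j P = (if i = j then 1 else 0)"
  shows "orthonormal_columns P"
  unfolding orthonormal_columns_def matrix_mult_transpose_dot_column using assms
  by (simp add: vec_eq_iff mat_def)

lemma orthonormal_columns_inj:
  assumes "orthonormal_columns P"
  shows "inj (\<lambda>j. column j P)"
proof (rule injI)
  fix i j assume "column i P = column j P"
  then show "i = j"
    using orthonormal_columns_inner[OF assms, of i j] orthonormal_columns_inner[OF assms, of j j]
    by (simp split: if_splits)
qed

lemma orthonormal_columns_independent:
  fixes P :: "('n::finite, 'r::finite) rmat"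
  assumes "orthonormal_columns P"
  shows "independent ((\<lambda>j. column j P) ` J)"
proof (rule pairwise_orthogonal_independent)
  note ip = orthonormal_columns_inner[OF assms]
  show "pairwise orthogonal ((\<lambda>j. column j P) ` J)" by (auto simp: pairwise_def orthogonal_def ip)
  show "0 \<notin> (\<lambda>j. column j P) ` J"
  proof
    assume "0 \<in> (\<lambda>j. column j P) ` J"
    then obtain i where "column i P = 0" by auto
    then show False using ip[of i i] by simp
  qed
qed

lemma orthonormal_columns_mult:
  assumes "orthonormal_columns P" "orthonormal_columns Q"
  shows "orthonormal_columns (P ** Q)"
proof -
  have "transpose (P ** Q) ** (P ** Q) = transpose Q ** ((transpose P ** P) ** Q)"
    by (simp add: matrix_transpose_mul matrix_mul_assoc)
  then show ?thesis using assms by (simp add: orthonormal_columns_def)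
qed

lemma orthogonal_imp_orthonormal: "orthogonal_matrix Q \<Longrightarrow> orthonormal_columns Q"
  for Q :: "('k::finite, 'k) rmat"
  by (simp add: orthonormal_columns_def orthogonal_matrix)

lemma inner_sum_orthonormal:
  fixes P :: "('n::finite, 'r::finite) rmat"
  assumes "orthonormal_columns P"
  shows "column i P \<bullet> (\<Sum>j\<in>UNIV. c j *\<^sub>R column j P) = c i"
proof -
  have "column i P \<bullet> (\<Sum>j\<in>UNIV. c j *\<^sub>R column j P) = (\<Sum>j\<in>UNIV. if i = j then c j else 0)"
    unfolding inner_sum_right
    by (intro sum.cong) (auto simp: orthonormal_columns_inner[OF assms])
  then show ?thesis by simp
qed

lemma matrix_vector_mult_columns:
  fixes A :: "('n::finite, 'm::finite) rmat"
  shows "A *v x = (\<Sum>j\<in>UNIV. x $ j *\<^sub>R column j A)"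
  by (simp add: matrix_mult_sum scalar_mult_eq_scaleR)

lemma transpose_mult_vector:
  fixes A :: "('n::finite, 'm::finite) rmat"
  shows "(transpose A *v x) $ j = column j A \<bullet> x"
  by (simp add: matrix_vector_mult_def transpose_def column_def inner_vec_def)

lemma diagonal_mult_column:
  assumes "nonneg_diagonal D"
  shows "column j (A ** D) = D $ j $ j *\<^sub>R column j A"
proof -
  have "column j (A ** D) = (\<Sum>i\<in>UNIV. D $ i $ j *\<^sub>R column i A)"
    unfolding column_matrix_mult matrix_vector_mult_columns by (simp add: column_def)
  also have "\<dots> = (\<Sum>i\<in>UNIV. if i = j then D $ j $ j *\<^sub>R column j A else 0)"
    using assms by (intro sum.cong) (auto simp: nonneg_diagonal_def)
  finally show ?thesis by simp
qed

lemma transpose_nonneg_diagonal: "nonneg_diagonal D \<Longrightarrow> transpose D = D"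
  for D :: "('k::finite, 'k) rmat"
  by (simp add: nonneg_diagonal_def vec_eq_iff transpose_def) metis

lemma mult_transpose_vector:
  fixes A :: "('n::finite, 'r::finite) rmat" and B :: "('m::finite, 'r) rmat"
  shows "(A ** transpose B) *v x = (\<Sum>j\<in>UNIV. (column j B \<bullet> x) *\<^sub>R column j A)"
  unfolding matrix_vector_mul_assoc[symmetric] matrix_vector_mult_columns[of A]
    transpose_mult_vector ..

text \<open>A balanced factorization \<open>(P D)(Q D)\<^sup>T = P D\<^sup>2 Q\<^sup>T\<close> distributes the singular values evenly
  among both factors. Its defining conditions are closed, so they pass to limits of iterates.\<close>

definition balanced ::
  "('n::finite, 'r::{finite,linorder}) rmat \<Rightarrow> ('m::finite, 'r) rmat \<Rightarrow> ('r, 'r) rmat \<Rightarrow> bool" where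
  "balanced P Q D \<longleftrightarrow> orthonormal_columns P \<and> orthonormal_columns Q \<and> nonneg_diagonal D \<and>
     (\<forall>i j. i \<le> j \<longrightarrow> D $ j $ j \<le> D $ i $ i)"

lemma balanced_swap: "balanced P Q D \<Longrightarrow> balanced Q P D"
  by (simp add: balanced_def)

lemma balanced_column:
  assumes "balanced P Q D"
  shows "column j (P ** D) = D $ j $ j *\<^sub>R column j P" "norm (column j (P ** D)) = D $ j $ j"
    "column j (P ** D) = 0 \<longleftrightarrow> D $ j $ j = 0"
proof -
  show c: "column j (P ** D) = D $ j $ j *\<^sub>R column j P"
    using assms by (simp add: balanced_def diagonal_mult_column)
  have "norm (column j P) = 1"
    using assms by (simp add: norm_eq_sqrt_inner orthonormal_columns_inner balanced_def)
  then show n: "norm (column j (P ** D)) = D $ j $ j"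
    using assms by (simp add: c balanced_def nonneg_diagonal_def)
  show "column j (P ** D) = 0 \<longleftrightarrow> D $ j $ j = 0"
    using n by (metis norm_eq_zero)
qed

lemma balanced_product_vector:
  assumes "balanced P Q D"
  shows "(P ** D ** transpose (Q ** D)) *v x
    = (\<Sum>j\<in>UNIV. ((D $ j $ j)\<^sup>2 * (column j Q \<bullet> x)) *\<^sub>R column j P)"
  by (simp add: mult_transpose_vector balanced_column(1)[OF assms] power2_eq_square mult_ac
      balanced_column(1)[OF balanced_swap[OF assms]])

lemma balanced_product_transpose:
  fixes P :: "('n::finite, 'r::finite) rmat" and Q :: "('m::finite, 'r) rmat"
  shows "transpose (P ** D ** transpose (Q ** D)) = Q ** D ** transpose (P ** D)"
  by (simp add: matrix_transpose_mul transpose_transpose)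

lemma balanced_gram_vector:
  assumes "balanced P Q D" "X = P ** D ** transpose (Q ** D)"
  shows "(X ** transpose X) *v x = (\<Sum>j\<in>UNIV. ((D $ j $ j) ^ 4 * (column j P \<bullet> x)) *\<^sub>R column j P)"
proof -
  have "(X ** transpose X) *v x = X *v (transpose X *v x)"
    by (rule matrix_vector_mul_assoc[symmetric])
  also have "\<dots> = (\<Sum>j\<in>UNIV. ((D $ j $ j) ^ 4 * (column j P \<bullet> x)) *\<^sub>R column j P)"
    unfolding assms(2) balanced_product_transpose balanced_product_vector[OF assms(1)]
      balanced_product_vector[OF balanced_swap[OF assms(1)]]
    using assms(1) by (simp add: inner_sum_orthonormal balanced_def power4_eq_xxxx power2_eq_square mult_ac)
  finally show ?thesis .
qed

abbreviation gram_eigenvectors :: "('n::finite, 'm::finite) rmat \<Rightarrow> real \<Rightarrow> (real^'n) set" where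
  "gram_eigenvectors X s \<equiv> {v. \<exists>t\<ge>s. (X ** transpose X) *v v = t\<^sup>2 *\<^sub>R v}"

text \<open>The eigenvalue equation for \<open>t\<^sup>2\<close> with \<open>t > 0\<close> kills every coefficient on a column whose squared
  diagonal entry differs from \<open>t\<close>, so the eigenvectors that count are spanned by columns of \<open>P\<close>.\<close>

lemma balanced_eigenspace_dim:
  fixes D :: "('r::{finite,linorder}, 'r) rmat"
  assumes bal: "balanced P Q D" and X: "X = P ** D ** transpose (Q ** D)" and s: "0 < s"
  shows "dim (gram_eigenvectors X s) = card {j. s \<le> (D $ j $ j)\<^sup>2}"
proof (rule dim_unique)
  let ?J = "{j. s \<le> (D $ j $ j)\<^sup>2}"
  have P: "orthonormal_columns P" using bal by (simp add: balanced_def)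
  note ip = orthonormal_columns_inner[OF P]
  note gram = balanced_gram_vector[OF bal X]
  show "(\<lambda>j. column j P) ` ?J \<subseteq> (gram_eigenvectors X s)"
  proof clarify
    fix i assume i: "s \<le> (D $ i $ i)\<^sup>2"
    have "(X ** transpose X) *v column i P
        = (\<Sum>j\<in>UNIV. if j = i then ((D $ i $ i)\<^sup>2)\<^sup>2 *\<^sub>R column i P else 0)"
      unfolding gram by (intro sum.cong) (auto simp: ip)
    then show "\<exists>t\<ge>s. (X ** transpose X) *v column i P = t\<^sup>2 *\<^sub>R column i P"
      using i by auto
  qed
  show "(gram_eigenvectors X s) \<subseteq> span ((\<lambda>j. column j P) ` ?J)"
  proof clarify
    fix v t assume t: "s \<le> t" and eig: "(X ** transpose X) *v v = t\<^sup>2 *\<^sub>R v"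
    have coeff: "(D $ i $ i) ^ 4 * (column i P \<bullet> v) = t\<^sup>2 * (column i P \<bullet> v)" for i
      using arg_cong[OF eig[unfolded gram], of "\<lambda>w. column i P \<bullet> w"]
      by (simp add: inner_sum_orthonormal[OF P])
    have "i \<in> ?J" if "column i P \<bullet> v \<noteq> 0" for i
    proof -
      have "((D $ i $ i)\<^sup>2)\<^sup>2 = t\<^sup>2" using coeff[of i] that by simp
      moreover have "0 \<le> t" using s t by simp
      ultimately have "(D $ i $ i)\<^sup>2 = t" by (rule power2_eq_imp_eq[OF _ zero_le_power2])
      then show ?thesis using t by simp
    qed
    then have "(\<Sum>j\<in>UNIV. ((D $ j $ j) ^ 4 * (column j P \<bullet> v)) *\<^sub>R column j P)
        \<in> span ((\<lambda>j. column j P) ` ?J)"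
      by (intro span_sum) (metis (no_types, lifting) image_eqI mult_zero_right scaleR_zero_left
          span_base span_scale span_zero)
    then have "(1 / t\<^sup>2) *\<^sub>R (t\<^sup>2 *\<^sub>R v) \<in> span ((\<lambda>j. column j P) ` ?J)"
      unfolding eig[symmetric] gram by (rule span_scale)
    then show "v \<in> span ((\<lambda>j. column j P) ` ?J)" using s t by simp
  qed
  show "independent ((\<lambda>j. column j P) ` ?J)" by (rule orthonormal_columns_independent[OF P])
  show "card ((\<lambda>j. column j P) ` ?J) = card ?J"
    by (rule card_image[OF inj_on_subset[OF orthonormal_columns_inj[OF P] subset_UNIV]])
qed

text \<open>Since the diagonal is nonincreasing, at least \<open>pos j\<close> squared entries reach the level \<open>s\<close> precisely
  when the one at \<open>j\<close> does.\<close>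

lemma balanced_sing_val:
  fixes D :: "('r::{finite,linorder}, 'r) rmat"
  assumes bal: "balanced P Q D" and X: "X = P ** D ** transpose (Q ** D)"
  shows "sing_val X (pos j) = (D $ j $ j)\<^sup>2" "CARD('r) < p \<Longrightarrow> sing_val X p = 0"
proof -
  have mono: "(D $ k $ k)\<^sup>2 \<le> (D $ i $ i)\<^sup>2" if "i \<le> k" for i k
    using bal that by (auto simp: balanced_def nonneg_diagonal_def intro!: power_mono)
  have iff: "pos j \<le> card {i. s \<le> (D $ i $ i)\<^sup>2} \<longleftrightarrow> s \<le> (D $ j $ j)\<^sup>2" for s
  proof
    assume le: "s \<le> (D $ j $ j)\<^sup>2"
    show "pos j \<le> card {i. s \<le> (D $ i $ i)\<^sup>2}"
      unfolding pos_def using le mono by (intro card_mono) (auto intro: order_trans)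
  next
    assume le: "pos j \<le> card {i. s \<le> (D $ i $ i)\<^sup>2}"
    show "s \<le> (D $ j $ j)\<^sup>2"
    proof (rule ccontr)
      assume "\<not> s \<le> (D $ j $ j)\<^sup>2"
      moreover have "i \<le> j" if "s \<le> (D $ i $ i)\<^sup>2" for i
        using mono[of j i] that \<open>\<not> s \<le> (D $ j $ j)\<^sup>2\<close> linear[of i j] by auto
      ultimately have "{i. s \<le> (D $ i $ i)\<^sup>2} \<subset> {i. i \<le> j}" by blast
      then have "card {i. s \<le> (D $ i $ i)\<^sup>2} < pos j"
        unfolding pos_def by (intro psubset_card_mono) auto
      then show False using le by simp
    qed
  qed
  show "sing_val X (pos j) = (D $ j $ j)\<^sup>2"
    unfolding sing_val_def
  proof (rule cSup_eq_maximum)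
    show "(D $ j $ j)\<^sup>2 \<in> insert 0 {s. 0 \<le> s \<and> pos j \<le> dim (gram_eigenvectors X s)}"
    proof (cases "D $ j $ j = 0")
      case False
      then have "0 < (D $ j $ j)\<^sup>2" by simp
      from balanced_eigenspace_dim[OF bal X this] show ?thesis using iff by simp
    qed simp
  next
    fix s assume "s \<in> insert 0 {s. 0 \<le> s \<and> pos j \<le> dim (gram_eigenvectors X s)}"
    then show "s \<le> (D $ j $ j)\<^sup>2"
      using balanced_eigenspace_dim[OF bal X, of s] iff[of s] by (cases "s = 0") auto
  qed
  assume p: "CARD('r) < p"
  have "s = 0" if "0 \<le> s" "p \<le> dim (gram_eigenvectors X s)" for s
  proof (rule ccontr)
    assume "s \<noteq> 0"
    then have "p \<le> card {j. s \<le> (D $ j $ j)\<^sup>2}"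
      using balanced_eigenspace_dim[OF bal X, of s] that by simp
    also have "\<dots> \<le> CARD('r)" by (rule card_mono) auto
    finally show False using p by simp
  qed
  then show "sing_val X p = 0"
    unfolding sing_val_def by (intro cSup_eq_maximum) auto
qed

text \<open>The suprema compare only because their sets are bounded: a counted level \<open>s\<close> is at most some
  \<open>t\<close> whose square is an eigenvalue of \<open>X X\<^sup>T\<close>.\<close>

lemma sing_val_antimono:
  fixes X :: "('n::finite, 'm::finite) rmat"
  assumes "1 \<le> i" "i \<le> j"
  shows "sing_val X j \<le> sing_val X i"
  unfolding sing_val_def
proof (rule cSup_subset_mono)
  obtain K where K: "\<And>v. norm ((X ** transpose X) *v v) \<le> norm v * K"
    using bounded_linear.bounded[OF matrix_vector_mul_bounded_linear[of "X ** transpose X"]] by blast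
  show "bdd_above (insert 0 {s. 0 \<le> s \<and> i \<le> dim (gram_eigenvectors X s)})"
  proof (rule bdd_aboveI)
    fix s assume s: "s \<in> insert 0 {s. 0 \<le> s \<and> i \<le> dim (gram_eigenvectors X s)}"
    show "s \<le> max 1 K"
    proof (cases "s = 0")
      case False
      let ?E = "(gram_eigenvectors X s)"
      have "0 \<le> s" "1 \<le> dim ?E" using s False assms by auto
      then have "\<not> ?E \<subseteq> {0}" using dim_eq_0[of ?E] by linarith
      then obtain v t where v: "v \<noteq> 0" "s \<le> t" "(X ** transpose X) *v v = t\<^sup>2 *\<^sub>R v" by auto
      have "norm (t\<^sup>2 *\<^sub>R v) \<le> norm v * K" using K[of v] v(3) by simp
      then have "t\<^sup>2 * norm v \<le> K * norm v" by (simp add: mult.commute)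
      then have tK: "t\<^sup>2 \<le> K" using v(1) by simp
      have "t \<le> max 1 K"
      proof (cases "t \<le> 1")
        case False
        then have "t * 1 \<le> t * t" by (intro mult_left_mono) auto
        then show ?thesis using tK by (simp add: power2_eq_square)
      qed simp
      then show ?thesis using v(2) by simp
    qed simp
  qed
qed (use assms in auto)

lemma rdiag_diagonal: "rdiag s $ j $ j = s (pos j)"
  by (simp add: rdiag_def)

lemma balancedI_rdiag:
  fixes D :: "('r::{finite,linorder}, 'r) rmat"
  assumes "orthonormal_columns P" "orthonormal_columns Q" "nonneg_diagonal D"
    and D: "D ** D = rdiag (sing_val X)"
  shows "balanced P Q D"
proof -
  have sq: "(D $ j $ j)\<^sup>2 = sing_val X (pos j)" for j
  proof -
    have "(D ** D) $ j $ j = column j (D ** D) $ j" by (simp add: column_def)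
    then have "(D ** D) $ j $ j = (D $ j $ j)\<^sup>2"
      unfolding diagonal_mult_column[OF assms(3)] by (simp add: column_def power2_eq_square)
    then show ?thesis by (simp add: D rdiag_diagonal)
  qed
  have "D $ j $ j \<le> D $ i $ i" if "i \<le> j" for i j
  proof (rule power2_le_imp_le)
    show "(D $ j $ j)\<^sup>2 \<le> (D $ i $ i)\<^sup>2"
      unfolding sq using that pos_in[of i] by (intro sing_val_antimono) (auto simp: pos_le_iff)
    show "0 \<le> D $ i $ i" using assms(3) by (simp add: nonneg_diagonal_def)
  qed
  then show ?thesis using assms by (simp add: balanced_def)
qed

lemma balanced_unique_diagonal:
  fixes P P' :: "('n::finite, 'r::{finite,linorder}) rmat" and Q Q' :: "('m::finite, 'r) rmat"
  assumes "balanced P Q D" "balanced P' Q' D'"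
    and "P ** D ** transpose (Q ** D) = P' ** D' ** transpose (Q' ** D')"
  shows "D = D'"
proof -
  have d: "D $ j $ j = D' $ j $ j" for j
  proof (rule power2_eq_imp_eq)
    show "(D $ j $ j)\<^sup>2 = (D' $ j $ j)\<^sup>2"
      using balanced_sing_val(1)[OF assms(1) refl, of j] balanced_sing_val(1)[OF assms(2) refl, of j]
        assms(3) by simp
  qed (use assms in \<open>auto simp: balanced_def nonneg_diagonal_def\<close>)
  have "D $ i $ j = D' $ i $ j" for i j
    using assms(1,2) d by (cases "i = j") (auto simp: balanced_def nonneg_diagonal_def)
  then show ?thesis by (simp add: vec_eq_iff)
qed

text \<open>The singular vectors of two factorizations of the same matrix differ by an orthogonal matrix
  that only mixes indices with equal singular values. A first-order condition whose multiplier is a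
  function of the singular value is therefore insensitive to the choice of the factorization.\<close>

lemma balanced_eigen_relation_transfer:
  fixes P P' :: "('n::finite, 'r::{finite,linorder}) rmat" and Q Q' :: "('m::finite, 'r) rmat"
  assumes bal: "balanced P Q D" and bal': "balanced P' Q' D'"
    and eq: "P ** D ** transpose (Q ** D) = P' ** D' ** transpose (Q' ** D')"
    and rel: "\<And>j. D $ j $ j \<noteq> 0 \<Longrightarrow> G *v column j (Q ** D) = m (D $ j $ j) *\<^sub>R column j (P ** D)"
    and nz: "D' $ j $ j \<noteq> 0"
  shows "G *v column j (Q' ** D') = m (D' $ j $ j) *\<^sub>R column j (P' ** D')"
proof -
  have DD: "D' = D" using balanced_unique_diagonal[OF bal bal' eq] by simp
  note eq = eq[unfolded DD] and bal' = bal'[unfolded DD] and nz = nz[unfolded DD]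
  let ?d = "\<lambda>i. D $ i $ i"
  have d0: "0 \<le> ?d i" for i using bal by (simp add: balanced_def nonneg_diagonal_def)
  have P: "orthonormal_columns P" "orthonormal_columns Q" "orthonormal_columns P'" "orthonormal_columns Q'"
    using bal bal' by (auto simp: balanced_def)
  have single: "(\<Sum>i\<in>UNIV. ((?d i)\<^sup>2 * (column i A \<bullet> column j A)) *\<^sub>R column i B) = (?d j)\<^sup>2 *\<^sub>R column j B"
    if "orthonormal_columns A" for A :: "('x::finite, 'r) rmat" and B :: "('y::finite, 'r) rmat"
  proof -
    have "(\<Sum>i\<in>UNIV. ((?d i)\<^sup>2 * (column i A \<bullet> column j A)) *\<^sub>R column i B)
       = (\<Sum>i\<in>UNIV. if i = j then (?d j)\<^sup>2 *\<^sub>R column j B else 0)"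
      by (intro sum.cong) (auto simp: orthonormal_columns_inner[OF that])
    then show ?thesis by simp
  qed
  \<comment> \<open>Column \<open>j\<close> of the two transition matrices between left and between right singular vectors; they
    will turn out to be equal and supported on indices with the same diagonal entry.\<close>
  define R where "R i = column i P \<bullet> column j P'" for i
  define S where "S i = column i Q \<bullet> column j Q'" for i
  have p': "(?d j)\<^sup>2 *\<^sub>R column j P' = (\<Sum>i\<in>UNIV. ((?d i)\<^sup>2 * S i) *\<^sub>R column i P)"
    using arg_cong[OF eq, of "\<lambda>X. X *v column j Q'"]
    unfolding balanced_product_vector[OF bal] balanced_product_vector[OF bal'] single[OF P(4)] S_def
    by simp
  have q': "(?d j)\<^sup>2 *\<^sub>R column j Q' = (\<Sum>i\<in>UNIV. ((?d i)\<^sup>2 * R i) *\<^sub>R column i Q)"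
    using arg_cong[OF eq, of "\<lambda>X. transpose X *v column j P'"]
    unfolding balanced_product_transpose balanced_product_vector[OF balanced_swap[OF bal]]
      balanced_product_vector[OF balanced_swap[OF bal']] single[OF P(3)] R_def
    by simp
  have RS: "(?d j)\<^sup>2 * R k = (?d k)\<^sup>2 * S k" for k
    using arg_cong[OF p', of "\<lambda>v. column k P \<bullet> v"] by (simp add: inner_sum_orthonormal[OF P(1)] R_def)
  have SR: "(?d j)\<^sup>2 * S k = (?d k)\<^sup>2 * R k" for k
    using arg_cong[OF q', of "\<lambda>v. column k Q \<bullet> v"] by (simp add: inner_sum_orthonormal[OF P(2)] S_def)
  have mix: "R k = S k \<and> (R k \<noteq> 0 \<longrightarrow> ?d k = ?d j)" for k
  proof -
    have dj: "0 < (?d j)\<^sup>2" using nz by simp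
    have "(?d j)\<^sup>2 * (R k + S k) = (?d k)\<^sup>2 * (R k + S k)"
      using RS[of k] SR[of k] by (simp add: distrib_left)
    moreover have "(?d j)\<^sup>2 * (R k - S k) = - ((?d k)\<^sup>2 * (R k - S k))"
      using RS[of k] SR[of k] by (simp add: right_diff_distrib)
    then have "((?d j)\<^sup>2 + (?d k)\<^sup>2) * (R k - S k) = 0" by (simp add: distrib_right)
    then have "R k = S k" using dj zero_le_power2[of "?d k"] by (smt (verit) mult_eq_0_iff)
    ultimately show ?thesis using d0 by (auto simp: power2_eq_iff_nonneg)
  qed
  have shift: "((?d i)\<^sup>2 * S i) *\<^sub>R x = (?d j)\<^sup>2 *\<^sub>R (R i *\<^sub>R x)" for i and x :: "real^'n"
    using mix[of i] by (cases "R i = 0") auto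
  have shift': "((?d i)\<^sup>2 * R i) *\<^sub>R x = (?d j)\<^sup>2 *\<^sub>R (R i *\<^sub>R x)" for i and x :: "real^'m"
    using mix[of i] by (cases "R i = 0") auto
  have "(?d j)\<^sup>2 *\<^sub>R column j P' = (?d j)\<^sup>2 *\<^sub>R (\<Sum>i\<in>UNIV. R i *\<^sub>R column i P)"
    unfolding p' scaleR_sum_right shift ..
  then have p: "column j P' = (\<Sum>i\<in>UNIV. R i *\<^sub>R column i P)" using nz by simp
  have "(?d j)\<^sup>2 *\<^sub>R column j Q' = (?d j)\<^sup>2 *\<^sub>R (\<Sum>i\<in>UNIV. R i *\<^sub>R column i Q)"
    unfolding q' scaleR_sum_right shift' ..
  then have q: "column j Q' = (\<Sum>i\<in>UNIV. R i *\<^sub>R column i Q)" using nz by simp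
  have rel': "G *v column i Q = m (?d i) *\<^sub>R column i P" if "?d i \<noteq> 0" for i
  proof -
    have "?d i *\<^sub>R (G *v column i Q) = ?d i *\<^sub>R (m (?d i) *\<^sub>R column i P)"
      using rel[OF that] balanced_column(1)[OF bal, of i] balanced_column(1)[OF balanced_swap[OF bal], of i]
      by (simp add: matrix_vector_mult_scaleR mult.commute)
    then show ?thesis by (rule scaleR_left_imp_eq[OF that])
  qed
  have rel'': "R i *\<^sub>R (G *v column i Q) = m (?d j) *\<^sub>R (R i *\<^sub>R column i P)" for i
    using mix[of i] rel'[of i] nz by (cases "R i = 0") auto
  have "G *v column j Q' = (\<Sum>i\<in>UNIV. R i *\<^sub>R (G *v column i Q))"
    unfolding q by (simp add: linear_sum[OF matrix_vector_mul_linear] matrix_vector_mult_scaleR)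
  also have "\<dots> = (\<Sum>i\<in>UNIV. m (?d j) *\<^sub>R (R i *\<^sub>R column i P))"
    unfolding rel'' ..
  finally have "G *v column j Q' = m (?d j) *\<^sub>R column j P'"
    unfolding p scaleR_sum_right .
  then show ?thesis
    unfolding DD balanced_column(1)[OF bal'] balanced_column(1)[OF balanced_swap[OF bal']]
    by (simp add: matrix_vector_mult_scaleR mult.commute)
qed

section \<open>Optimality of balanced factorizations\<close>

text \<open>The missing columns enumerate an orthonormal basis of the orthogonal complement of the column
  space.\<close>

lemma orthonormal_columns_extend:
  fixes P :: "('n::{finite,linorder}, 'r::{finite,linorder}) rmat"
  assumes card: "CARD('r) \<le> CARD('n)" and P: "orthonormal_columns P"
  obtains P' :: "('n, 'n) rmat" where "orthogonal_matrix P'"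
    "\<And>p. p \<in> {1..CARD('r)} \<Longrightarrow> nth_column P' p = nth_column P p"
proof -
  note ip = orthonormal_columns_inner[OF P]
  define B where "B = range (\<lambda>j. column j P)"
  have "independent B" unfolding B_def by (rule orthonormal_columns_independent[OF P])
  then have dimB: "dim (span B) = CARD('r)"
    using card_image[OF orthonormal_columns_inj[OF P]] by (simp add: dim_eq_card_independent B_def)
  define W where "W = {y \<in> UNIV. \<forall>x\<in>span B. orthogonal x y}"
  have dimW: "dim W + CARD('r) = CARD('n)"
    using dim_subspace_orthogonal_to_vectors[of "span B" UNIV] dimB by (simp add: W_def)
  have "subspace W"
    by (auto simp: W_def subspace_def orthogonal_clauses)
  then obtain C where C: "C \<subseteq> W" "pairwise orthogonal C" "\<And>x. x \<in> C \<Longrightarrow> norm x = 1"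
      "independent C" "card C = dim W"
    using orthonormal_basis_subspace by metis
  have "finite C" using C(4) by (rule independent_imp_finite)
  moreover have "card {CARD('r)<..CARD('n)} = card C" using C(5) dimW by simp
  ultimately obtain g where g: "bij_betw g {CARD('r)<..CARD('n)} C"
    using finite_same_card_bij[of "{CARD('r)<..CARD('n)}" C] by auto
  define P' :: "('n, 'n) rmat" where
    "P' = (\<chi> i j. (if pos j \<le> CARD('r) then nth_column P (pos j) else g (pos j)) $ i)"
  have col: "column j P' = (if pos j \<le> CARD('r) then nth_column P (pos j) else g (pos j))" for j
    by (simp add: P'_def column_def vec_eq_iff)
  have low: "\<exists>i. pos i = pos j \<and> column j P' = column i P" if "pos j \<le> CARD('r)" for j :: 'n
  proof -
    have "pos j \<in> {1..CARD('r)}" using that pos_in[of j] by simp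
    then obtain i :: 'r where "pos i = pos j" by (rule pos_surj)
    then show ?thesis using that nth_column_pos[of P i] by (auto simp: col)
  qed
  have high: "column j P' \<in> C" "column j P' = g (pos j)" if "\<not> pos j \<le> CARD('r)" for j :: 'n
  proof -
    have "pos j \<in> {CARD('r)<..CARD('n)}" using that pos_in[of j] by simp
    then show "column j P' \<in> C" using g that by (auto simp: col bij_betw_def)
    show "column j P' = g (pos j)" using that by (simp add: col)
  qed
  have BC: "x \<bullet> y = 0" if "x \<in> B" "y \<in> C" for x y
    using that C(1) span_base[of x B] by (auto simp: W_def orthogonal_def)
  have "column i P' \<bullet> column j P' = (if i = j then 1 else 0)" for i j
  proof (cases "pos i \<le> CARD('r)")
    case i: True
    then obtain i' where i': "pos i' = pos i" "column i P' = column i' P" using low by blast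
    show ?thesis
    proof (cases "pos j \<le> CARD('r)")
      case True
      then obtain j' where j': "pos j' = pos j" "column j P' = column j' P" using low by blast
      have "i' = j' \<longleftrightarrow> i = j" using i'(1) j'(1) by (metis pos_eq_iff)
      then show ?thesis using i'(2) j'(2) ip by simp
    next
      case False
      then have "column i P' \<bullet> column j P' = 0"
        using BC[of "column i' P" "column j P'"] high(1)[OF False] i'(2) by (simp add: B_def)
      then show ?thesis using i False by auto
    qed
  next
    case i: False
    show ?thesis
    proof (cases "pos j \<le> CARD('r)")
      case True
      then obtain j' where j': "column j P' = column j' P" using low by blast
      have "column j P' \<bullet> column i P' = 0"
        using BC[of "column j' P" "column i P'"] high(1)[OF i] j' by (simp add: B_def)
      then show ?thesis using i True by (auto simp: inner_commute)
    next
      case False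
      show ?thesis
      proof (cases "i = j")
        case True
        then show ?thesis using C(3)[OF high(1)[OF i]] by (simp add: norm_eq_1)
      next
        case ij: False
        have "inj_on g {CARD('r)<..CARD('n)}" using g by (simp add: bij_betw_def)
        then have "g (pos i) \<noteq> g (pos j)"
          using i False ij pos_in[of i] pos_in[of j] by (auto dest: inj_onD)
        then have "column i P' \<noteq> column j P'" using high(2)[OF i] high(2)[OF False] by simp
        then show ?thesis
          using C(2) high(1)[OF i] high(1)[OF False] ij by (auto simp: pairwise_def orthogonal_def)
      qed
    qed
  qed
  then have "orthonormal_columns P'" by (rule orthonormal_columnsI)
  then have orth: "orthogonal_matrix P'" by (simp add: orthonormal_columns_def orthogonal_matrix)
  have nth: "nth_column P' p = nth_column P p" if p: "p \<in> {1..CARD('r)}" for p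
  proof -
    have "p \<in> {1..CARD('n)}" using p card by simp
    then obtain j :: 'n where j: "pos j = p" by (rule pos_surj)
    then show ?thesis using col[of j] p nth_column_pos[of P' j] by simp
  qed
  show thesis by (rule that[OF orth nth])
qed

lemma balanced_as_rdiag:
  fixes P :: "('n::finite, 'r::{finite,linorder}) rmat" and Q :: "('m::finite, 'r) rmat"
  assumes bal: "balanced P Q D" and X: "X = P ** D ** transpose (Q ** D)"
  shows "X = P ** rdiag (sing_val X) ** transpose Q"
proof -
  have off: "D $ i $ j = 0" if "i \<noteq> j" for i j
    using bal that by (simp add: balanced_def nonneg_diagonal_def)
  have "transpose D = D" using bal by (simp add: balanced_def transpose_nonneg_diagonal)
  moreover have "D ** D = rdiag (sing_val X)"
  proof (rule matrix_eq_columnsI)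
    fix j
    have "column j (D ** D) = D $ j $ j *\<^sub>R column j D"
      using bal by (simp add: balanced_def diagonal_mult_column)
    also have "\<dots> = column j (rdiag (sing_val X))"
      using off by (auto simp: column_def rdiag_def vec_eq_iff balanced_sing_val(1)[OF bal X]
          power2_eq_square)
    finally show "column j (D ** D) = column j (rdiag (sing_val X))" .
  qed
  ultimately show ?thesis
    by (metis X matrix_mul_assoc matrix_transpose_mul)
qed

lemma mult_transpose_entry:
  fixes A :: "('n::finite, 'r::finite) rmat" and B :: "('m::finite, 'r) rmat"
  shows "(A ** transpose B) $ a $ b = (\<Sum>j\<in>UNIV. column j A $ a * column j B $ b)"
  by (simp add: matrix_matrix_mult_def transpose_def column_def)

text \<open>The optimality assumption speaks about full singular value decompositions; the orthonormal
  columns of a thin one are completed to orthogonal matrices.\<close>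

lemma balanced_penalty_minimal:
  fixes P A :: "('n::{finite,linorder}, 'r::{finite,linorder}) rmat"
    and Q B :: "('m::{finite,linorder}, 'r) rmat"
  assumes card: "CARD('n) \<le> CARD('m)" "CARD('r) \<le> CARD('n)" and \<theta>: "penalty_fun \<theta>"
    and opt: "balanced_factorization_optimal TYPE('n \<times> 'm) \<theta>"
    and bal: "balanced P Q D" and prod: "A ** transpose B = P ** D ** transpose (Q ** D)"
  shows "total_penalty \<theta> (P ** D) + total_penalty \<theta> (Q ** D) \<le> total_penalty \<theta> A + total_penalty \<theta> B"
proof -
  define X where "X = P ** D ** transpose (Q ** D)"
  have P: "orthonormal_columns P" and Q: "orthonormal_columns Q"
    using bal by (auto simp: balanced_def)
  obtain P' :: "('n, 'n) rmat" where P': "orthogonal_matrix P'"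
      "\<And>p. p \<in> {1..CARD('r)} \<Longrightarrow> nth_column P' p = nth_column P p"
    by (rule orthonormal_columns_extend[OF card(2) P]) blast
  obtain Q' :: "('m, 'm) rmat" where Q': "orthogonal_matrix Q'"
      "\<And>p. p \<in> {1..CARD('r)} \<Longrightarrow> nth_column Q' p = nth_column Q p"
    by (rule orthonormal_columns_extend[OF order_trans[OF card(2) card(1)] Q]) blast
  have zero: "sing_val X p = 0" if "CARD('r) < p" for p
    using balanced_sing_val(2)[OF bal X_def that] .
  have "X = P' ** rdiag (sing_val X) ** transpose Q'"
  proof -
    have "X $ a $ b = (P' ** rdiag (sing_val X) ** transpose Q') $ a $ b" for a b
    proof -
      have "X $ a $ b = (P ** rdiag (sing_val X) ** transpose Q) $ a $ b"
        using balanced_as_rdiag[OF bal X_def] by simp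
      also have "\<dots> = (\<Sum>p=1..CARD('r). sing_val X p * nth_column P p $ a * nth_column Q p $ b)"
        by (rule rdiag_product_entry) simp
      also have "\<dots> = (\<Sum>p=1..CARD('r). sing_val X p * nth_column P' p $ a * nth_column Q' p $ b)"
        by (rule sum.cong[OF refl]) (simp only: P'(2) Q'(2))
      also have "\<dots> = (\<Sum>p=1..CARD('n). sing_val X p * nth_column P' p $ a * nth_column Q' p $ b)"
        using card zero by (intro sum.mono_neutral_left) auto
      also have "\<dots> = (P' ** rdiag (sing_val X) ** transpose Q') $ a $ b"
        by (rule rdiag_product_entry[OF card(1), symmetric])
      finally show ?thesis .
    qed
    then show ?thesis by (simp add: vec_eq_iff)
  qed
  then have svd: "(P', Q') \<in> svd_pairs X" using P'(1) Q'(1) by (simp add: svd_pairs_def)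
  have "rank X \<le> CARD('r)"
    unfolding X_def using rank_mul_le_left[of "P ** D" "transpose (Q ** D)"] rank_bound[of "P ** D"]
    by linarith
  moreover have "CARD('r) \<in> {1..CARD('n)}" using card(2) by (simp add: Suc_le_eq)
  ultimately have eq: "columns_vtheta \<theta> CARD('r) (\<lambda>i. sqrt (sing_val X i) *\<^sub>R nth_column P' i)
             + columns_vtheta \<theta> CARD('r) (\<lambda>i. sqrt (sing_val X i) *\<^sub>R nth_column Q' i)
           = Inf {columns_vtheta \<theta> CARD('r) U + columns_vtheta \<theta> CARD('r) V | U V. X = columns_mult CARD('r) U V}"
    using opt svd unfolding balanced_factorization_optimal_def by blast
  have vtheta: "columns_vtheta \<theta> CARD('r) (nth_column M) = vtheta \<theta> M" for M :: "('x::finite, 'r) rmat"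
    unfolding columns_vtheta_def vtheta_def sum_pos[symmetric] nth_column_pos ..
  have root: "columns_vtheta \<theta> CARD('r) (\<lambda>i. sqrt (sing_val X i) *\<^sub>R nth_column M' i) = vtheta \<theta> (M ** D)"
    if "\<And>p. p \<in> {1..CARD('r)} \<Longrightarrow> nth_column M' p = nth_column M p"
    for M :: "('x::finite, 'r) rmat" and M' :: "('x, 'y::{finite,linorder}) rmat"
  proof -
    have "columns_vtheta \<theta> CARD('r) (\<lambda>i. sqrt (sing_val X i) *\<^sub>R nth_column M' i)
        = (\<Sum>i=1..CARD('r). \<theta> (norm (sqrt (sing_val X i) *\<^sub>R nth_column M i)))"
      unfolding columns_vtheta_def by (rule sum.cong[OF refl]) (simp only: that)
    also have "\<dots> = (\<Sum>j\<in>UNIV. \<theta> (norm (sqrt (sing_val X (pos (j::'r))) *\<^sub>R nth_column M (pos j))))"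
      by (rule sum_pos[symmetric])
    also have "\<dots> = vtheta \<theta> (M ** D)"
      using bal unfolding vtheta_def nth_column_pos balanced_sing_val(1)[OF bal X_def]
      by (simp add: diagonal_mult_column balanced_def nonneg_diagonal_def)
    finally show ?thesis .
  qed
  have rootP: "columns_vtheta \<theta> CARD('r) (\<lambda>i. sqrt (sing_val X i) *\<^sub>R nth_column P' i) = vtheta \<theta> (P ** D)"
    by (rule root) (rule P'(2))
  have rootQ: "columns_vtheta \<theta> CARD('r) (\<lambda>i. sqrt (sing_val X i) *\<^sub>R nth_column Q' i) = vtheta \<theta> (Q ** D)"
    by (rule root) (rule Q'(2))
  have "X $ a $ b = columns_mult CARD('r) (nth_column A) (nth_column B) $ a $ b" for a b
    using sum_pos[where 'a = 'r, of "\<lambda>p. nth_column A p $ a * nth_column B p $ b"]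
    unfolding X_def prod[symmetric] mult_transpose_entry columns_mult_def nth_column_pos by simp
  then have "X = columns_mult CARD('r) (nth_column A) (nth_column B)" by (simp add: vec_eq_iff)
  then have "Inf {columns_vtheta \<theta> CARD('r) U + columns_vtheta \<theta> CARD('r) V | U V. X = columns_mult CARD('r) U V}
      \<le> columns_vtheta \<theta> CARD('r) (nth_column A) + columns_vtheta \<theta> CARD('r) (nth_column B)"
    by (intro Inf_lower) blast
  then have "vtheta \<theta> (P ** D) + vtheta \<theta> (Q ** D) \<le> vtheta \<theta> A + vtheta \<theta> B"
    unfolding eq[symmetric] rootP rootQ vtheta .
  then show ?thesis by (simp add: vtheta_eq_total_penalty[OF \<theta>])
qed

text \<open>Bessel's inequality: the residual of the orthogonal projection has nonnegative square norm.\<close>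

lemma sum_inner_sq_orthonormal_le:
  assumes "orthonormal_columns P"
  shows "(\<Sum>j\<in>UNIV. (column j P \<bullet> a)\<^sup>2) \<le> (norm a)\<^sup>2"
proof -
  define y where "y = (\<Sum>j\<in>UNIV. (column j P \<bullet> a) *\<^sub>R column j P)"
  have ay: "a \<bullet> y = (\<Sum>j\<in>UNIV. (column j P \<bullet> a)\<^sup>2)"
    by (simp add: y_def inner_sum_right power2_eq_square inner_commute)
  have "y \<bullet> y = (\<Sum>j\<in>UNIV. (column j P \<bullet> a) * (column j P \<bullet> y))"
    unfolding y_def by (subst inner_sum_left) simp
  then have yy: "y \<bullet> y = (\<Sum>j\<in>UNIV. (column j P \<bullet> a)\<^sup>2)"
    unfolding y_def inner_sum_orthonormal[OF assms] by (simp add: power2_eq_square)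
  have "0 \<le> (a - y) \<bullet> (a - y)" by simp
  then show ?thesis
    using ay yy by (simp add: power2_norm_eq_inner inner_diff_left inner_diff_right inner_commute)
qed

lemma sum_norm_sq_transpose_orthonormal_le:
  fixes A :: "('n::finite, 'k::finite) rmat" and P :: "('n, 'r::finite) rmat"
  assumes "orthonormal_columns P"
  shows "(\<Sum>j\<in>UNIV. (norm (transpose A *v column j P))\<^sup>2) \<le> (norm A)\<^sup>2"
proof -
  have "(\<Sum>j\<in>UNIV. (norm (transpose A *v column j P))\<^sup>2)
      = (\<Sum>j\<in>UNIV. \<Sum>i\<in>UNIV. (column j P \<bullet> column i A)\<^sup>2)"
    unfolding power2_norm_eq_inner
    by (simp add: inner_vec_def[of "transpose A *v _"] transpose_mult_vector power2_eq_square
        inner_commute del: transpose_matrix_vector)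
  also have "\<dots> = (\<Sum>i\<in>UNIV. \<Sum>j\<in>UNIV. (column j P \<bullet> column i A)\<^sup>2)" by (rule sum.swap)
  also have "\<dots> \<le> (\<Sum>i\<in>UNIV. (norm (column i A))\<^sup>2)"
    by (intro sum_mono sum_inner_sq_orthonormal_le assms)
  finally show ?thesis by (simp add: norm_sq_eq_sum_columns[of A])
qed

text \<open>The left-hand side is twice the sum of the singular values \<open>(D $ j $ j)\<^sup>2\<close>. That sum equals
  \<open>\<Sum>\<^sub>j (A\<^sup>T p\<^sub>j) \<bullet> (B\<^sup>T q\<^sub>j)\<close>, and Bessel's inequality bounds both factors.\<close>

lemma balanced_norm_minimal:
  fixes P A :: "('n::finite, 'r::{finite,linorder}) rmat" and Q B :: "('m::finite, 'r) rmat"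
  assumes bal: "balanced P Q D" and prod: "A ** transpose B = P ** D ** transpose (Q ** D)"
  shows "(norm (P ** D))\<^sup>2 + (norm (Q ** D))\<^sup>2 \<le> (norm A)\<^sup>2 + (norm B)\<^sup>2"
proof -
  have P: "orthonormal_columns P" and Q: "orthonormal_columns Q"
    using bal by (auto simp: balanced_def)
  let ?a = "\<lambda>j. transpose A *v column j P" and ?b = "\<lambda>j. transpose B *v column j Q"
  have "?a j \<bullet> ?b j = (D $ j $ j)\<^sup>2" for j
  proof -
    have "?a j \<bullet> ?b j = column j P \<bullet> ((A ** transpose B) *v column j Q)"
      unfolding matrix_vector_mul_assoc[symmetric] by (simp add: dot_lmul_matrix)
    also have "\<dots> = (D $ j $ j)\<^sup>2 * (column j Q \<bullet> column j Q)"
      unfolding prod balanced_product_vector[OF bal] inner_sum_orthonormal[OF P] ..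
    finally show ?thesis by (simp add: orthonormal_columns_inner[OF Q])
  qed
  moreover have "2 * (?a j \<bullet> ?b j) \<le> (norm (?a j))\<^sup>2 + (norm (?b j))\<^sup>2" for j
  proof -
    have "0 \<le> (?a j - ?b j) \<bullet> (?a j - ?b j)" by (rule inner_ge_zero)
    then show ?thesis
      unfolding power2_norm_eq_inner inner_diff_left inner_diff_right
      using inner_commute[of "?a j" "?b j"] by linarith
  qed
  ultimately have "(\<Sum>j\<in>UNIV. 2 * (D $ j $ j)\<^sup>2) \<le> (\<Sum>j\<in>UNIV. (norm (?a j))\<^sup>2 + (norm (?b j))\<^sup>2)"
    by (intro sum_mono) metis
  also have "\<dots> \<le> (norm A)\<^sup>2 + (norm B)\<^sup>2"
    unfolding sum.distrib
    by (intro add_mono sum_norm_sq_transpose_orthonormal_le P Q)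
  finally show ?thesis
    by (simp add: norm_sq_eq_sum_columns[of "P ** D"] norm_sq_eq_sum_columns[of "Q ** D"]
        balanced_column(2)[OF bal] balanced_column(2)[OF balanced_swap[OF bal]]
        sum_distrib_left[symmetric])
qed

text \<open>A matrix that factorizes through \<open>CARD('r)\<close> columns has no further singular values, so nothing is
  lost when the remaining columns of the orthogonal factors are deleted.\<close>

lemma svd_pairs_balanced:
  fixes P :: "('n::{finite,linorder}, 'n) rmat" and Q :: "('m::{finite,linorder}, 'm) rmat"
    and P0 :: "('n, 'r::{finite,linorder}) rmat" and Q0 :: "('m, 'r) rmat"
  assumes card: "CARD('n) \<le> CARD('m)" "CARD('r) \<le> CARD('n)" and svd: "(P, Q) \<in> svd_pairs X"
    and bal: "balanced P0 Q0 D0" and X: "X = P0 ** D0 ** transpose (Q0 ** D0)"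
  defines "P1 \<equiv> first_columns P :: ('n, 'r) rmat" and "Q1 \<equiv> first_columns Q :: ('m, 'r) rmat"
    and "D \<equiv> sqrt_sing_diag X :: ('r, 'r) rmat"
  shows "balanced P1 Q1 D" "X = P1 ** D ** transpose (Q1 ** D)"
proof -
  have zero: "sing_val X p = 0" if "CARD('r) < p" for p
    using balanced_sing_val(2)[OF bal X that] .
  have d0: "D0 $ j $ j \<ge> 0" for j using bal by (simp add: balanced_def nonneg_diagonal_def)
  have d: "D $ j $ j = D0 $ j $ j" for j
    using d0[of j]
    by (simp add: D_def sqrt_sing_diag_def rdiag_diagonal balanced_sing_val(1)[OF bal X])
  have off: "D $ i $ j = 0" if "i \<noteq> j" for i j
    using that by (simp add: D_def sqrt_sing_diag_def rdiag_def)
  have col: "column j (first_columns M :: ('x, 'r) rmat) = nth_column M (pos j)"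
    for M :: "('x::finite, 'y::{finite,linorder}) rmat" and j
    by (simp add: first_columns_def column_def vec_eq_iff)
  have orth: "orthonormal_columns (first_columns M :: ('x, 'r) rmat)"
    if M: "orthogonal_matrix M" and cd: "CARD('r) \<le> CARD('x)"
    for M :: "('x::{finite,linorder}, 'x) rmat"
  proof (rule orthonormal_columnsI)
    fix i j :: 'r
    have M': "orthonormal_columns M" using M by (simp add: orthonormal_columns_def orthogonal_matrix)
    have "pos i \<in> {1..CARD('x)}" "pos j \<in> {1..CARD('x)}" using pos_in[of i] pos_in[of j] cd by auto
    then obtain i' j' :: 'x where ij: "pos i' = pos i" "pos j' = pos j" using pos_surj by metis
    have "i' = j' \<longleftrightarrow> i = j" using ij by (metis pos_eq_iff)
    then show "column i (first_columns M) \<bullet> column j (first_columns M) = (if i = j then 1 else 0)"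
      unfolding col ij[symmetric] nth_column_pos by (simp add: orthonormal_columns_inner[OF M'])
  qed
  show bal1: "balanced P1 Q1 D"
    unfolding balanced_def
  proof (intro conjI)
    show "orthonormal_columns P1" "orthonormal_columns Q1"
      using svd orth[OF _ card(2), of P] orth[OF _ order_trans[OF card(2,1)], of Q]
      unfolding P1_def Q1_def svd_pairs_def by auto
    show "nonneg_diagonal D" using d d0 off by (simp add: nonneg_diagonal_def)
    show "\<forall>i j. i \<le> j \<longrightarrow> D $ j $ j \<le> D $ i $ i" using bal d by (simp add: balanced_def)
  qed
  have "X $ a $ b = (P1 ** D ** transpose (Q1 ** D)) $ a $ b" for a b
  proof -
    have "X $ a $ b = (P ** rdiag (sing_val X) ** transpose Q) $ a $ b"
      using svd by (simp add: svd_pairs_def)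
    also have "\<dots> = (\<Sum>p=1..CARD('n). sing_val X p * nth_column P p $ a * nth_column Q p $ b)"
      by (rule rdiag_product_entry[OF card(1)])
    also have "\<dots> = (\<Sum>p=1..CARD('r). sing_val X p * nth_column P p $ a * nth_column Q p $ b)"
      using card zero by (intro sum.mono_neutral_right) auto
    also have "\<dots> = (\<Sum>j\<in>UNIV. sing_val X (pos (j::'r)) * nth_column P (pos j) $ a * nth_column Q (pos j) $ b)"
      by (rule sum_pos[symmetric])
    also have "\<dots> = (P1 ** D ** transpose (Q1 ** D)) $ a $ b"
      unfolding mult_transpose_entry balanced_column(1)[OF bal1] balanced_column(1)[OF balanced_swap[OF bal1]]
      by (rule sum.cong[OF refl])
         (simp add: col P1_def Q1_def d balanced_sing_val(1)[OF bal X] power2_eq_square mult_ac)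
    finally show ?thesis .
  qed
  then show "X = P1 ** D ** transpose (Q1 ** D)" by (simp add: vec_eq_iff)
qed

section \<open>Convergence of column spaces\<close>

lemma span_columns_eq_range:
  fixes A :: "('n::finite, 'm::finite) rmat"
  shows "span (columns A) = range (\<lambda>w. A *v w)"
proof
  have "subspace (range (\<lambda>w. A *v w))"
    by (rule linear_subspace_image[OF matrix_vector_mul_linear subspace_UNIV])
  moreover have "columns A \<subseteq> range (\<lambda>w. A *v w)"
    unfolding columns_image_basis by auto
  ultimately show "span (columns A) \<subseteq> range (\<lambda>w. A *v w)" by (rule span_minimal[rotated])
  show "range (\<lambda>w. A *v w) \<subseteq> span (columns A)" by (auto intro: matrix_vector_mult_in_columnspace)
qed

lemma tendsto_matrix_vector_mult:
  fixes X :: "nat \<Rightarrow> ('n::finite, 'm::finite) rmat"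
  assumes "X \<longlonglongrightarrow> X'" "w \<longlonglongrightarrow> w'"
  shows "(\<lambda>k. X k *v w k) \<longlonglongrightarrow> X' *v w'"
  unfolding matrix_vector_mult_def
  by (intro vec_tendstoI) (simp, intro tendsto_intros tendsto_vec_nth assms)

text \<open>Every vector of the limit range is a limit of range vectors. Conversely, uniformly bounded
  preimages keep limits of range vectors inside the limit range; this excludes that directions
  with vanishing singular value survive in the limit.\<close>

lemma painleve_kuratowski_range:
  fixes X :: "nat \<Rightarrow> ('n::finite, 'm::finite) rmat"
  assumes lim: "X \<longlonglongrightarrow> X'"
    and sub: "\<forall>\<^sub>F k in sequentially. \<forall>w. X k *v w \<in> C k"
    and rep: "\<forall>\<^sub>F k in sequentially. \<forall>y\<in>C k. \<exists>w. norm w \<le> M * norm y \<and> y = X k *v w"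
    and M: "0 \<le> M"
  shows "painleve_kuratowski_converges C (span (columns X'))"
proof -
  have inner: "span (columns X') \<subseteq> inner_limit C"
  proof
    fix y assume "y \<in> span (columns X')"
    then obtain w where y: "y = X' *v w" by (auto simp: span_columns_eq_range)
    have "(\<lambda>k. X k *v w) \<longlonglongrightarrow> y" unfolding y by (intro tendsto_matrix_vector_mult lim tendsto_const)
    moreover have "\<forall>\<^sub>F k in sequentially. X k *v w \<in> C k" using sub by eventually_elim blast
    ultimately show "y \<in> inner_limit C"
      unfolding inner_limit_def by (intro CollectI exI[of _ "\<lambda>k. X k *v w"]) simp
  qed
  have mid: "inner_limit C \<subseteq> outer_limit C"
  proof
    fix x assume "x \<in> inner_limit C"
    then obtain y N where y: "\<And>k. N \<le> k \<Longrightarrow> y k \<in> C k" "y \<longlonglongrightarrow> x"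
      unfolding inner_limit_def eventually_sequentially by blast
    have "strict_mono (\<lambda>k. k + N)" by (simp add: strict_mono_def)
    moreover have "(\<lambda>k. y (k + N)) \<longlonglongrightarrow> x" using y(2) by (rule LIMSEQ_ignore_initial_segment)
    ultimately show "x \<in> outer_limit C"
      unfolding outer_limit_def using y(1)
      by (intro CollectI exI[of _ "\<lambda>k. k + N"] exI[of _ "\<lambda>k. y (k + N)"]) auto
  qed
  have outer: "outer_limit C \<subseteq> span (columns X')"
  proof
    fix x assume "x \<in> outer_limit C"
    then obtain s :: "nat \<Rightarrow> nat" and y where s: "strict_mono s" and y: "\<And>k. y k \<in> C (s k)" "y \<longlonglongrightarrow> x"
      unfolding outer_limit_def by blast
    obtain N where N: "\<And>k y. N \<le> k \<Longrightarrow> y \<in> C k \<Longrightarrow> \<exists>w. norm w \<le> M * norm y \<and> y = X k *v w"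
      using rep unfolding eventually_sequentially by blast
    have "\<exists>w. norm w \<le> M * norm (y (k + N)) \<and> y (k + N) = X (s (k + N)) *v w" for k
      using seq_suble[OF s, of "k + N"] by (intro N y) auto
    then obtain w where w: "\<And>k. norm (w k) \<le> M * norm (y (k + N))"
        "\<And>k. y (k + N) = X (s (k + N)) *v w k"
      by metis
    obtain K where K: "\<And>k. norm (y k) \<le> K"
      using convergent_imp_bounded[OF y(2)] unfolding bounded_iff by auto
    have "bounded (range w)"
      unfolding bounded_iff
    proof (intro exI ballI)
      fix v assume "v \<in> range w"
      then obtain k where "v = w k" by blast
      then show "norm v \<le> M * K" using w(1)[of k] mult_left_mono[OF K[of "k + N"] M] by simp
    qed
    then obtain w' r where r: "strict_mono r" "(w \<circ> r) \<longlonglongrightarrow> w'"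
      using bounded_imp_convergent_subsequence by metis
    have mono: "strict_mono (\<lambda>k. s (r k + N))" using s r(1) by (simp add: strict_mono_def)
    have "(\<lambda>k. X (s (r k + N)) *v (w \<circ> r) k) \<longlonglongrightarrow> X' *v w'"
      using LIMSEQ_subseq_LIMSEQ[OF lim mono] r(2) by (intro tendsto_matrix_vector_mult) (auto simp: o_def)
    moreover have "(\<lambda>k. X (s (r k + N)) *v (w \<circ> r) k) \<longlonglongrightarrow> x"
      using LIMSEQ_subseq_LIMSEQ[OF LIMSEQ_ignore_initial_segment[OF y(2), of N] r(1)]
      by (simp add: o_def w(2)[symmetric])
    ultimately have "x = X' *v w'" by (rule LIMSEQ_unique[rotated])
    then show "x \<in> span (columns X')" by (simp add: matrix_vector_mult_in_columnspace)
  qed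
  show ?thesis
    unfolding painleve_kuratowski_converges_def using inner mid outer by blast
qed

text \<open>The preimage divides the coefficients of \<open>y\<close> by the nonzero singular values, all of which are at
  least \<open>c\<^sup>2\<close>.\<close>

lemma balanced_bounded_preimage:
  fixes P :: "('n::finite, 'r::{finite,linorder}) rmat" and Q :: "('m::finite, 'r) rmat"
  assumes bal: "balanced P Q D" and gap: "column_gap c (P ** D)" and c: "0 < c"
    and y: "y \<in> span (columns (P ** D))"
  shows "\<exists>w. norm w \<le> CARD('r) / c\<^sup>2 * norm y \<and> y = (P ** D ** transpose (Q ** D)) *v w"
proof -
  have P: "orthonormal_columns P" and Q: "orthonormal_columns Q"
    using bal by (auto simp: balanced_def)
  let ?d = "\<lambda>j. D $ j $ j"
  obtain z where "y = (P ** D) *v z" using y by (auto simp: span_columns_eq_range)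
  then have yz: "y = (\<Sum>j\<in>UNIV. (z $ j * ?d j) *\<^sub>R column j P)"
    by (simp add: matrix_vector_mult_columns balanced_column(1)[OF bal])
  then have py: "column j P \<bullet> y = z $ j * ?d j" for j by (simp add: inner_sum_orthonormal[OF P])
  define b where "b j = (column j P \<bullet> y) / (?d j)\<^sup>2" for j
  define w where "w = (\<Sum>j\<in>UNIV. b j *\<^sub>R column j Q)"
  have "(P ** D ** transpose (Q ** D)) *v w = (\<Sum>j\<in>UNIV. ((?d j)\<^sup>2 * b j) *\<^sub>R column j P)"
    unfolding balanced_product_vector[OF bal] w_def inner_sum_orthonormal[OF Q] ..
  also have "\<dots> = (\<Sum>j\<in>UNIV. (z $ j * ?d j) *\<^sub>R column j P)"
  proof (rule sum.cong[OF refl])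
    fix j
    show "((?d j)\<^sup>2 * b j) *\<^sub>R column j P = (z $ j * ?d j) *\<^sub>R column j P"
      by (cases "?d j = 0") (simp_all add: b_def py)
  qed
  finally have "y = (P ** D ** transpose (Q ** D)) *v w" using yz by simp
  moreover have "norm w \<le> CARD('r) / c\<^sup>2 * norm y"
  proof -
    have nq: "norm (column j Q) = 1" and np: "norm (column j P) = 1" for j
      using P Q by (auto simp: norm_eq_sqrt_inner orthonormal_columns_inner)
    have "\<bar>b j\<bar> \<le> norm y / c\<^sup>2" for j
    proof (cases "?d j = 0")
      case False
      then have "c \<le> ?d j"
        using gap balanced_column(2,3)[OF bal, of j] unfolding column_gap_def by metis
      then have cd: "c\<^sup>2 \<le> (?d j)\<^sup>2" using c by (intro power_mono) auto
      have "\<bar>column j P \<bullet> y\<bar> \<le> norm y"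
        using Cauchy_Schwarz_ineq2[of "column j P" y] by (simp add: np)
      then have "\<bar>column j P \<bullet> y\<bar> / (?d j)\<^sup>2 \<le> norm y / c\<^sup>2"
        using cd c by (intro frac_le) auto
      then show ?thesis by (simp add: b_def abs_divide)
    qed (simp add: b_def)
    then have "norm (b j *\<^sub>R column j Q) \<le> norm y / c\<^sup>2" for j by (simp add: nq)
    then have "norm w \<le> (\<Sum>j\<in>(UNIV::'r set). norm y / c\<^sup>2)"
      unfolding w_def by (rule order_trans[OF norm_sum sum_mono])
    then show ?thesis by simp
  qed
  ultimately show ?thesis by blast
qed

section \<open>A sufficient condition for stationarity\<close>

definition real_objective ::
  "(('n::finite, 'm::finite) rmat \<Rightarrow> real) \<Rightarrow> (real \<Rightarrow> ereal) \<Rightarrow> real \<Rightarrow> real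
    \<Rightarrow> ('n, 'r::finite) rmat \<times> ('m, 'r) rmat \<Rightarrow> real" where
  "real_objective f \<theta> lam \<mu> x = f (fst x ** transpose (snd x))
     + lam * (total_penalty \<theta> (fst x) + total_penalty \<theta> (snd x))
     + \<mu> / 2 * ((norm (fst x))\<^sup>2 + (norm (snd x))\<^sup>2)"

lemma objective_eq_real:
  assumes "penalty_fun \<theta>"
  shows "objective f \<theta> lam \<mu> = (\<lambda>x. ereal (real_objective f \<theta> lam \<mu> x))"
  unfolding objective_def real_objective_def
  by (auto simp: vtheta_eq_total_penalty[OF assms] fun_eq_iff)

lemma regular_subdiff_limiting:
  assumes "v \<in> regular_subdiff h x"
  shows "v \<in> limiting_subdiff h x"
proof -
  have "\<bar>h x\<bar> \<noteq> \<infinity>" using assms by (simp add: regular_subdiff_def)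
  moreover have "(\<lambda>_::nat. x) \<longlonglongrightarrow> x" "(\<lambda>_::nat. h x) \<longlonglongrightarrow> h x" "(\<lambda>_::nat. v) \<longlonglongrightarrow> v"
    by (rule tendsto_const)+
  ultimately show ?thesis
    using assms unfolding limiting_subdiff_def
    by (intro CollectI conjI exI[of _ "\<lambda>_::nat. x"] exI[of _ "\<lambda>_::nat. v"]) auto
qed

text \<open>A minorant that touches \<open>h\<close> at \<open>x\<close> and is stationary there bounds \<open>h\<close> from below to first order.\<close>

lemma regular_subdiff_zeroI:
  fixes g h :: "'a::euclidean_space \<Rightarrow> real"
  assumes "(g has_derivative (\<lambda>_. 0)) (at x)" "g x = h x" "\<And>y. g y \<le> h y"
  shows "0 \<in> regular_subdiff (\<lambda>y. ereal (h y)) x"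
proof -
  have "\<forall>\<^sub>F y in nhds x. ereal (h x) + ereal (0 \<bullet> (y - x) - e * norm (y - x)) \<le> ereal (h y)"
    if e: "0 < e" for e
  proof -
    obtain d where d: "0 < d" "\<And>y. norm (y - x) < d \<Longrightarrow> norm (g y - g x - 0) \<le> e * norm (y - x)"
      using assms(1) e unfolding has_derivative_at_alt by blast
    have "h x - e * norm (y - x) \<le> h y" if "norm (y - x) < d" for y
      using d(2)[OF that] assms(2) assms(3)[of y] by simp
    then show ?thesis
      unfolding eventually_nhds_metric using d(1) by (auto simp: dist_norm)
  qed
  then show ?thesis by (simp add: regular_subdiff_def)
qed

text \<open>Zero columns impose no condition: there the penalty is minimal, and the gradient of the
  smooth part vanishes because the same column of the other factor is zero, too.\<close>

lemma zero_in_regular_subdiff_objective: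
  fixes f :: "('n::finite, 'm::finite) rmat \<Rightarrow> real" and U :: "('n, 'r::finite) rmat" and V :: "('m, 'r) rmat"
  assumes \<theta>: "penalty_fun \<theta>" and lam: "0 < lam"
    and grad: "GDERIV f (U ** transpose V) :> G"
    and supp: "\<And>j. column j U = 0 \<longleftrightarrow> column j V = 0"
  defines "\<tau> \<equiv> \<lambda>s. real_of_ereal (\<theta> s)"
  assumes eqU: "\<And>j. column j U \<noteq> 0 \<Longrightarrow> G *v column j V
      + (\<mu> + lam * deriv \<tau> (norm (column j U)) / norm (column j U)) *\<^sub>R column j U = 0"
    and eqV: "\<And>j. column j V \<noteq> 0 \<Longrightarrow> transpose G *v column j U
      + (\<mu> + lam * deriv \<tau> (norm (column j V)) / norm (column j V)) *\<^sub>R column j V = 0"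
  shows "0 \<in> regular_subdiff (objective f \<theta> lam \<mu>) (U, V)"
  unfolding objective_eq_real[OF \<theta>]
proof (rule regular_subdiff_zeroI)
  \<comment> \<open>Dropping the penalty of the zero columns gives a differentiable minorant \<open>g\<close> of the objective.\<close>
  define J where "J = {j. column j U \<noteq> 0}"
  define g where "g x = f (fst x ** transpose (snd x))
     + lam * ((\<Sum>j\<in>J. \<tau> (norm (column j (fst x)))) + (\<Sum>j\<in>J. \<tau> (norm (column j (snd x)))))
     + \<mu> / 2 * (fst x \<bullet> fst x + snd x \<bullet> snd x)" for x :: "('n, 'r) rmat \<times> ('m, 'r) rmat"
  have pen: "(\<Sum>j\<in>J. \<tau> (norm (column j W))) \<le> total_penalty \<theta> W" for W :: "('k::finite, 'r) rmat"
    unfolding total_penalty_def \<tau>_def by (intro sum_mono2) (auto intro: real_penalty_nonneg[OF \<theta>])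
  have pen_eq: "(\<Sum>j\<in>J. \<tau> (norm (column j W))) = total_penalty \<theta> W"
    if "\<And>j. j \<notin> J \<Longrightarrow> column j W = 0" for W :: "('k::finite, 'r) rmat"
    unfolding total_penalty_def \<tau>_def
    by (intro sum.mono_neutral_left) (auto simp: that real_penalty_zero[OF \<theta>])
  show "g (U, V) = real_objective f \<theta> lam \<mu> (U, V)"
    unfolding g_def real_objective_def
    using pen_eq[of U] pen_eq[of V] supp by (auto simp: J_def power2_norm_eq_inner)
  show "g y \<le> real_objective f \<theta> lam \<mu> y" for y
  proof -
    have "lam * ((\<Sum>j\<in>J. \<tau> (norm (column j (fst y)))) + (\<Sum>j\<in>J. \<tau> (norm (column j (snd y)))))
        \<le> lam * (total_penalty \<theta> (fst y) + total_penalty \<theta> (snd y))"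
      using lam by (intro mult_left_mono add_mono pen) auto
    then show ?thesis by (simp add: g_def real_objective_def power2_norm_eq_inner)
  qed
  let ?cU = "\<lambda>j. deriv \<tau> (norm (column j U)) / norm (column j U)"
  let ?cV = "\<lambda>j. deriv \<tau> (norm (column j V)) / norm (column j V)"
  let ?D = "\<lambda>h :: ('n, 'r) rmat \<times> ('m, 'r) rmat.
      (U ** transpose (snd h) + fst h ** transpose V) \<bullet> G
      + lam * ((\<Sum>j\<in>J. (?cU j *\<^sub>R column j U) \<bullet> column j (fst h))
             + (\<Sum>j\<in>J. (?cV j *\<^sub>R column j V) \<bullet> column j (snd h)))
      + \<mu> / 2 * (2 * (U \<bullet> fst h) + 2 * (V \<bullet> snd h))"
  have dfst: "(fst has_derivative fst) (at (U, V))" and dsnd: "(snd has_derivative snd) (at (U, V))"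
    by (auto intro!: bounded_linear_imp_has_derivative bounded_linear_fst bounded_linear_snd)
  have df: "((\<lambda>x. f (fst x ** transpose (snd x))) has_derivative
      (\<lambda>h. (U ** transpose (snd h) + fst h ** transpose V) \<bullet> G)) (at (U, V))"
  proof -
    have "((\<lambda>x. fst x ** transpose (snd x)) has_derivative
        (\<lambda>h. fst (U, V) ** transpose (snd h) + fst h ** transpose (snd (U, V)))) (at (U, V))"
      by (rule bounded_bilinear.FDERIV[OF bounded_bilinear_matrix_mult dfst
            bounded_linear.has_derivative[OF bounded_linear_transpose dsnd]])
    moreover have "(f has_derivative (\<lambda>h. h \<bullet> G)) (at (fst (U, V) ** transpose (snd (U, V))))"
      using grad by (simp add: gderiv_def)
    ultimately show ?thesis
      by (rule has_derivative_compose[THEN has_derivative_eq_rhs]) simp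
  qed
  have dpen: "((\<lambda>x. \<tau> (norm (column j (p x)))) has_derivative
      (\<lambda>h. ((deriv \<tau> (norm (column j W)) / norm (column j W)) *\<^sub>R column j W) \<bullet> column j (p h))) (at (U, V))"
    if "column j W \<noteq> 0" and p: "(p has_derivative p) (at (U, V))" "p (U, V) = W"
    for j and W :: "('k::finite, 'r) rmat" and p
  proof -
    have "((\<lambda>x. column j (p x)) has_derivative (\<lambda>h. column j (p h))) (at (U, V))"
      by (rule bounded_linear.has_derivative[OF bounded_linear_column p(1)])
    moreover have "((\<lambda>y. \<tau> (norm y)) has_derivative
        (\<lambda>h. ((deriv \<tau> (norm (column j W)) / norm (column j W)) *\<^sub>R column j W) \<bullet> h)) (at (column j (p (U, V))))"
      using has_derivative_penalty_norm[OF \<theta> that(1)] p(2) unfolding \<tau>_def by simp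
    ultimately show ?thesis by (rule has_derivative_compose)
  qed
  have dsq: "((\<lambda>x. p x \<bullet> p x) has_derivative (\<lambda>h. 2 * (W \<bullet> p h))) (at (U, V))"
    if p: "(p has_derivative p) (at (U, V))" "p (U, V) = W"
    for W :: "('k::finite, 'r) rmat" and p
    using has_derivative_inner[OF p(1) p(1)] by (simp add: p(2) inner_commute)
  have "(g has_derivative ?D) (at (U, V))"
    unfolding g_def
    by (intro has_derivative_add df has_derivative_mult_right has_derivative_sum dpen dsq dfst dsnd)
       (auto simp: J_def supp)
  moreover have "?D h = 0" for h
  proof -
    obtain A B where h: "h = (A, B)" by (cases h)
    have t1: "(A ** transpose V) \<bullet> G = (\<Sum>j\<in>UNIV. (G *v column j V) \<bullet> column j A)"
      unfolding inner_commute[of _ G] inner_mult_transpose inner_eq_sum_columns[of "G ** V"]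
        column_matrix_mult ..
    have "(U ** transpose B) \<bullet> G = (B ** transpose U) \<bullet> transpose G"
      by (subst inner_transpose[symmetric]) (simp add: matrix_transpose_mul)
    then have t2: "(U ** transpose B) \<bullet> G = (\<Sum>j\<in>UNIV. (transpose G *v column j U) \<bullet> column j B)"
      unfolding inner_commute[of _ "transpose G"] inner_mult_transpose
        inner_eq_sum_columns[of "transpose G ** U"] column_matrix_mult .
    have sJ: "(\<Sum>j\<in>J. F j) = (\<Sum>j\<in>UNIV. if j \<in> J then F j else 0)" for F :: "'r \<Rightarrow> real"
      by (simp add: sum.If_cases)
    have zU: "(G *v column j V) \<bullet> column j A + lam * (if j \<in> J then (?cU j *\<^sub>R column j U) \<bullet> column j A else 0)
        + \<mu> * (column j U \<bullet> column j A) = 0" for j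
    proof (cases "j \<in> J")
      case True
      then have "column j U \<noteq> 0" by (simp add: J_def)
      from arg_cong[OF eqU[OF this], of "\<lambda>v. v \<bullet> column j A"] True show ?thesis
        by (simp add: inner_add_left distrib_right)
    next
      case False
      then have "column j U = 0" "column j V = 0" using supp by (auto simp: J_def)
      then show ?thesis using False by simp
    qed
    have zV: "(transpose G *v column j U) \<bullet> column j B
        + lam * (if j \<in> J then (?cV j *\<^sub>R column j V) \<bullet> column j B else 0)
        + \<mu> * (column j V \<bullet> column j B) = 0" for j
    proof (cases "j \<in> J")
      case True
      then have "column j V \<noteq> 0" using supp by (simp add: J_def)
      from arg_cong[OF eqV[OF this], of "\<lambda>v. v \<bullet> column j B"] True show ?thesis
        by (simp add: inner_add_left distrib_right)
    next
      case False
      then have "column j U = 0" "column j V = 0" using supp by (auto simp: J_def)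
      then show ?thesis using False by simp
    qed
    have "?D h = (\<Sum>j\<in>UNIV. ((G *v column j V) \<bullet> column j A
          + lam * (if j \<in> J then (?cU j *\<^sub>R column j U) \<bullet> column j A else 0) + \<mu> * (column j U \<bullet> column j A))
        + ((transpose G *v column j U) \<bullet> column j B
          + lam * (if j \<in> J then (?cV j *\<^sub>R column j V) \<bullet> column j B else 0) + \<mu> * (column j V \<bullet> column j B)))"
      unfolding h fst_conv snd_conv inner_add_left t1 t2 sJ inner_eq_sum_columns[of U]
        inner_eq_sum_columns[of V] sum.distrib
      by (simp add: sum_distrib_left[symmetric] distrib_left)
    then show ?thesis unfolding zU zV by simp
  qed
  ultimately show "(g has_derivative (\<lambda>_. 0)) (at (U, V))" by simp
qed

section \<open>One step of the algorithm\<close>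

lemma argmin_majorant_left:
  fixes f :: "('n::finite, 'm::finite) rmat \<Rightarrow> real" and B :: "('m, 'r::finite) rmat"
  assumes \<theta>: "penalty_fun \<theta>"
    and A: "A \<in> argmin_set (\<lambda>W. majorant f gradf L \<theta> lam \<mu> W B C B + ereal (g / 2 * (norm (W - C))\<^sup>2))"
  shows "solves_subproblem \<theta> lam \<mu> L g (gradf (C ** transpose B)) B C A"
  unfolding solves_subproblem_def
proof
  fix W
  have "majorant f gradf L \<theta> lam \<mu> W B C B + ereal (g / 2 * (norm (W - C))\<^sup>2)
      = ereal (subproblem \<theta> lam \<mu> L g (gradf (C ** transpose B)) B C W
          + (f (C ** transpose B) + lam * total_penalty \<theta> B + \<mu> / 2 * (norm B)\<^sup>2))" for W
    by (simp add: majorant_def subproblem_def vtheta_eq_total_penalty[OF \<theta>] matrix_mult_diff_left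
        algebra_simps)
  then show "subproblem \<theta> lam \<mu> L g (gradf (C ** transpose B)) B C A
      \<le> subproblem \<theta> lam \<mu> L g (gradf (C ** transpose B)) B C W"
    using A by (simp add: argmin_set_def)
qed

lemma argmin_majorant_right:
  fixes f :: "('n::finite, 'm::finite) rmat \<Rightarrow> real" and B :: "('n, 'r::finite) rmat"
  assumes \<theta>: "penalty_fun \<theta>"
    and A: "A \<in> argmin_set (\<lambda>W. majorant f gradf L \<theta> lam \<mu> B W B C + ereal (g / 2 * (norm (W - C))\<^sup>2))"
  shows "solves_subproblem \<theta> lam \<mu> L g (transpose (gradf (B ** transpose C))) B C A"
  unfolding solves_subproblem_def
proof
  fix W
  have flip: "B ** transpose W - B ** transpose C = transpose ((W - C) ** transpose B)" for W
    by (simp add: matrix_transpose_mul transpose_diff matrix_mult_diff_right)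
  have "majorant f gradf L \<theta> lam \<mu> B W B C + ereal (g / 2 * (norm (W - C))\<^sup>2)
      = ereal (subproblem \<theta> lam \<mu> L g (transpose (gradf (B ** transpose C))) B C W
          + (f (B ** transpose C) + lam * total_penalty \<theta> B + \<mu> / 2 * (norm B)\<^sup>2))" for W
  proof -
    have "gradf (B ** transpose C) \<bullet> transpose ((W - C) ** transpose B)
        = transpose (gradf (B ** transpose C)) \<bullet> ((W - C) ** transpose B)"
      by (subst inner_transpose[symmetric]) simp
    then show ?thesis
      unfolding majorant_def subproblem_def flip norm_transpose
      by (simp add: vtheta_eq_total_penalty[OF \<theta>] algebra_simps)
  qed
  then show "subproblem \<theta> lam \<mu> L g (transpose (gradf (B ** transpose C))) B C A
      \<le> subproblem \<theta> lam \<mu> L g (transpose (gradf (B ** transpose C))) B C W"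
    using A by (simp add: argmin_set_def)
qed

text \<open>Comparing the solution of a subproblem with the proximal centre and adding the quadratic upper
  bound for \<open>f\<close> gives sufficient decrease; the second factor enters through its own terms only.\<close>

lemma solves_subproblem_decrease_left:
  fixes f :: "('n::finite, 'm::finite) rmat \<Rightarrow> real" and B :: "('m, 'r::finite) rmat"
  assumes grad: "\<And>X. GDERIV f X :> gradf X" and lip: "L-lipschitz_on UNIV gradf"
    and sol: "solves_subproblem \<theta> lam \<mu> L g (gradf (C ** transpose B)) B C A"
  shows "real_objective f \<theta> lam \<mu> (A, B) + g / 2 * (norm (A - C))\<^sup>2 \<le> real_objective f \<theta> lam \<mu> (C, B)"
proof -
  have "f (A ** transpose B) \<le> f (C ** transpose B)
      + gradf (C ** transpose B) \<bullet> ((A - C) ** transpose B)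
      + L / 2 * (norm ((A - C) ** transpose B))\<^sup>2"
    using lipschitz_gradient_descent[OF grad lip, of "A ** transpose B" "C ** transpose B"]
    by (simp add: matrix_mult_diff_left)
  moreover have "subproblem \<theta> lam \<mu> L g (gradf (C ** transpose B)) B C A
      \<le> subproblem \<theta> lam \<mu> L g (gradf (C ** transpose B)) B C C"
    using sol by (simp add: solves_subproblem_def)
  ultimately show ?thesis
    by (simp add: subproblem_def real_objective_def matrix_mult_diff_left algebra_simps)
qed

lemma solves_subproblem_decrease_right:
  fixes f :: "('n::finite, 'm::finite) rmat \<Rightarrow> real" and B :: "('n, 'r::finite) rmat"
  assumes grad: "\<And>X. GDERIV f X :> gradf X" and lip: "L-lipschitz_on UNIV gradf"
    and sol: "solves_subproblem \<theta> lam \<mu> L g (transpose (gradf (B ** transpose C))) B C A"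
  shows "real_objective f \<theta> lam \<mu> (B, A) + g / 2 * (norm (A - C))\<^sup>2 \<le> real_objective f \<theta> lam \<mu> (B, C)"
proof -
  have flip: "B ** transpose A - B ** transpose C = transpose ((A - C) ** transpose B)"
    by (simp add: matrix_transpose_mul transpose_diff matrix_mult_diff_right)
  have "gradf (B ** transpose C) \<bullet> transpose ((A - C) ** transpose B)
        = transpose (gradf (B ** transpose C)) \<bullet> ((A - C) ** transpose B)"
    by (subst inner_transpose[symmetric]) simp
  then have "f (B ** transpose A) \<le> f (B ** transpose C)
      + transpose (gradf (B ** transpose C)) \<bullet> ((A - C) ** transpose B)
      + L / 2 * (norm ((A - C) ** transpose B))\<^sup>2"
    using lipschitz_gradient_descent[OF grad lip, of "B ** transpose A" "B ** transpose C"]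
    by (simp add: flip norm_transpose)
  moreover have "subproblem \<theta> lam \<mu> L g (transpose (gradf (B ** transpose C))) B C A
      \<le> subproblem \<theta> lam \<mu> L g (transpose (gradf (B ** transpose C))) B C C"
    using sol by (simp add: solves_subproblem_def)
  ultimately show ?thesis
    by (simp add: subproblem_def real_objective_def matrix_mult_diff_left algebra_simps)
qed

lemma balanced_objective_le:
  fixes P A :: "('n::{finite,linorder}, 'r::{finite,linorder}) rmat"
    and Q B :: "('m::{finite,linorder}, 'r) rmat"
  assumes "CARD('n) \<le> CARD('m)" "CARD('r) \<le> CARD('n)" "penalty_fun \<theta>"
    and "balanced_factorization_optimal TYPE('n \<times> 'm) \<theta>" "0 < lam" "0 < \<mu>"
    and bal: "balanced P Q D" and prod: "A ** transpose B = P ** D ** transpose (Q ** D)"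
  shows "real_objective f \<theta> lam \<mu> (P ** D, Q ** D) \<le> real_objective f \<theta> lam \<mu> (A, B)"
proof -
  have "lam * (total_penalty \<theta> (P ** D) + total_penalty \<theta> (Q ** D))
      \<le> lam * (total_penalty \<theta> A + total_penalty \<theta> B)"
    using balanced_penalty_minimal[OF assms(1-4) bal prod] assms(5) by (intro mult_left_mono) auto
  moreover have "\<mu> / 2 * ((norm (P ** D))\<^sup>2 + (norm (Q ** D))\<^sup>2) \<le> \<mu> / 2 * ((norm A)\<^sup>2 + (norm B)\<^sup>2)"
    using balanced_norm_minimal[OF bal prod] assms(6) by (intro mult_left_mono) auto
  ultimately show ?thesis by (simp add: real_objective_def prod)
qed

lemma balanced_column_gap:
  assumes "balanced P Q D"
  shows "column_gap c (P ** D) \<longleftrightarrow> (\<forall>j. D $ j $ j \<noteq> 0 \<longrightarrow> c \<le> D $ j $ j)"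
  unfolding column_gap_def balanced_column(2,3)[OF assms] ..

lemma balanced_limit:
  assumes "\<And>n::nat. balanced (P n) (Q n) (D n)" "P \<longlonglongrightarrow> P'" "Q \<longlonglongrightarrow> Q'" "D \<longlonglongrightarrow> D'"
  shows "balanced P' Q' D'"
proof -
  have orth: "orthonormal_columns A'" if "\<And>n. orthonormal_columns (A n)" "A \<longlonglongrightarrow> A'"
    for A :: "nat \<Rightarrow> ('x::finite, 'y::finite) rmat" and A'
  proof -
    have "(\<lambda>n. transpose (A n) ** A n) \<longlonglongrightarrow> transpose A' ** A'"
      by (intro tendsto_matrix_mult tendsto_transpose that)
    moreover have "(\<lambda>n. transpose (A n) ** A n) = (\<lambda>n. mat 1)"
      using that(1) by (simp add: orthonormal_columns_def)
    ultimately show ?thesis unfolding orthonormal_columns_def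
      by (metis LIMSEQ_unique tendsto_const)
  qed
  have D: "(\<lambda>n. D n $ i $ j) \<longlonglongrightarrow> D' $ i $ j" for i j
    by (intro tendsto_vec_nth assms)
  have bal: "\<And>n i j. i \<noteq> j \<Longrightarrow> D n $ i $ j = 0" "\<And>n i. 0 \<le> D n $ i $ i"
      "\<And>n i j. i \<le> j \<Longrightarrow> D n $ j $ j \<le> D n $ i $ i"
    using assms(1) by (auto simp: balanced_def nonneg_diagonal_def)
  have "D' $ i $ j = 0" if "i \<noteq> j" for i j
    using D[of i j] bal(1)[OF that] by (simp add: LIMSEQ_const_iff)
  moreover have "0 \<le> D' $ i $ i" for i
    by (rule LIMSEQ_le_const[OF D]) (use bal(2) in auto)
  moreover have "D' $ j $ j \<le> D' $ i $ i" if "i \<le> j" for i j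
    by (rule LIMSEQ_le[OF D D]) (use bal(3)[OF that] in auto)
  ultimately show ?thesis
    using orth[of P] orth[of Q] assms by (simp add: balanced_def nonneg_diagonal_def)
qed

lemma norm_sq_orthonormal:
  fixes P :: "('x::finite, 'y::finite) rmat"
  assumes "orthonormal_columns P"
  shows "(norm P)\<^sup>2 = CARD('y)"
  unfolding norm_sq_eq_sum_columns[of P]
  by (simp add: power2_norm_eq_inner orthonormal_columns_inner[OF assms])

lemma norm_balanced_diagonal:
  fixes P :: "('x::finite, 'y::{finite,linorder}) rmat" and Q :: "('z::finite, 'y) rmat"
  assumes "balanced P Q D"
  shows "norm D = norm (P ** D)"
proof -
  have D: "nonneg_diagonal D" using assms by (simp add: balanced_def)
  have "norm (column j D) = norm (column j (P ** D))" for j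
  proof -
    have "column j D = D $ j $ j *\<^sub>R axis j 1"
      using D by (auto simp: column_def nonneg_diagonal_def vec_eq_iff axis_def)
    then have "norm (column j D) = D $ j $ j" using D by (simp add: nonneg_diagonal_def)
    then show ?thesis by (simp add: balanced_column(2)[OF assms])
  qed
  then have "(norm D)\<^sup>2 = (norm (P ** D))\<^sup>2"
    by (simp add: norm_sq_eq_sum_columns[of D] norm_sq_eq_sum_columns[of "P ** D"])
  then show ?thesis by simp
qed

text \<open>Orthonormal columns have a fixed norm and the diagonal has the norm of the factor, so all three
  components are bounded.\<close>

lemma balanced_subsequence:
  fixes P :: "nat \<Rightarrow> ('x::finite, 'y::{finite,linorder}) rmat" and Q :: "nat \<Rightarrow> ('z::finite, 'y) rmat"
  assumes bal: "\<And>n. balanced (P n) (Q n) (D n)" and R: "\<And>n. norm (P n ** D n) \<le> R"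
  obtains r P' Q' D' where "strict_mono r" "(\<lambda>n. P (r n)) \<longlonglongrightarrow> P'" "(\<lambda>n. Q (r n)) \<longlonglongrightarrow> Q'"
    "(\<lambda>n. D (r n)) \<longlonglongrightarrow> D'" "balanced P' Q' D'"
proof -
  have n1: "norm (P n) = sqrt CARD('y)" "norm (Q n) = sqrt CARD('y)" for n
    using bal[of n] by (auto simp: balanced_def intro!: real_sqrt_unique[symmetric] norm_sq_orthonormal)
  have n2: "norm (D n) \<le> R" for n using norm_balanced_diagonal[OF bal[of n]] R[of n] by simp
  have "norm (P n, Q n, D n) \<le> sqrt CARD('y) + (sqrt CARD('y) + R)" for n
    using norm_Pair_le[of "P n" "(Q n, D n)"] norm_Pair_le[of "Q n" "D n"] n1[of n] n2[of n] by linarith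
  then have "bounded (range (\<lambda>n. (P n, Q n, D n)))" unfolding bounded_iff by blast
  then obtain l r where r: "strict_mono r" "((\<lambda>n. (P n, Q n, D n)) \<circ> r) \<longlonglongrightarrow> l"
    by (blast dest: bounded_imp_convergent_subsequence)
  obtain P' Q' D' where l: "l = (P', Q', D')" by (cases l) auto
  note lim = r(2)[unfolded l o_def]
  have P: "(\<lambda>n. P (r n)) \<longlonglongrightarrow> P'" using tendsto_fst[OF lim] by simp
  have Q: "(\<lambda>n. Q (r n)) \<longlonglongrightarrow> Q'" using tendsto_fst[OF tendsto_snd[OF lim]] by simp
  have D: "(\<lambda>n. D (r n)) \<longlonglongrightarrow> D'" using tendsto_snd[OF tendsto_snd[OF lim]] by simp
  have "balanced P' Q' D'" by (rule balanced_limit[OF bal P Q D])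
  with r(1) P Q D show thesis by (rule that)
qed

text \<open>Nonzero columns of either factor are recovered from the common product by division by a
  nonzero diagonal entry.\<close>

lemma span_columns_eq_of_svd:
  fixes A :: "('n::finite, 'r::finite) rmat"
  assumes D: "nonneg_diagonal D" and E: "nonneg_diagonal E" and Q: "orthogonal_matrix Q"
    and svd: "A ** D = P ** (E ** E) ** transpose Q"
    and supp: "\<And>j. D $ j $ j = 0 \<Longrightarrow> column j A = 0"
  shows "span (columns A) = span (columns (P ** E))"
proof
  have "column j A \<in> span (columns (P ** E))" for j
  proof (cases "D $ j $ j = 0")
    case True
    then show ?thesis using supp[of j] span_zero[of "columns (P ** E)"] by simp
  next
    case False
    have "column j (A ** D) = (P ** E) *v column j (E ** transpose Q)"
      unfolding svd column_matrix_mult[symmetric] by (simp add: matrix_mul_assoc)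
    then have "column j (A ** D) \<in> span (columns (P ** E))"
      by (simp add: matrix_vector_mult_in_columnspace)
    then have "(1 / D $ j $ j) *\<^sub>R column j (A ** D) \<in> span (columns (P ** E))"
      by (rule span_scale)
    then show ?thesis using False by (simp add: diagonal_mult_column[OF D])
  qed
  then show "span (columns A) \<subseteq> span (columns (P ** E))"
    by (intro span_minimal) (auto simp: columns_def)
  have "transpose Q ** Q = mat 1" using Q by (simp add: orthogonal_matrix)
  then have PEE: "(P ** E) ** E = A ** (D ** Q)"
    by (metis svd matrix_mul_assoc matrix_mul_rid)
  have "column j (P ** E) \<in> span (columns A)" for j
  proof (cases "E $ j $ j = 0")
    case True
    then show ?thesis using span_zero[of "columns A"] by (simp add: diagonal_mult_column[OF E])
  next
    case False
    have "column j (P ** E ** E) = A *v column j (D ** Q)"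
      unfolding PEE column_matrix_mult[symmetric] ..
    then have "column j (P ** E ** E) \<in> span (columns A)"
      by (simp add: matrix_vector_mult_in_columnspace)
    then have "(1 / E $ j $ j) *\<^sub>R column j (P ** E ** E) \<in> span (columns A)"
      by (rule span_scale)
    then show ?thesis using False by (simp add: diagonal_mult_column[OF E])
  qed
  then show "span (columns (P ** E)) \<subseteq> span (columns A)"
    by (intro span_minimal) (auto simp: columns_def)
qed

lemma painleve_kuratowski_balanced:
  fixes X :: "nat \<Rightarrow> ('n::finite, 'm::finite) rmat"
    and P :: "nat \<Rightarrow> ('n, 'r::{finite,linorder}) rmat" and Q :: "nat \<Rightarrow> ('m, 'r) rmat"
  assumes lim: "X \<longlonglongrightarrow> X'" and c: "0 < c"
    and gap: "\<forall>\<^sub>F k in sequentially. column_gap c (A k)"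
    and bal: "\<And>k. N \<le> k \<Longrightarrow> balanced (P k) (Q k) (D k)"
    and AB: "\<And>k. N \<le> k \<Longrightarrow> A k = P k ** D k" "\<And>k. N \<le> k \<Longrightarrow> B k = Q k ** D k"
    and X: "\<And>k. N \<le> k \<Longrightarrow> X k = A k ** transpose (B k)"
    and C: "\<And>k. N \<le> k \<Longrightarrow> C k = span (columns (A k))"
  shows "painleve_kuratowski_converges C (span (columns X'))"
proof (rule painleve_kuratowski_range[OF lim])
  have big: "\<forall>\<^sub>F k in sequentially. N \<le> k" by (rule eventually_ge_at_top)
  then show "\<forall>\<^sub>F k in sequentially. \<forall>w. X k *v w \<in> C k"
  proof eventually_elim
    case (elim k)
    have "X k *v w = A k *v (transpose (B k) *v w)" for w
      unfolding matrix_vector_mul_assoc X[OF elim] ..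
    then show ?case unfolding C[OF elim] by (metis matrix_vector_mult_in_columnspace)
  qed
  show "\<forall>\<^sub>F k in sequentially. \<forall>y\<in>C k. \<exists>w. norm w \<le> real CARD('r) / c\<^sup>2 * norm y \<and> y = X k *v w"
    using gap big
  proof eventually_elim
    case (elim k)
    note k = elim(2)
    show ?case
      unfolding C[OF k] X[OF k] AB[OF k]
      by (intro ballI balanced_bounded_preimage[OF bal[OF k] elim(1)[unfolded AB(1)[OF k]] c])
  qed
  show "0 \<le> real CARD('r) / c\<^sup>2" by simp
qed

section \<open>The iterates\<close>

locale alternating_minimization =
  fixes f :: "('n::{finite,linorder}, 'm::{finite,linorder}) rmat \<Rightarrow> real"
    and gradf :: "('n, 'm) rmat \<Rightarrow> ('n, 'm) rmat"
    and \<theta> :: "real \<Rightarrow> ereal"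
    and Lf lam \<mu> \<rho> \<gamma>low1 \<gamma>low2 :: real
    and \<gamma>1 \<gamma>2 :: "nat \<Rightarrow> real"
    and U Uh Ub Ph :: "nat \<Rightarrow> ('n, 'r::{finite,linorder}) rmat"
    and V Vh Vb Pb :: "nat \<Rightarrow> ('m, 'r) rmat"
    and Xh Xb :: "nat \<Rightarrow> ('n, 'm) rmat"
    and Dh Qh Db Qb :: "nat \<Rightarrow> ('r, 'r) rmat"
  assumes card: "CARD('n) \<le> CARD('m)" "CARD('r) \<le> CARD('n)"
    and lam: "0 < lam" and \<mu>: "0 < \<mu>"
    and f_bdd: "bdd_below (range f)"
    and grad: "\<And>X. GDERIV f X :> gradf X"
    and lip: "Lf-lipschitz_on UNIV gradf"
    and \<theta>: "penalty_fun \<theta>"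
    and run: "alt_min_run f gradf Lf \<theta> lam \<mu> \<rho> \<gamma>low1 \<gamma>low2 \<gamma>1 \<gamma>2
           U V Uh Vh Xh Ph Dh Qh Ub Vb Xb Pb Db Qb"
    and opt: "balanced_factorization_optimal TYPE('n \<times> 'm) \<theta>"
begin

abbreviation \<Phi> :: "('n, 'r) rmat \<times> ('m, 'r) rmat \<Rightarrow> real" where
  "\<Phi> \<equiv> real_objective f \<theta> lam \<mu>"

lemma Lf_nonneg: "0 \<le> Lf"
  using lip by (rule lipschitz_on_nonneg)

lemma params: "0 < \<rho>" "\<rho> < 1" "0 < \<gamma>low1" "0 < \<gamma>low2" "0 < \<gamma>1 0" "0 < \<gamma>2 0"
  "\<gamma>1 (Suc k) = max \<gamma>low1 (\<rho> * \<gamma>1 k)" "\<gamma>2 (Suc k) = max \<gamma>low2 (\<rho> * \<gamma>2 k)"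
  using run by (simp_all add: alt_min_run_def)

lemma start: "orthonormal_columns (Pb 0)" "orthonormal_columns (Ph 0)"
  "Qb 0 = mat 1" "Db 0 = mat 1" "Ub 0 = Ph 0" "Vb 0 = Pb 0" "Xb 0 = Ub 0 ** transpose (Vb 0)"
  using run by (simp_all add: alt_min_run_def)

lemma step_U:
  "U (Suc k) \<in> argmin_set (\<lambda>W. majorant f gradf Lf \<theta> lam \<mu> W (Vb k) (Ub k) (Vb k)
                                    + ereal (\<gamma>1 k / 2 * (norm (W - Ub k))\<^sup>2))"
  "orthonormal_columns (Ph (Suc k))" "orthogonal_matrix (Qh (Suc k))" "nonneg_diagonal (Dh (Suc k))"
  "Dh (Suc k) ** Dh (Suc k) = rdiag (sing_val (U (Suc k) ** Db k))"
  "U (Suc k) ** Db k = Ph (Suc k) ** (Dh (Suc k) ** Dh (Suc k)) ** transpose (Qh (Suc k))"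
  "Uh (Suc k) = Ph (Suc k) ** Dh (Suc k)" "Vh (Suc k) = Pb k ** Qh (Suc k) ** Dh (Suc k)"
  "Xh (Suc k) = Uh (Suc k) ** transpose (Vh (Suc k))"
  using run unfolding alt_min_run_def by blast+

lemma step_V:
  "V (Suc k) \<in> argmin_set (\<lambda>W. majorant f gradf Lf \<theta> lam \<mu>
                                      (Uh (Suc k)) W (Uh (Suc k)) (Vh (Suc k))
                                    + ereal (\<gamma>2 k / 2 * (norm (W - Vh (Suc k)))\<^sup>2))"
  "orthonormal_columns (Pb (Suc k))" "orthogonal_matrix (Qb (Suc k))" "nonneg_diagonal (Db (Suc k))"
  "Db (Suc k) ** Db (Suc k) = rdiag (sing_val (V (Suc k) ** Dh (Suc k)))"
  "V (Suc k) ** Dh (Suc k) = Pb (Suc k) ** (Db (Suc k) ** Db (Suc k)) ** transpose (Qb (Suc k))"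
  "Ub (Suc k) = Ph (Suc k) ** Qb (Suc k) ** Db (Suc k)" "Vb (Suc k) = Pb (Suc k) ** Db (Suc k)"
  "Xb (Suc k) = Ub (Suc k) ** transpose (Vb (Suc k))"
  using run unfolding alt_min_run_def by blast+

lemma \<gamma>_lower: "\<gamma>low1 \<le> \<gamma>1 (Suc k)" "\<gamma>low2 \<le> \<gamma>2 (Suc k)"
  by (simp_all add: params)

lemma \<gamma>_pos: "0 < \<gamma>1 k" "0 < \<gamma>2 k"
  using params(3-6) \<gamma>_lower by (cases k; force intro: less_le_trans)+

lemma \<gamma>_upper: "\<gamma>1 k \<le> max \<gamma>low1 (\<gamma>1 0)" "\<gamma>2 k \<le> max \<gamma>low2 (\<gamma>2 0)"
proof -
  have "\<rho> * x \<le> x" if "0 < x" for x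
    using that params(2) mult_right_mono[of \<rho> 1 x] by simp
  then have le: "\<rho> * \<gamma>1 k \<le> \<gamma>1 k" "\<rho> * \<gamma>2 k \<le> \<gamma>2 k" for k using \<gamma>_pos by auto
  show "\<gamma>1 k \<le> max \<gamma>low1 (\<gamma>1 0)"
  proof (induction k)
    case (Suc k)
    then show ?case using le(1)[of k] by (simp add: params)
  qed simp
  show "\<gamma>2 k \<le> max \<gamma>low2 (\<gamma>2 0)"
  proof (induction k)
    case (Suc k)
    then show ?case using le(2)[of k] by (simp add: params)
  qed simp
qed

lemma orthonormal_Pb: "orthonormal_columns (Pb k)"
  using start(1) step_V(2) by (cases k) auto

lemma orthonormal_Ph: "orthonormal_columns (Ph k)"
  using start(2) step_U(2) by (cases k) auto

text \<open>After each half step both factors carry the same diagonal matrix.\<close>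

lemma balanced_hat: "balanced (Ph (Suc k)) (Pb k ** Qh (Suc k)) (Dh (Suc k))"
  by (rule balancedI_rdiag[OF step_U(2) orthonormal_columns_mult[OF orthonormal_Pb
        orthogonal_imp_orthonormal[OF step_U(3)]] step_U(4,5)])

lemma balanced_bar: "balanced (Ph k ** Qb k) (Pb k) (Db k)"
proof (cases k)
  case 0
  have "nonneg_diagonal (mat 1 :: ('r, 'r) rmat)" "(mat 1 :: ('r, 'r) rmat) $ j $ j = 1" for j
    by (auto simp: nonneg_diagonal_def mat_def)
  then show ?thesis unfolding 0 using start by (simp add: balanced_def)
next
  case (Suc l)
  show ?thesis
    unfolding Suc
    by (rule balancedI_rdiag[OF orthonormal_columns_mult[OF orthonormal_Ph
          orthogonal_imp_orthonormal[OF step_V(3)]] step_V(2,4,5)])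
qed

lemma bar_eq: "Ub k = Ph k ** Qb k ** Db k" "Vb k = Pb k ** Db k" "Xb k = Ub k ** transpose (Vb k)"
proof -
  have "Ub k = Ph k ** Qb k ** Db k \<and> Vb k = Pb k ** Db k \<and> Xb k = Ub k ** transpose (Vb k)"
  proof (cases k)
    case 0
    show ?thesis unfolding 0 using start by simp
  next
    case (Suc l)
    show ?thesis unfolding Suc using step_V(7-9)[of l] by blast
  qed
  then show "Ub k = Ph k ** Qb k ** Db k" "Vb k = Pb k ** Db k" "Xb k = Ub k ** transpose (Vb k)"
    by blast+
qed

text \<open>Rebalancing keeps the product, so each update of \<open>X\<close> is also the product of the subproblem solution
  with the factor that was held fixed.\<close>

lemma Xh_eq: "Xh (Suc k) = U (Suc k) ** transpose (Vb k)"
proof -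
  have D: "transpose (Dh (Suc k)) = Dh (Suc k)" "transpose (Db k) = Db k"
    using balanced_hat balanced_bar by (auto simp: balanced_def transpose_nonneg_diagonal)
  have "U (Suc k) ** transpose (Vb k) = U (Suc k) ** Db k ** transpose (Pb k)"
    by (simp add: bar_eq(2) matrix_transpose_mul D matrix_mul_assoc)
  also have "\<dots> = Xh (Suc k)"
    unfolding step_U(6) by (simp add: step_U(7-9) matrix_transpose_mul D matrix_mul_assoc)
  finally show ?thesis by simp
qed

lemma Xb_eq: "Xb (Suc k) = Uh (Suc k) ** transpose (V (Suc k))"
proof -
  have D: "transpose (Dh (Suc k)) = Dh (Suc k)" "transpose (Db (Suc k)) = Db (Suc k)"
    using balanced_hat balanced_bar by (auto simp: balanced_def transpose_nonneg_diagonal)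
  have "Uh (Suc k) ** transpose (V (Suc k)) = Ph (Suc k) ** transpose (V (Suc k) ** Dh (Suc k))"
    by (simp add: step_U(7) matrix_transpose_mul D matrix_mul_assoc)
  also have "\<dots> = Xb (Suc k)"
    unfolding step_V(6) by (simp add: step_V(7-9) matrix_transpose_mul D matrix_mul_assoc)
  finally show ?thesis by simp
qed

lemma solves_U: "solves_subproblem \<theta> lam \<mu> Lf (\<gamma>1 k) (gradf (Xb k)) (Vb k) (Ub k) (U (Suc k))"
  using argmin_majorant_left[OF \<theta> step_U(1)[of k]] by (simp add: bar_eq(3))

lemma solves_V: "solves_subproblem \<theta> lam \<mu> Lf (\<gamma>2 k) (transpose (gradf (Xh (Suc k)))) (Uh (Suc k))
    (Vh (Suc k)) (V (Suc k))"
  using argmin_majorant_right[OF \<theta> step_V(1)[of k]] by (simp add: step_U(9))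

lemma span_U:
  assumes "nonzero_columns (U (Suc k)) \<subseteq> nonzero_columns (Vb k)"
  shows "span (columns (U (Suc k))) = span (columns (Uh (Suc k)))"
  unfolding step_U(7)
proof (rule span_columns_eq_of_svd[OF _ step_U(4,3,6)])
  show "nonneg_diagonal (Db k)" using balanced_bar by (simp add: balanced_def)
  fix j assume "Db k $ j $ j = 0"
  then have "column j (Vb k) = 0"
    by (simp add: bar_eq(2) balanced_column(3)[OF balanced_swap[OF balanced_bar]])
  then show "column j (U (Suc k)) = 0" using assms by (auto simp: nonzero_columns_def)
qed

lemma span_V:
  assumes "nonzero_columns (V (Suc k)) \<subseteq> nonzero_columns (Uh (Suc k))"
  shows "span (columns (V (Suc k))) = span (columns (Vb (Suc k)))"
  unfolding step_V(8)
proof (rule span_columns_eq_of_svd[OF step_U(4) step_V(4,3,6)])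
  fix j assume "Dh (Suc k) $ j $ j = 0"
  then have "column j (Uh (Suc k)) = 0"
    by (simp add: step_U(7) balanced_column(3)[OF balanced_hat])
  then show "column j (V (Suc k)) = 0" using assms by (auto simp: nonzero_columns_def)
qed

text \<open>The decrease achieved by the subproblem is kept by the subsequent rebalancing.\<close>

lemma decrease_U: "\<Phi> (Uh (Suc k), Vh (Suc k)) + \<gamma>1 k / 2 * (norm (U (Suc k) - Ub k))\<^sup>2 \<le> \<Phi> (Ub k, Vb k)"
proof -
  have "U (Suc k) ** transpose (Vb k) = Ph (Suc k) ** Dh (Suc k) ** transpose (Pb k ** Qh (Suc k) ** Dh (Suc k))"
    using Xh_eq[of k] by (simp add: step_U(7-9))
  then have "\<Phi> (Uh (Suc k), Vh (Suc k)) \<le> \<Phi> (U (Suc k), Vb k)"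
    unfolding step_U(7,8) by (rule balanced_objective_le[OF card \<theta> opt lam \<mu> balanced_hat])
  then show ?thesis
    using solves_subproblem_decrease_left[OF grad lip, of \<theta> lam \<mu> "\<gamma>1 k" "Ub k" "Vb k" "U (Suc k)"]
      solves_U[of k] by (simp add: bar_eq(3))
qed

lemma decrease_V:
  "\<Phi> (Ub (Suc k), Vb (Suc k)) + \<gamma>2 k / 2 * (norm (V (Suc k) - Vh (Suc k)))\<^sup>2 \<le> \<Phi> (Uh (Suc k), Vh (Suc k))"
proof -
  have "Uh (Suc k) ** transpose (V (Suc k))
      = Ph (Suc k) ** Qb (Suc k) ** Db (Suc k) ** transpose (Pb (Suc k) ** Db (Suc k))"
    using Xb_eq[of k] by (simp add: step_V(7-9))
  then have "\<Phi> (Ub (Suc k), Vb (Suc k)) \<le> \<Phi> (Uh (Suc k), V (Suc k))"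
    unfolding step_V(7,8) by (rule balanced_objective_le[OF card \<theta> opt lam \<mu> balanced_bar])
  then show ?thesis
    using solves_subproblem_decrease_right[OF grad lip, of \<theta> lam \<mu> "\<gamma>2 k" "Uh (Suc k)" "Vh (Suc k)" "V (Suc k)"]
      solves_V[of k] by (simp add: step_U(9))
qed

definition step_size :: "nat \<Rightarrow> real" where
  "step_size k = norm (U (Suc k) - Ub k) + norm (V (Suc k) - Vh (Suc k))"

lemma step_size_nonneg: "0 \<le> step_size k"
  by (simp add: step_size_def)

text \<open>The proximal terms contribute half of their parameters, and another factor \<open>1/2\<close> comes from
  \<open>(x + y)\<^sup>2 \<le> 2 (x\<^sup>2 + y\<^sup>2)\<close>.\<close>

definition decrease_rate :: real where
  "decrease_rate = min \<gamma>low1 \<gamma>low2 / 4"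

lemma decrease_rate_pos: "0 < decrease_rate"
  using params by (simp add: decrease_rate_def)

lemma sufficient_decrease:
  assumes "1 \<le> k"
  shows "\<Phi> (Ub (Suc k), Vb (Suc k)) + decrease_rate * (step_size k)\<^sup>2 \<le> \<Phi> (Ub k, Vb k)"
proof -
  obtain l where k: "k = Suc l" using assms by (cases k) auto
  let ?x = "norm (U (Suc k) - Ub k)" and ?y = "norm (V (Suc k) - Vh (Suc k))"
  have "(step_size k)\<^sup>2 \<le> 2 * (?x\<^sup>2 + ?y\<^sup>2)"
    using zero_le_power2[of "?x - ?y"] by (simp add: step_size_def power2_eq_square algebra_simps)
  then have "decrease_rate * (step_size k)\<^sup>2 \<le> decrease_rate * (2 * (?x\<^sup>2 + ?y\<^sup>2))"
    using decrease_rate_pos by (intro mult_left_mono) auto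
  also have "\<dots> = (2 * decrease_rate) * ?x\<^sup>2 + (2 * decrease_rate) * ?y\<^sup>2"
    by (simp add: algebra_simps)
  also have "\<dots> \<le> \<gamma>1 k / 2 * ?x\<^sup>2 + \<gamma>2 k / 2 * ?y\<^sup>2"
    using \<gamma>_lower[of l] by (intro add_mono mult_right_mono) (auto simp: k decrease_rate_def)
  finally show ?thesis using decrease_U[of k] decrease_V[of k] by linarith
qed

lemma objective_antimono: "\<Phi> (Ub (Suc k), Vb (Suc k)) \<le> \<Phi> (Ub k, Vb k)"
  "\<Phi> (Uh (Suc k), Vh (Suc k)) \<le> \<Phi> (Ub k, Vb k)"
proof -
  have "0 \<le> \<gamma>1 k / 2 * (norm (U (Suc k) - Ub k))\<^sup>2" "0 \<le> \<gamma>2 k / 2 * (norm (V (Suc k) - Vh (Suc k)))\<^sup>2"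
    using \<gamma>_pos[of k] by auto
  then show "\<Phi> (Ub (Suc k), Vb (Suc k)) \<le> \<Phi> (Ub k, Vb k)" "\<Phi> (Uh (Suc k), Vh (Suc k)) \<le> \<Phi> (Ub k, Vb k)"
    using decrease_U[of k] decrease_V[of k] by linarith+
qed

lemma objective_decseq: "decseq (\<lambda>k. \<Phi> (Ub k, Vb k))"
  by (rule decseq_SucI) (rule objective_antimono(1))

lemma objective_coercive:
  obtains m where "\<And>A B. m + \<mu> / 2 * ((norm A)\<^sup>2 + (norm B)\<^sup>2) \<le> \<Phi> (A, B)"
proof -
  obtain m where m: "\<And>X. m \<le> f X" using f_bdd by (auto simp: bdd_below_def)
  have "m + \<mu> / 2 * ((norm A)\<^sup>2 + (norm B)\<^sup>2) \<le> \<Phi> (A, B)" for A B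
    using m[of "A ** transpose B"] total_penalty_nonneg[OF \<theta>, of A] total_penalty_nonneg[OF \<theta>, of B] lam
    by (simp add: real_objective_def add_increasing2)
  then show thesis by (rule that)
qed

lemma iterates_bounded:
  obtains R where "0 \<le> R" "\<And>k. norm (Ub k) \<le> R" "\<And>k. norm (Vb k) \<le> R"
    "\<And>k. norm (Uh (Suc k)) \<le> R" "\<And>k. norm (Vh (Suc k)) \<le> R"
proof -
  obtain m where m: "\<And>A B. m + \<mu> / 2 * ((norm A)\<^sup>2 + (norm B)\<^sup>2) \<le> \<Phi> (A, B)"
    by (rule objective_coercive) blast
  define R where "R = sqrt (2 / \<mu> * (\<Phi> (Ub 0, Vb 0) - m))"
  have bound: "norm A \<le> R \<and> norm B \<le> R" if "\<Phi> (A, B) \<le> \<Phi> (Ub 0, Vb 0)" for A B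
  proof -
    have "\<mu> / 2 * ((norm A)\<^sup>2 + (norm B)\<^sup>2) \<le> \<Phi> (Ub 0, Vb 0) - m" using m[of A B] that by simp
    then have "(norm A)\<^sup>2 + (norm B)\<^sup>2 \<le> 2 / \<mu> * (\<Phi> (Ub 0, Vb 0) - m)"
      using \<mu> by (simp add: field_simps)
    then have "(norm A)\<^sup>2 \<le> 2 / \<mu> * (\<Phi> (Ub 0, Vb 0) - m)" "(norm B)\<^sup>2 \<le> 2 / \<mu> * (\<Phi> (Ub 0, Vb 0) - m)"
      using zero_le_power2[of "norm A"] zero_le_power2[of "norm B"] by linarith+
    then show ?thesis unfolding R_def by (simp add: real_le_rsqrt)
  qed
  have le: "\<Phi> (Ub k, Vb k) \<le> \<Phi> (Ub 0, Vb 0)" for k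
    using objective_decseq by (auto simp: decseq_def)
  have R: "0 \<le> R" using bound[OF le[of 0]] norm_ge_zero order_trans by blast
  show thesis
    by (rule that[OF R]) (use bound le objective_antimono(2) order_trans in blast)+
qed

lemma step_size_tendsto_zero: "step_size \<longlonglongrightarrow> 0"
proof -
  obtain m where m: "\<And>A B. m + \<mu> / 2 * ((norm A)\<^sup>2 + (norm B)\<^sup>2) \<le> \<Phi> (A, B)"
    by (rule objective_coercive) blast
  have "m \<le> \<Phi> (Ub k, Vb k)" for k
  proof -
    have "0 \<le> \<mu> / 2 * ((norm (Ub k))\<^sup>2 + (norm (Vb k))\<^sup>2)" using \<mu> by simp
    then show ?thesis using m[of "Ub k" "Vb k"] by linarith
  qed
  then obtain \<Phi>' where lim: "(\<lambda>k. \<Phi> (Ub k, Vb k)) \<longlonglongrightarrow> \<Phi>'"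
    using decseq_convergent[OF objective_decseq] by metis
  have "(\<lambda>k. (\<Phi> (Ub k, Vb k) - \<Phi> (Ub (Suc k), Vb (Suc k))) / decrease_rate) \<longlonglongrightarrow> (\<Phi>' - \<Phi>') / decrease_rate"
    using decrease_rate_pos by (intro tendsto_divide tendsto_diff lim LIMSEQ_Suc[OF lim] tendsto_const) auto
  then have up: "(\<lambda>k. (\<Phi> (Ub k, Vb k) - \<Phi> (Ub (Suc k), Vb (Suc k))) / decrease_rate) \<longlonglongrightarrow> 0" by simp
  have "(\<lambda>k. (step_size k)\<^sup>2) \<longlonglongrightarrow> 0"
  proof (rule tendsto_sandwich[OF _ _ tendsto_const up])
    show "\<forall>\<^sub>F k in sequentially. (step_size k)\<^sup>2 \<le> (\<Phi> (Ub k, Vb k) - \<Phi> (Ub (Suc k), Vb (Suc k))) / decrease_rate"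
      using eventually_ge_at_top[of 1]
    proof eventually_elim
      case (elim k)
      then show ?case using sufficient_decrease[OF elim] decrease_rate_pos by (simp add: field_simps)
    qed
  qed simp
  from tendsto_real_sqrt[OF this] show ?thesis by (simp add: step_size_nonneg)
qed

lemma factor_steps_tendsto_zero:
  "(\<lambda>k. U (Suc k) - Ub k) \<longlonglongrightarrow> 0" "(\<lambda>k. V (Suc k) - Vh (Suc k)) \<longlonglongrightarrow> 0"
  by (rule Lim_null_comparison[OF _ step_size_tendsto_zero], simp add: step_size_def)+

text \<open>Each half step changes the product through one factor only, while the other one is bounded.\<close>

lemma product_steps_bound:
  obtains M where "0 < M" "\<And>k. norm (Xh (Suc k) - Xb k) \<le> M * step_size k"
    "\<And>k. norm (Xb (Suc k) - Xh (Suc k)) \<le> M * step_size k"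
proof -
  obtain R where R: "0 \<le> R" "\<And>k. norm (Vb k) \<le> R" "\<And>k. norm (Uh (Suc k)) \<le> R"
    by (rule iterates_bounded) blast
  obtain K1 where K1: "0 < K1" "\<And>(A :: ('n, 'r) rmat) (B :: ('r, 'm) rmat). norm (A ** B) \<le> norm A * norm B * K1"
    using bounded_bilinear.pos_bounded[OF bounded_bilinear_matrix_mult] by blast
  define M where "M = R * K1 + 1"
  have M: "0 < M" using R(1) K1(1) by (simp add: M_def add_nonneg_pos)
  have b1: "norm (Xh (Suc k) - Xb k) \<le> M * step_size k" for k
  proof -
    have "norm (Xh (Suc k) - Xb k) = norm ((U (Suc k) - Ub k) ** transpose (Vb k))"
      by (simp add: Xh_eq bar_eq(3) matrix_mult_diff_left)
    also have "\<dots> \<le> norm (U (Suc k) - Ub k) * norm (Vb k) * K1"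
      using K1(2)[of "U (Suc k) - Ub k" "transpose (Vb k)"] by (simp add: norm_transpose)
    also have "\<dots> \<le> step_size k * R * K1"
      using R K1(1) by (intro mult_right_mono mult_mono) (auto simp: step_size_def)
    also have "\<dots> \<le> M * step_size k"
      using step_size_nonneg[of k] by (simp add: M_def algebra_simps)
    finally show ?thesis .
  qed
  have b2: "norm (Xb (Suc k) - Xh (Suc k)) \<le> M * step_size k" for k
  proof -
    have "Xb (Suc k) - Xh (Suc k) = Uh (Suc k) ** transpose (V (Suc k) - Vh (Suc k))"
      by (simp add: Xb_eq step_U(9) transpose_diff matrix_mult_diff_right)
    then have "norm (Xb (Suc k) - Xh (Suc k)) \<le> norm (Uh (Suc k)) * norm (V (Suc k) - Vh (Suc k)) * K1"
      using K1(2)[of "Uh (Suc k)" "transpose (V (Suc k) - Vh (Suc k))"] by (simp add: norm_transpose)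
    also have "\<dots> \<le> R * step_size k * K1"
      using R K1(1) by (intro mult_right_mono mult_mono) (auto simp: step_size_def)
    also have "\<dots> \<le> M * step_size k"
      using step_size_nonneg[of k] by (simp add: M_def algebra_simps)
    finally show ?thesis .
  qed
  show thesis by (rule that[OF M b1 b2])
qed

end

section \<open>Stable supports and cluster points\<close>

locale stable_alternating_minimization =
  alternating_minimization f gradf \<theta> Lf lam \<mu> \<rho> \<gamma>low1 \<gamma>low2 \<gamma>1 \<gamma>2 U Uh Ub Ph V Vh Vb Pb Xh Xb Dh Qh Db Qb
  for f :: "('n::{finite,linorder}, 'm::{finite,linorder}) rmat \<Rightarrow> real"
    and gradf :: "('n, 'm) rmat \<Rightarrow> ('n, 'm) rmat"
    and \<theta> :: "real \<Rightarrow> ereal"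
    and Lf lam \<mu> \<rho> \<gamma>low1 \<gamma>low2 :: real
    and \<gamma>1 \<gamma>2 :: "nat \<Rightarrow> real"
    and U Uh Ub Ph :: "nat \<Rightarrow> ('n, 'r::{finite,linorder}) rmat"
    and V Vh Vb Pb :: "nat \<Rightarrow> ('m, 'r) rmat"
    and Xh Xb :: "nat \<Rightarrow> ('n, 'm) rmat"
    and Dh Qh Db Qb :: "nat \<Rightarrow> ('r, 'r) rmat" +
  fixes \<beta> :: real and kbar :: nat
  assumes \<beta>: "0 < \<beta>"
    and curv_bar: "\<And>k i. (scaling_matrix Lf \<mu> (Db k) (\<gamma>1 k) $ i $ i)\<^sup>2 \<le> \<beta>"
    and curv_hat: "\<And>k i. (scaling_matrix Lf \<mu> (Dh (Suc k)) (\<gamma>2 k) $ i $ i)\<^sup>2 \<le> \<beta>"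
    and gap: "\<And>\<gamma>. \<gamma> \<in> {lam / \<beta> .. lam / (\<mu> + min \<gamma>low1 \<gamma>low2)} \<Longrightarrow> prox_gap \<theta> \<gamma>"
    and supp: "stable_support_index U V Uh Vh Xh Ub Vb Xb kbar"
begin

lemma supports:
  assumes "kbar \<le> k"
  shows "nonzero_columns (V k) = nonzero_columns (Ub k)" "nonzero_columns (U k) = nonzero_columns (Ub k)"
    "nonzero_columns (Uh k) = nonzero_columns (Ub k)" "nonzero_columns (Vh k) = nonzero_columns (Ub k)"
    "nonzero_columns (Vb k) = nonzero_columns (Ub k)" "nonzero_columns (Ub (Suc k)) = nonzero_columns (Ub k)"
proof -
  have "nonzero_columns (V k) = nonzero_columns (U k) \<and>
        nonzero_columns (U k) = nonzero_columns (Uh k) \<and>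
        nonzero_columns (Uh k) = nonzero_columns (Vh k) \<and>
        nonzero_columns (Vh k) = nonzero_columns (Vb k) \<and>
        nonzero_columns (Vb k) = nonzero_columns (Ub k) \<and>
        nonzero_columns (Ub k) = nonzero_columns (Ub (Suc k))"
    using supp assms unfolding stable_support_index_def by blast
  then show "nonzero_columns (V k) = nonzero_columns (Ub k)" "nonzero_columns (U k) = nonzero_columns (Ub k)"
    "nonzero_columns (Uh k) = nonzero_columns (Ub k)" "nonzero_columns (Vh k) = nonzero_columns (Ub k)"
    "nonzero_columns (Vb k) = nonzero_columns (Ub k)" "nonzero_columns (Ub (Suc k)) = nonzero_columns (Ub k)"
    by simp_all
qed

text \<open>The squared scaling matrices are the curvatures of the subproblems along their columns, because the
  columns of the fixed factor have the diagonal entries as norms.\<close>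

lemma curvature:
  "Lf * (norm (column j (Vb k)))\<^sup>2 + \<mu> + \<gamma>1 k \<le> \<beta>"
  "Lf * (norm (column j (Uh (Suc k))))\<^sup>2 + \<mu> + \<gamma>2 k \<le> \<beta>"
proof -
  have "0 \<le> Lf * x\<^sup>2 + (\<mu> + \<gamma>1 k)" "0 \<le> Lf * x\<^sup>2 + (\<mu> + \<gamma>2 k)" for x
    using Lf_nonneg \<mu> \<gamma>_pos[of k] by (auto intro!: add_nonneg_nonneg mult_nonneg_nonneg)
  then show "Lf * (norm (column j (Vb k)))\<^sup>2 + \<mu> + \<gamma>1 k \<le> \<beta>"
    "Lf * (norm (column j (Uh (Suc k))))\<^sup>2 + \<mu> + \<gamma>2 k \<le> \<beta>"
    using curv_bar[of k j] curv_hat[of k j]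
    by (simp_all add: scaling_matrix_def bar_eq(2) step_U(7) balanced_column(2)[OF balanced_hat]
        balanced_column(2)[OF balanced_swap[OF balanced_bar]] add.assoc)
qed

lemma subproblem_column_gap:
  obtains c where "0 < c" "\<And>k. column_gap c (U (Suc k))" "\<And>k. column_gap c (V (Suc k))"
proof -
  have "0 \<le> Lf * (norm (column undefined (Vb 1)))\<^sup>2" using Lf_nonneg by simp
  then have le: "\<mu> + min \<gamma>low1 \<gamma>low2 \<le> \<beta>"
    using curvature(1)[of undefined 1] \<gamma>_lower(1)[of 0] min.cobounded1[of \<gamma>low1 \<gamma>low2]
    by (simp only: One_nat_def)
  moreover have "0 < \<mu> + min \<gamma>low1 \<gamma>low2" using \<mu> params by simp
  ultimately have "lam / \<beta> \<le> lam / (\<mu> + min \<gamma>low1 \<gamma>low2)"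
    using lam by (intro divide_left_mono mult_pos_pos) auto
  then have pg: "prox_gap \<theta> (lam / \<beta>)" by (intro gap) auto
  obtain c1 where c1: "0 < c1" "\<And>g H B C A. solves_subproblem \<theta> lam \<mu> Lf g (H :: ('m, 'n) rmat)
        (B :: ('n, 'r) rmat) C A \<Longrightarrow>
      (\<And>j. Lf * (norm (column j B))\<^sup>2 + \<mu> + g \<le> \<beta>) \<Longrightarrow> column_gap c1 A"
    by (rule solves_subproblem_column_gap[OF \<theta> lam \<beta> pg, of \<mu> Lf]) blast
  obtain c2 where c2: "0 < c2" "\<And>g H B C A. solves_subproblem \<theta> lam \<mu> Lf g (H :: ('n, 'm) rmat)
        (B :: ('m, 'r) rmat) C A \<Longrightarrow>
      (\<And>j. Lf * (norm (column j B))\<^sup>2 + \<mu> + g \<le> \<beta>) \<Longrightarrow> column_gap c2 A"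
    by (rule solves_subproblem_column_gap[OF \<theta> lam \<beta> pg, of \<mu> Lf]) blast
  have "column_gap c2 (U (Suc k))" "column_gap c1 (V (Suc k))" for k
    using c2(2)[OF solves_U curvature(1)] c1(2)[OF solves_V curvature(2)] by auto
  then have "column_gap (min c1 c2) (U (Suc k))" "column_gap (min c1 c2) (V (Suc k))" for k
    by (meson column_gap_mono min.cobounded1 min.cobounded2)+
  then show thesis
    using c1(1) c2(1) by (intro that[of "min c1 c2"]) auto
qed

text \<open>A solution of a subproblem and its proximal centre have the same support eventually, and their
  distance tends to 0; so the centre inherits half of the gap. Its partner has the same column
  norms.\<close>

lemma eventually_column_gap:
  obtains c where "0 < c" "\<forall>\<^sub>F k in sequentially. column_gap c (Ub k) \<and> column_gap c (Vb k)"
    "\<forall>\<^sub>F k in sequentially. column_gap c (Uh (Suc k)) \<and> column_gap c (Vh (Suc k))"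
    "\<And>k. column_gap c (U (Suc k))" "\<And>k. column_gap c (V (Suc k))"
proof -
  obtain c where c: "0 < c" "\<And>k. column_gap c (U (Suc k))" "\<And>k. column_gap c (V (Suc k))"
    by (rule subproblem_column_gap) blast
  have small: "\<forall>\<^sub>F k in sequentially. step_size k < c / 2"
    using step_size_tendsto_zero c(1) by (intro order_tendstoD(2)) auto
  have "\<forall>\<^sub>F k in sequentially. kbar \<le> k" by (rule eventually_ge_at_top)
  with small have bar: "\<forall>\<^sub>F k in sequentially. column_gap (c / 2) (Ub k) \<and> column_gap (c / 2) (Vb k)"
  proof eventually_elim
    case (elim k)
    have "norm (U (Suc k) - Ub k) \<le> step_size k" by (simp add: step_size_def)
    then have "norm (U (Suc k) - Ub k) < c / 2" using elim(1) by linarith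
    moreover have "nonzero_columns (U (Suc k)) = nonzero_columns (Ub k)"
      using supports(2)[of "Suc k"] supports(6)[OF elim(2)] elim(2) by simp
    ultimately have "column_gap (c / 2) (Ub k)" by (rule column_gap_perturb[OF c(2)])
    then show ?case
      unfolding bar_eq(1,2) balanced_column_gap[OF balanced_bar]
        balanced_column_gap[OF balanced_swap[OF balanced_bar]] by blast
  qed
  have "\<forall>\<^sub>F k in sequentially. kbar \<le> k" by (rule eventually_ge_at_top)
  with small have hat: "\<forall>\<^sub>F k in sequentially. column_gap (c / 2) (Uh (Suc k)) \<and> column_gap (c / 2) (Vh (Suc k))"
  proof eventually_elim
    case (elim k)
    have "norm (V (Suc k) - Vh (Suc k)) \<le> step_size k" by (simp add: step_size_def)
    then have "norm (V (Suc k) - Vh (Suc k)) < c / 2" using elim(1) by linarith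
    moreover have "nonzero_columns (V (Suc k)) = nonzero_columns (Vh (Suc k))"
      using supports(1,4)[of "Suc k"] elim(2) by simp
    ultimately have "column_gap (c / 2) (Vh (Suc k))" by (rule column_gap_perturb[OF c(3)])
    then show ?case
      unfolding step_U(7,8) balanced_column_gap[OF balanced_hat]
        balanced_column_gap[OF balanced_swap[OF balanced_hat]] by blast
  qed
  have "column_gap (c / 2) (U (Suc k))" "column_gap (c / 2) (V (Suc k))" for k
    using c(1) by (auto intro: column_gap_mono[OF c(2)] column_gap_mono[OF c(3)])
  with c(1) bar hat show thesis by (intro that[of "c / 2"]) auto
qed

lemma gradf_tendsto:
  assumes "X \<longlonglongrightarrow> X'"
  shows "(\<lambda>n. gradf (X n)) \<longlonglongrightarrow> gradf X'"
proof -
  have "isCont gradf X'"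
    using lipschitz_on_continuous_on[OF lip] continuous_on_eq_continuous_at[OF open_UNIV] by blast
  then show ?thesis by (rule isCont_tendsto_compose[OF _ assms])
qed

definition stationary_product :: "('n, 'm) rmat \<Rightarrow> bool" where
  "stationary_product X \<longleftrightarrow> (\<forall>(P :: ('n, 'r) rmat) (Q :: ('m, 'r) rmat) D.
     balanced P Q D \<longrightarrow> P ** D ** transpose (Q ** D) = X \<longrightarrow>
     0 \<in> regular_subdiff (objective f \<theta> lam \<mu>) (P ** D, Q ** D))"

text \<open>The first subproblem yields the first-order condition in \<open>U\<close> at a limit of the barred factors,
  the second one the condition in \<open>V\<close> at a limit of the hatted factors. Both limits factorize the same
  matrix, so both conditions carry over to every balanced factorization of it.\<close>

lemma cluster_stationary:
  assumes s: "strict_mono s" "(\<lambda>n. Ub (s n)) \<longlonglongrightarrow> U'" "(\<lambda>n. Vb (s n)) \<longlonglongrightarrow> V'"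
  obtains P1 Q1 D1 where "balanced P1 Q1 D1" "U' = P1 ** D1" "V' = Q1 ** D1"
    "stationary_product (U' ** transpose V')"
proof -
  obtain R where R: "\<And>k. norm (Ub k) \<le> R" "\<And>k. norm (Uh (Suc k)) \<le> R"
    by (rule iterates_bounded) blast
  obtain r1 P1 Q1 D1 where r1: "strict_mono r1" "(\<lambda>n. (Ph (s (r1 n)) ** Qb (s (r1 n)))) \<longlonglongrightarrow> P1"
      "(\<lambda>n. Pb (s (r1 n))) \<longlonglongrightarrow> Q1" "(\<lambda>n. Db (s (r1 n))) \<longlonglongrightarrow> D1" and bal1: "balanced P1 Q1 D1"
    by (rule balanced_subsequence[of "\<lambda>n. Ph (s n) ** Qb (s n)" "\<lambda>n. Pb (s n)" "\<lambda>n. Db (s n)" R])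
       (use balanced_bar R(1) bar_eq(1) in auto)
  define s1 where "s1 n = s (r1 n)" for n
  have s1: "strict_mono s1" using s(1) r1(1) by (simp add: s1_def strict_mono_def)
  \<comment> \<open>The hatted factors are taken one half step later, where their product has the same limit.\<close>
  obtain r2 P2 Q2 D2 where r2: "strict_mono r2" "(\<lambda>n. Ph (Suc (s1 (r2 n)))) \<longlonglongrightarrow> P2"
      "(\<lambda>n. Pb (s1 (r2 n)) ** Qh (Suc (s1 (r2 n)))) \<longlonglongrightarrow> Q2" "(\<lambda>n. Dh (Suc (s1 (r2 n)))) \<longlonglongrightarrow> D2"
      and bal2: "balanced P2 Q2 D2"
    by (rule balanced_subsequence[of "\<lambda>n. Ph (Suc (s1 n))" "\<lambda>n. Pb (s1 n) ** Qh (Suc (s1 n))"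
          "\<lambda>n. Dh (Suc (s1 n))" R])
       (use balanced_hat R(2) step_U(7) in auto)
  have "norm (\<gamma>1 k, \<gamma>2 k) \<le> max \<gamma>low1 (\<gamma>1 0) + max \<gamma>low2 (\<gamma>2 0)" for k
    using norm_Pair_le[of "\<gamma>1 k" "\<gamma>2 k"] \<gamma>_pos[of k] \<gamma>_upper[of k] by simp
  then have "bounded (range (\<lambda>n. (\<gamma>1 (s1 (r2 n)), \<gamma>2 (s1 (r2 n)))))" unfolding bounded_iff by blast
  then obtain g r3 where r3: "strict_mono r3" "((\<lambda>n. (\<gamma>1 (s1 (r2 n)), \<gamma>2 (s1 (r2 n)))) \<circ> r3) \<longlonglongrightarrow> g"
    by (blast dest: bounded_imp_convergent_subsequence)
  define t where "t n = s1 (r2 (r3 n))" for n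
  have t: "strict_mono t" using s1 r2(1) r3(1) by (simp add: t_def strict_mono_def)
  have r12: "strict_mono (\<lambda>n. r1 (r2 (r3 n)))" and r23: "strict_mono (\<lambda>n. r2 (r3 n))"
    using r1(1) r2(1) r3(1) by (auto simp: strict_mono_def)
  have g1: "(\<lambda>n. \<gamma>1 (t n)) \<longlonglongrightarrow> fst g" using tendsto_fst[OF r3(2)] by (simp add: o_def t_def)
  have g2: "(\<lambda>n. \<gamma>2 (t n)) \<longlonglongrightarrow> snd g" using tendsto_snd[OF r3(2)] by (simp add: o_def t_def)
  have Ub: "(\<lambda>n. Ub (t n)) \<longlonglongrightarrow> U'" and Vb: "(\<lambda>n. Vb (t n)) \<longlonglongrightarrow> V'"
    using LIMSEQ_subseq_LIMSEQ[OF s(2) r12] LIMSEQ_subseq_LIMSEQ[OF s(3) r12]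
    by (simp_all add: o_def t_def s1_def)
  have U': "U' = P1 ** D1"
  proof (rule LIMSEQ_unique[OF Ub])
    show "(\<lambda>n. Ub (t n)) \<longlonglongrightarrow> P1 ** D1"
      using tendsto_matrix_mult[OF LIMSEQ_subseq_LIMSEQ[OF r1(2) r23] LIMSEQ_subseq_LIMSEQ[OF r1(4) r23]]
      by (simp add: o_def bar_eq(1) t_def s1_def)
  qed
  have V': "V' = Q1 ** D1"
  proof (rule LIMSEQ_unique[OF Vb])
    show "(\<lambda>n. Vb (t n)) \<longlonglongrightarrow> Q1 ** D1"
      using tendsto_matrix_mult[OF LIMSEQ_subseq_LIMSEQ[OF r1(3) r23] LIMSEQ_subseq_LIMSEQ[OF r1(4) r23]]
      by (simp add: o_def bar_eq(2) t_def s1_def)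
  qed
  have Uh: "(\<lambda>n. Uh (Suc (t n))) \<longlonglongrightarrow> P2 ** D2"
    using tendsto_matrix_mult[OF LIMSEQ_subseq_LIMSEQ[OF r2(2) r3(1)] LIMSEQ_subseq_LIMSEQ[OF r2(4) r3(1)]]
    by (simp add: o_def step_U(7) t_def)
  have Vh: "(\<lambda>n. Vh (Suc (t n))) \<longlonglongrightarrow> Q2 ** D2"
    using tendsto_matrix_mult[OF LIMSEQ_subseq_LIMSEQ[OF r2(3) r3(1)] LIMSEQ_subseq_LIMSEQ[OF r2(4) r3(1)]]
    by (simp add: o_def step_U(8) t_def)
  have U: "(\<lambda>n. U (Suc (t n))) \<longlonglongrightarrow> U'"
    using tendsto_add[OF LIMSEQ_subseq_LIMSEQ[OF factor_steps_tendsto_zero(1) t] Ub] by (simp add: o_def)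
  have V: "(\<lambda>n. V (Suc (t n))) \<longlonglongrightarrow> Q2 ** D2"
    using tendsto_add[OF LIMSEQ_subseq_LIMSEQ[OF factor_steps_tendsto_zero(2) t] Vh] by (simp add: o_def)
  define X where "X = U' ** transpose V'"
  define G where "G = gradf X"
  have Xb: "(\<lambda>n. Xb (t n)) \<longlonglongrightarrow> X"
    unfolding X_def bar_eq(3) by (intro tendsto_matrix_mult tendsto_transpose Ub Vb)
  have Xh: "(\<lambda>n. Xh (Suc (t n))) \<longlonglongrightarrow> X"
    unfolding X_def Xh_eq by (intro tendsto_matrix_mult tendsto_transpose U Vb)
  have "(\<lambda>n. Xh (Suc (t n))) \<longlonglongrightarrow> P2 ** D2 ** transpose (Q2 ** D2)"
    unfolding step_U(9) by (intro tendsto_matrix_mult tendsto_transpose Uh Vh)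
  then have X2: "P2 ** D2 ** transpose (Q2 ** D2) = X" by (rule LIMSEQ_unique[OF _ Xh])
  have X1: "P1 ** D1 ** transpose (Q1 ** D1) = X" by (simp add: X_def U' V')
  obtain c where c: "0 < c" "\<And>k. column_gap c (U (Suc k))" "\<And>k. column_gap c (V (Suc k))"
    by (rule subproblem_column_gap) blast
  have solU: "solves_subproblem \<theta> lam \<mu> Lf (fst g) G V' U' U'"
    unfolding G_def
    by (rule solves_subproblem_limit[OF solves_U g1 gradf_tendsto[OF Xb] Vb Ub U
          tendsto_total_penalty[OF \<theta> U c(1)]]) (simp add: c(2))
  have solV: "solves_subproblem \<theta> lam \<mu> Lf (snd g) (transpose G) (P2 ** D2) (Q2 ** D2) (Q2 ** D2)"
    unfolding G_def
    by (rule solves_subproblem_limit[OF solves_V g2 tendsto_transpose[OF gradf_tendsto[OF Xh]] Uh Vh V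
          tendsto_total_penalty[OF \<theta> V c(1)]]) (simp add: c(3))
  define m where "m d = - (\<mu> + lam * deriv (\<lambda>s. real_of_ereal (\<theta> s)) d / d)" for d
  have negate: "x = (- a) *\<^sub>R y" if "x + a *\<^sub>R y = 0" for x y :: "real^'k" and a
    using that by (simp add: eq_neg_iff_add_eq_0)
  have negate': "x + a *\<^sub>R y = 0" if "x = (- a) *\<^sub>R y" for x y :: "real^'k" and a
    using that by simp
  have rel1: "G *v column j (Q1 ** D1) = m (D1 $ j $ j) *\<^sub>R column j (P1 ** D1)"
    if "D1 $ j $ j \<noteq> 0" for j
    using solves_subproblem_first_order[OF \<theta> solU, of j] that
    unfolding U' V' balanced_column(2,3)[OF bal1] m_def by (intro negate) blast
  have rel2: "transpose G *v column j (P2 ** D2) = m (D2 $ j $ j) *\<^sub>R column j (Q2 ** D2)"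
    if "D2 $ j $ j \<noteq> 0" for j
    using solves_subproblem_first_order[OF \<theta> solV, of j] that
    unfolding balanced_column(2,3)[OF balanced_swap[OF bal2]] m_def by (intro negate) blast
  have stat: "0 \<in> regular_subdiff (objective f \<theta> lam \<mu>) (P ** D, Q ** D)"
    if bal: "balanced P Q D" and prod: "P ** D ** transpose (Q ** D) = U' ** transpose V'"
    for P :: "('n, 'r) rmat" and Q :: "('m, 'r) rmat" and D
  proof (rule zero_in_regular_subdiff_objective[OF \<theta> lam])
    show "GDERIV f (P ** D ** transpose (Q ** D)) :> G"
      unfolding G_def X_def prod by (rule grad)
    note colP = balanced_column(2,3)[OF bal] and colQ = balanced_column(2,3)[OF balanced_swap[OF bal]]
    show "column j (P ** D) = 0 \<longleftrightarrow> column j (Q ** D) = 0" for j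
      unfolding colP colQ ..
    fix j
    show "G *v column j (Q ** D) + (\<mu> + lam * deriv (\<lambda>s. real_of_ereal (\<theta> s)) (norm (column j (P ** D)))
        / norm (column j (P ** D))) *\<^sub>R column j (P ** D) = 0"
      if nz: "column j (P ** D) \<noteq> 0"
    proof -
      have "G *v column j (Q ** D) = m (D $ j $ j) *\<^sub>R column j (P ** D)"
        using nz unfolding colP
        by (intro balanced_eigen_relation_transfer[OF bal1 bal _ rel1]) (simp_all add: X1 X_def prod)
      then show ?thesis unfolding colP m_def by (rule negate')
    qed
    show "transpose G *v column j (P ** D) + (\<mu> + lam * deriv (\<lambda>s. real_of_ereal (\<theta> s)) (norm (column j (Q ** D)))
        / norm (column j (Q ** D))) *\<^sub>R column j (Q ** D) = 0"
      if nz: "column j (Q ** D) \<noteq> 0"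
    proof -
      have "Q2 ** D2 ** transpose (P2 ** D2) = Q ** D ** transpose (P ** D)"
        using X2 prod unfolding X_def by (metis balanced_product_transpose)
      then have "transpose G *v column j (P ** D) = m (D $ j $ j) *\<^sub>R column j (Q ** D)"
        using nz unfolding colQ
        by (intro balanced_eigen_relation_transfer[OF balanced_swap[OF bal2] balanced_swap[OF bal] _ rel2])
      then show ?thesis unfolding colQ m_def by (rule negate')
    qed
  qed
  then have "stationary_product (U' ** transpose V')" unfolding stationary_product_def by blast
  then show thesis by (rule that[OF bal1 U' V'])
qed

lemma objective_tendsto:
  assumes "strict_mono s" "(\<lambda>n. Ub (s n)) \<longlonglongrightarrow> U'" "(\<lambda>n. Vb (s n)) \<longlonglongrightarrow> V'"
  shows "(\<lambda>n. \<Phi> (Ub (s n), Vb (s n))) \<longlonglongrightarrow> \<Phi> (U', V')"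
proof -
  obtain c where c: "0 < c" "\<forall>\<^sub>F k in sequentially. column_gap c (Ub k) \<and> column_gap c (Vb k)"
    by (rule eventually_column_gap) blast
  have ev: "\<forall>\<^sub>F n in sequentially. column_gap c (Ub (s n)) \<and> column_gap c (Vb (s n))"
    by (rule eventually_subseq[OF assms(1) c(2)])
  have pU: "(\<lambda>n. total_penalty \<theta> (Ub (s n))) \<longlonglongrightarrow> total_penalty \<theta> U'"
    by (rule tendsto_total_penalty[OF \<theta> assms(2) c(1)]) (use ev in eventually_elim, blast)
  have pV: "(\<lambda>n. total_penalty \<theta> (Vb (s n))) \<longlonglongrightarrow> total_penalty \<theta> V'"
    by (rule tendsto_total_penalty[OF \<theta> assms(3) c(1)]) (use ev in eventually_elim, blast)
  have "isCont f X" for X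
    using grad[of X] has_derivative_continuous unfolding gderiv_def by blast
  then have "(\<lambda>n. f (Ub (s n) ** transpose (Vb (s n)))) \<longlonglongrightarrow> f (U' ** transpose V')"
    by (rule isCont_tendsto_compose) (intro tendsto_matrix_mult tendsto_transpose assms)
  then show ?thesis
    unfolding real_objective_def fst_conv snd_conv
    by (intro tendsto_add tendsto_mult tendsto_power tendsto_norm tendsto_const pU pV assms)
qed

section \<open>Convergence\<close>

lemma iterates_in_bounded: "bounded (range (\<lambda>k. (Ub k, Vb k)))"
proof -
  obtain R where R: "\<And>k. norm (Ub k) \<le> R" "\<And>k. norm (Vb k) \<le> R"
    by (rule iterates_bounded) blast
  have "norm (Ub k, Vb k) \<le> R + R" for k
    using norm_Pair_le[of "Ub k" "Vb k"] R[of k] by linarith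
  then show ?thesis unfolding bounded_iff by blast
qed

text \<open>The distances between consecutive products in the subgradient bound are absorbed into the step
  size, which puts the iteration into the abstract descent scheme.\<close>

lemma summable_step_size:
  assumes KL: "KL_function (objective f \<theta> lam \<mu> :: ('n, 'r) rmat \<times> ('m, 'r) rmat \<Rightarrow> ereal)"
    and cs: "0 < cs"
    and subgrad: "\<And>k. ktil \<le> k \<Longrightarrow>
           dist_zero (limiting_subdiff (objective f \<theta> lam \<mu>) (Ub (Suc k), Vb (Suc k)))
           \<le> ereal (cs * (norm (Xb (Suc k) - Xb k) + norm (Xh (Suc k) - Xb (Suc k)))
                    + cs * (norm (U (Suc k) - Ub k) + norm (V (Suc k) - Vh (Suc k))))"
  shows "summable step_size"
proof -
  obtain M where M: "0 < M" "\<And>k. norm (Xh (Suc k) - Xb k) \<le> M * step_size k"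
    "\<And>k. norm (Xb (Suc k) - Xh (Suc k)) \<le> M * step_size k"
    by (rule product_steps_bound) blast
  have obj: "objective f \<theta> lam \<mu> = (\<lambda>x. ereal (\<Phi> x))" by (rule objective_eq_real[OF \<theta>])
  show ?thesis
  proof (rule KL_descent_summable[where z = "\<lambda>k. (Ub k, Vb k)" and h = \<Phi> and K = "max 1 ktil"
        and a = decrease_rate and b = "cs * (3 * M + 1)"])
    show "bounded (range (\<lambda>k. (Ub k, Vb k)))" by (rule iterates_in_bounded)
    show "0 < decrease_rate" by (rule decrease_rate_pos)
    show "0 < cs * (3 * M + 1)" using cs M(1) by simp
    show "0 \<le> step_size k" for k by (rule step_size_nonneg)
    show "\<Phi> (Ub (Suc k), Vb (Suc k)) + decrease_rate * (step_size k)\<^sup>2 \<le> \<Phi> (Ub k, Vb k)"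
      if "max 1 ktil \<le> k" for k
      using that by (intro sufficient_decrease) simp
    show "dist_zero (limiting_subdiff (\<lambda>x. ereal (\<Phi> x)) (Ub (Suc k), Vb (Suc k)))
        \<le> ereal (cs * (3 * M + 1) * step_size k)" if k: "max 1 ktil \<le> k" for k
    proof -
      have "norm (Xb (Suc k) - Xb k) \<le> norm (Xb (Suc k) - Xh (Suc k)) + norm (Xh (Suc k) - Xb k)"
        using norm_triangle_ineq[of "Xb (Suc k) - Xh (Suc k)" "Xh (Suc k) - Xb k"] by simp
      then have "norm (Xb (Suc k) - Xb k) + norm (Xh (Suc k) - Xb (Suc k)) \<le> 3 * (M * step_size k)"
        using M(2,3)[of k] norm_minus_commute[of "Xh (Suc k)" "Xb (Suc k)"] by linarith
      then have "cs * (norm (Xb (Suc k) - Xb k) + norm (Xh (Suc k) - Xb (Suc k))) + cs * step_size k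
          \<le> cs * (3 * (M * step_size k)) + cs * step_size k"
        using cs by (intro add_right_mono mult_left_mono) auto
      also have "\<dots> = cs * (3 * M + 1) * step_size k" by (simp add: algebra_simps)
      finally have "ereal (cs * (norm (Xb (Suc k) - Xb k) + norm (Xh (Suc k) - Xb (Suc k))) + cs * step_size k)
          \<le> ereal (cs * (3 * M + 1) * step_size k)" by simp
      moreover have "ktil \<le> k" using k by simp
      ultimately show ?thesis
        using subgrad[of k] unfolding obj step_size_def by (meson order_trans)
    qed
    show "(\<lambda>n. \<Phi> (Ub (s n), Vb (s n))) \<longlonglongrightarrow> \<Phi> w \<and> KL_property (\<lambda>x. ereal (\<Phi> x)) w"
      if s: "strict_mono s" "((\<lambda>k. (Ub k, Vb k)) \<circ> s) \<longlonglongrightarrow> w" for s w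
    proof -
      obtain U' V' where w: "w = (U', V')" by (cases w) auto
      have U': "(\<lambda>n. Ub (s n)) \<longlonglongrightarrow> U'" and V': "(\<lambda>n. Vb (s n)) \<longlonglongrightarrow> V'"
        using tendsto_fst[OF s(2)] tendsto_snd[OF s(2)] by (simp_all add: o_def w)
      obtain P1 Q1 D1 where c: "balanced P1 Q1 D1" "U' = P1 ** D1" "V' = Q1 ** D1"
        "stationary_product (U' ** transpose V')"
        by (rule cluster_stationary[OF s(1) U' V']) blast
      have "0 \<in> regular_subdiff (objective f \<theta> lam \<mu>) w"
        using c(1,4) by (simp add: w c(2,3) stationary_product_def)
      then have "limiting_subdiff (objective f \<theta> lam \<mu>) w \<noteq> {}"
        using regular_subdiff_limiting by blast
      then have "KL_property (objective f \<theta> lam \<mu>) w" using KL unfolding KL_function_def by blast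
      then show ?thesis using objective_tendsto[OF s(1) U' V'] by (simp add: obj w)
    qed
  qed
qed

lemma products_converge:
  assumes "summable step_size"
  obtains Xstar where "Xb \<longlonglongrightarrow> Xstar" "Xh \<longlonglongrightarrow> Xstar"
proof -
  obtain M where M: "0 < M" "\<And>k. norm (Xh (Suc k) - Xb k) \<le> M * step_size k"
    "\<And>k. norm (Xb (Suc k) - Xh (Suc k)) \<le> M * step_size k"
    by (rule product_steps_bound) blast
  have "norm (Xb (Suc k) - Xb k) \<le> 2 * M * step_size k" for k
    using norm_triangle_ineq[of "Xb (Suc k) - Xh (Suc k)" "Xh (Suc k) - Xb k"] M(2,3)[of k] by simp
  then have "summable (\<lambda>k. Xb (Suc k) - Xb k)"
    by (intro summable_comparison_test'[OF summable_mult[OF assms, of "2 * M"]]) auto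
  then obtain S where "(\<lambda>n. \<Sum>k<n. Xb (Suc k) - Xb k) \<longlonglongrightarrow> S"
    using summable_LIMSEQ by blast
  then have "(\<lambda>n. Xb n - Xb 0) \<longlonglongrightarrow> S" by (simp only: sum_lessThan_telescope)
  from tendsto_add[OF this tendsto_const[of "Xb 0"]] have Xb: "Xb \<longlonglongrightarrow> S + Xb 0" by simp
  have "(\<lambda>k. M * step_size k) \<longlonglongrightarrow> 0"
    using tendsto_mult[OF tendsto_const[of M] step_size_tendsto_zero] by simp
  then have "(\<lambda>k. Xh (Suc k) - Xb k) \<longlonglongrightarrow> 0"
    by (rule Lim_null_comparison[rotated]) (use M(2) in auto)
  from tendsto_add[OF this Xb] have "(\<lambda>k. Xh (Suc k)) \<longlonglongrightarrow> S + Xb 0" by simp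
  then have "Xh \<longlonglongrightarrow> S + Xb 0" by (rule LIMSEQ_imp_Suc)
  with Xb show thesis by (rule that)
qed

text \<open>Any limit of a subsequence of factors is a balanced factorization of \<open>Xstar\<close>, and stationarity
  does not depend on the choice of such a factorization.\<close>

lemma limit_stationary:
  assumes lim: "Xb \<longlonglongrightarrow> Xstar" and svd: "(P, Q) \<in> svd_pairs Xstar"
  shows "stationary_point f \<theta> lam \<mu>
                (first_columns P ** sqrt_sing_diag Xstar :: ('n, 'r) rmat)
                (first_columns Q ** sqrt_sing_diag Xstar :: ('m, 'r) rmat)"
proof -
  obtain w s where s: "strict_mono s" "((\<lambda>k. (Ub k, Vb k)) \<circ> s) \<longlonglongrightarrow> w"
    using bounded_imp_convergent_subsequence[OF iterates_in_bounded] by blast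
  obtain U' V' where w: "w = (U', V')" by (cases w) auto
  have U': "(\<lambda>n. Ub (s n)) \<longlonglongrightarrow> U'" and V': "(\<lambda>n. Vb (s n)) \<longlonglongrightarrow> V'"
    using tendsto_fst[OF s(2)] tendsto_snd[OF s(2)] by (simp_all add: o_def w)
  obtain P1 Q1 D1 where c: "balanced P1 Q1 D1" "U' = P1 ** D1" "V' = Q1 ** D1"
    "stationary_product (U' ** transpose V')"
    by (rule cluster_stationary[OF s(1) U' V']) blast
  have "(\<lambda>n. Xb (s n)) \<longlonglongrightarrow> U' ** transpose V'"
    unfolding bar_eq(3) by (intro tendsto_matrix_mult tendsto_transpose U' V')
  moreover have "(\<lambda>n. Xb (s n)) \<longlonglongrightarrow> Xstar"
    using LIMSEQ_subseq_LIMSEQ[OF lim s(1)] by (simp add: o_def)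
  ultimately have X: "Xstar = U' ** transpose V'" by (rule LIMSEQ_unique[rotated])
  note bal = svd_pairs_balanced[OF card svd c(1) X[unfolded c(2,3)]]
  show ?thesis
    unfolding stationary_point_def
  proof (rule regular_subdiff_limiting, rule c(4)[unfolded stationary_product_def, rule_format, OF bal(1)])
    show "first_columns P ** sqrt_sing_diag Xstar
        ** transpose (first_columns Q ** (sqrt_sing_diag Xstar :: ('r, 'r) rmat)) = U' ** transpose V'"
      unfolding X[symmetric] by (rule bal(2)[symmetric])
  qed
qed

text \<open>The rebalanced factors have the ranges of the products or of their transposes as column spaces,
  with a uniform gap; the solutions of the subproblems share these column spaces once the
  supports are stable.\<close>

lemma column_spaces_converge:
  assumes Xb: "Xb \<longlonglongrightarrow> Xstar" and Xh: "Xh \<longlonglongrightarrow> Xstar"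
  shows "painleve_kuratowski_converges (\<lambda>k. span (columns (U k))) (span (columns Xstar))"
    "painleve_kuratowski_converges (\<lambda>k. span (columns (Ub k))) (span (columns Xstar))"
    "painleve_kuratowski_converges (\<lambda>k. span (columns (Uh k))) (span (columns Xstar))"
    "painleve_kuratowski_converges (\<lambda>k. span (columns (V k))) (span (rows Xstar))"
    "painleve_kuratowski_converges (\<lambda>k. span (columns (Vb k))) (span (rows Xstar))"
    "painleve_kuratowski_converges (\<lambda>k. span (columns (Vh k))) (span (rows Xstar))"
proof -
  obtain c where c: "0 < c" "\<forall>\<^sub>F k in sequentially. column_gap c (Ub k) \<and> column_gap c (Vb k)"
    "\<forall>\<^sub>F k in sequentially. column_gap c (Uh (Suc k)) \<and> column_gap c (Vh (Suc k))"
    by (rule eventually_column_gap) blast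
  have hat_gap: "\<forall>\<^sub>F k in sequentially. column_gap c (Uh k) \<and> column_gap c (Vh k)"
    using c(3) eventually_sequentially_Suc[of "\<lambda>k. column_gap c (Uh k) \<and> column_gap c (Vh k)"] by simp
  have gap: "\<forall>\<^sub>F k in sequentially. column_gap c (Ub k)" "\<forall>\<^sub>F k in sequentially. column_gap c (Vb k)"
    "\<forall>\<^sub>F k in sequentially. column_gap c (Uh k)" "\<forall>\<^sub>F k in sequentially. column_gap c (Vh k)"
    using c(2) hat_gap by (auto simp: eventually_conj_iff)
  \<comment> \<open>The right orthonormal factor of the hatted iterate uses the barred one of the previous round.\<close>
  define Qh' where "Qh' k = Pb (k - 1) ** Qh k" for k
  have hat: "balanced (Ph k) (Qh' k) (Dh k)" "Uh k = Ph k ** Dh k" "Vh k = Qh' k ** Dh k"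
    "Xh k = Uh k ** transpose (Vh k)" "span (columns (U k)) = span (columns (Uh k))"
    "span (columns (V k)) = span (columns (Vb k))" if k: "Suc kbar \<le> k" for k
  proof -
    obtain l where l: "k = Suc l" "kbar \<le> l" using k by (cases k) auto
    have sl: "kbar \<le> Suc l" using l(2) by simp
    show "balanced (Ph k) (Qh' k) (Dh k)" "Uh k = Ph k ** Dh k" "Vh k = Qh' k ** Dh k"
      "Xh k = Uh k ** transpose (Vh k)"
      unfolding l(1) Qh'_def using balanced_hat[of l] step_U(7-9)[of l] by auto
    show "span (columns (U k)) = span (columns (Uh k))"
      unfolding l(1) using supports(5,6)[OF l(2)] supports(2)[OF sl] by (intro span_U) simp
    show "span (columns (V k)) = span (columns (Vb k))"
      unfolding l(1) using supports(1,3)[OF sl] by (intro span_V) simp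
  qed
  have rows: "span (rows Xstar) = span (columns (transpose Xstar))" by simp
  have flip: "transpose (A ** transpose B) = B ** transpose A"
    for A :: "('n, 'r) rmat" and B :: "('m, 'r) rmat"
    by (simp add: matrix_transpose_mul)
  note bar_U = painleve_kuratowski_balanced[OF Xb c(1) gap(1), of 0, OF balanced_bar bar_eq]
  note bar_V = painleve_kuratowski_balanced[OF tendsto_transpose[OF Xb] c(1) gap(2),
      OF balanced_swap[OF balanced_bar] bar_eq(2,1), folded rows]
  note hat_U = painleve_kuratowski_balanced[OF Xh c(1) gap(3), of "Suc kbar", OF hat(1-4)]
  note hat_V = painleve_kuratowski_balanced[OF tendsto_transpose[OF Xh] c(1) gap(4), of "Suc kbar",
      OF balanced_swap[OF hat(1)] hat(3,2), folded rows]
  have "transpose (Xb k) = Vb k ** transpose (Ub k)" for k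
    unfolding bar_eq(3) by (rule flip)
  then show "painleve_kuratowski_converges (\<lambda>k. span (columns (Vb k))) (span (rows Xstar))"
    "painleve_kuratowski_converges (\<lambda>k. span (columns (V k))) (span (rows Xstar))"
    using hat(6) by (auto intro: bar_V[of 0] bar_V[of "Suc kbar"])
  have "transpose (Xh k) = Vh k ** transpose (Uh k)" if "Suc kbar \<le> k" for k
    unfolding hat(4)[OF that] by (rule flip)
  then show "painleve_kuratowski_converges (\<lambda>k. span (columns (Vh k))) (span (rows Xstar))"
    by (intro hat_V) auto
  show "painleve_kuratowski_converges (\<lambda>k. span (columns (Ub k))) (span (columns Xstar))"
    by (rule bar_U) simp
  show "painleve_kuratowski_converges (\<lambda>k. span (columns (Uh k))) (span (columns Xstar))"
    by (rule hat_U) simp_all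
  show "painleve_kuratowski_converges (\<lambda>k. span (columns (U k))) (span (columns Xstar))"
    by (rule hat_U) (simp_all add: hat(5))
qed

end

theorem theorem7:
  fixes f :: "('n::{finite,linorder}, 'm::{finite,linorder}) rmat \<Rightarrow> real"
    and gradf :: "('n, 'm) rmat \<Rightarrow> ('n, 'm) rmat"
    and \<theta> :: "real \<Rightarrow> ereal"
    and Lf lam \<mu> \<rho> \<gamma>low1 \<gamma>low2 \<beta> cs :: real
    and \<gamma>1 \<gamma>2 :: "nat \<Rightarrow> real"
    and U Uh Ub Ph :: "nat \<Rightarrow> ('n, 'r::{finite,linorder}) rmat"
    and V Vh Vb Pb :: "nat \<Rightarrow> ('m, 'r) rmat"
    and Xh Xb :: "nat \<Rightarrow> ('n, 'm) rmat"
    and Dh Qh Db Qb :: "nat \<Rightarrow> ('r, 'r) rmat"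
    and kbar ktil rbar :: nat
  assumes "CARD('n) \<le> CARD('m)" and "CARD('r) \<le> CARD('n)"
    and "0 < lam" and "0 < \<mu>"
    and "bdd_below (range f)"
    and "\<And>X. GDERIV f X :> gradf X"
    and "Lf-lipschitz_on UNIV gradf"
    and "penalty_fun \<theta>"
    and "alt_min_run f gradf Lf \<theta> lam \<mu> \<rho> \<gamma>low1 \<gamma>low2 \<gamma>1 \<gamma>2
           U V Uh Vh Xh Ph Dh Qh Ub Vb Xb Pb Db Qb"
    and "KL_function (objective f \<theta> lam \<mu> :: ('n, 'r) rmat \<times> ('m, 'r) rmat \<Rightarrow> ereal)"
    and "balanced_factorization_optimal TYPE('n \<times> 'm) \<theta>"
    and "0 < \<beta>"
    and "\<And>k i. (scaling_matrix Lf \<mu> (Db k) (\<gamma>1 k) $ i $ i)\<^sup>2 \<le> \<beta>"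
    and "\<And>k i. (scaling_matrix Lf \<mu> (Dh (Suc k)) (\<gamma>2 k) $ i $ i)\<^sup>2 \<le> \<beta>"
    and "\<And>\<gamma>. \<gamma> \<in> {lam / \<beta> .. lam / (\<mu> + min \<gamma>low1 \<gamma>low2)} \<Longrightarrow> prox_gap \<theta> \<gamma>"
    and "stable_support_index U V Uh Vh Xh Ub Vb Xb kbar"
    and "\<exists>Uh' Vh' Ub' Vb' Xh' Xb'.
           (Uh', Vh', Ub', Vb', Xh', Xb')
             \<in> cluster_points (\<lambda>k. (Uh k, Vh k, Ub k, Vb k, Xh k, Xb k)) \<and>
           rbar = card (nonzero_columns Ub')"
    and "kbar \<le> ktil" and "sing_val_gap_index Xh Xb rbar ktil"
    and "0 < cs"
    and "\<And>k. ktil \<le> k \<Longrightarrow>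
           dist_zero (limiting_subdiff (objective f \<theta> lam \<mu>) (Ub (Suc k), Vb (Suc k)))
           \<le> ereal (cs * (norm (Xb (Suc k) - Xb k) + norm (Xh (Suc k) - Xb (Suc k)))
                    + cs * (norm (U (Suc k) - Ub k) + norm (V (Suc k) - Vh (Suc k))))"
  shows "\<exists>Xstar. Xb \<longlonglongrightarrow> Xstar \<and> Xh \<longlonglongrightarrow> Xstar \<and>
           (\<forall>(P, Q) \<in> svd_pairs Xstar.
              stationary_point f \<theta> lam \<mu>
                (first_columns P ** sqrt_sing_diag Xstar :: ('n, 'r) rmat)
                (first_columns Q ** sqrt_sing_diag Xstar :: ('m, 'r) rmat)) \<and>
           painleve_kuratowski_converges (\<lambda>k. span (columns (U k))) (span (columns Xstar)) \<and>
           painleve_kuratowski_converges (\<lambda>k. span (columns (Ub k))) (span (columns Xstar)) \<and>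
           painleve_kuratowski_converges (\<lambda>k. span (columns (Uh k))) (span (columns Xstar)) \<and>
           painleve_kuratowski_converges (\<lambda>k. span (columns (V k))) (span (rows Xstar)) \<and>
           painleve_kuratowski_converges (\<lambda>k. span (columns (Vb k))) (span (rows Xstar)) \<and>
           painleve_kuratowski_converges (\<lambda>k. span (columns (Vh k))) (span (rows Xstar))"
proof -
  interpret stable_alternating_minimization f gradf \<theta> Lf lam \<mu> \<rho> \<gamma>low1 \<gamma>low2 \<gamma>1 \<gamma>2
    U Uh Ub Ph V Vh Vb Pb Xh Xb Dh Qh Db Qb \<beta> kbar
    by unfold_locales (fact assms)+
  obtain Xstar where lim: "Xb \<longlonglongrightarrow> Xstar" "Xh \<longlonglongrightarrow> Xstar"
    by (rule products_converge[OF summable_step_size[OF assms(10,20,21)]])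
  have "\<forall>(P, Q) \<in> svd_pairs Xstar.
              stationary_point f \<theta> lam \<mu>
                (first_columns P ** sqrt_sing_diag Xstar :: ('n, 'r) rmat)
                (first_columns Q ** sqrt_sing_diag Xstar :: ('m, 'r) rmat)"
    using limit_stationary[OF lim(1)] by blast
  with lim column_spaces_converge[OF lim] show ?thesis by blast
qed

end
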